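(* Consider the Bayesian mixture model with a prior on the number of components described in the context, with $\boldsymbol{\theta} := (W,V)$ the random parameter. Assume the following conditions on the component family: (1) for every measurable $A\subseteq\mathcal{X}$, the function $v\mapsto F_v(A)$ is measurable on $\mathcal{V}$; (2) (finite mixture identifiability) for all $k,k'\in\{1,2,\ldots\}$, $w\in\Delta_k$, $w'\in\Delta_{k'}$, $v\in\mathcal{V}^k$, $v'\in\mathcal{V}^{k'}$, if $P_{w,v}=P_{w',v'}$ then $\sum_{i=1}^k w_i\delta_{v_i}=\sum_{i=1}^{k'} w'_i\delta_{v'_i}$, where $\delta_x$ is the unit point mass at $x$; and the following conditions on the prior, for all $k\in\{1,2,\ldots\}$: (3) $\mathbb{P}(K=k)>0$; (4) for all measurable $A\subseteq\Delta_k$, if $\mathbb{P}(W\in A\mid K=k)=0$ then $\{w_{1:k-1}:w\in A\}$ has Lebesgue measure zero, where $w_{1:k-1}=(w_1,\ldots,w_{k-1})$; (5) for all measurable $A\subseteq\mathcal{V}^k$, if $\sum_{\sigma\in S_k}\mathbb{P}(V_\sigma\in A\mid K=k)=0$ then $A$ has Lebesgue measure zero, where $V_\sigma=(V_{\sigma_1},\ldots,V_{\sigma_k})$; (6) $\mathbb{P}(V_i=V_j\mid K=k)=0$ for all $1\le i<j\le k$. Then there exists $\Theta_*\subseteq\Theta$ such that $\mathbb{P}(\boldsymbol{\theta}\in\Theta_* )=1$, $\lambda(\Theta\setminus\Theta_* )=0$, and, for all $\theta_0\in\Theta_*$, if $X_1,X_2,\ldots\sim P_{\theta_0}$ i.i.d.,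 then for all $\varepsilon>0$, $$\lim_{n\to\infty}\mathbb{P}\big(\boldsymbol{\theta}\in\tilde{B}(\theta_0,\varepsilon)\mid X_1,\ldots,X_n\big)=1\quad\text{a.s.}[P_{\theta_0}]$$ and $$\lim_{n\to\infty}\mathbb{P}\big(K=k(\theta_0)\mid X_1,\ldots,X_n\big)=1\quad\text{a.s.}[P_{\theta_0}].$$
   Context: Setting. $(F_v:v\in\mathcal{V})$ is a family of probability measures on $\mathcal{X}$, where $\mathcal{V}\subseteq\mathbb{R}^D$ is (Borel) measurable and $\mathcal{X}$ is a Borel measurable subset of a complete separable metric space, equipped with its Borel sigma-algebra. Each $\mathbb{R}^d$ has the Euclidean topology and its Borel sigma-algebra. For $k\in\{1,2,\ldots\}$ let $\Delta_k:=\{w\in(0,1]^k:\sum_{i=1}^k w_i=1\}\subseteq\mathbb{R}^k$ (so $\Delta_1=\{1\}$ and, for $k\ge 2$, all coordinates lie in $(0,1)$). For $w\in\Delta_k$ and $v\in\mathcal{V}^k$, let $P_{w,v}:=\sum_{i=1}^k w_iF_{v_i}$, a probability measure on $\mathcal{X}$. Model. Let $\pi$, $D_k$, $G_k$ be probability measures on $\{1,2,\ldots\}$, $\Delta_k$, $\mathcal{V}^k$, respectively (for each $k\ge1$). The model is: $K\sim\pi$; given $K=k$, $W=(W_1,\ldots,W_k)\sim D_k$ and $V=(V_1,\ldots,V_k)\sim G_k$, with $W$ and $V$ conditionally independent given $K$; and given $(W,V)$, the observations $X_1,X_2,\ldots$ are i.i.d. from $P_{W,V}$. $\mathbb{P}$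 denotes probability under this model; $\mathbb{P}(W\in\cdot\mid K=k)$ and $\mathbb{P}(V\in\cdot\mid K=k)$ mean $D_k$ and $G_k$. Parameter space. $\Theta_k:=\Delta_k\times\mathcal{V}^k$ and $\Theta:=\bigcup_{k=1}^\infty\Theta_k$ (a disjoint union). For $\theta=(w,v)\in\Theta$, $k(\theta)$ is the unique $k$ with $\theta\in\Theta_k$, and $P_\theta:=P_{w,v}$. Define the metric on $\Theta$ $$d_\Theta(\theta,\theta')=\begin{cases}\min\{\|\theta-\theta'\|,1\}&\text{if }k(\theta)=k(\theta'),\\ 1&\text{otherwise,}\end{cases}$$ where $\|\cdot\|$ is the Euclidean norm on $\Delta_k\times\mathcal{V}^k\subseteq\mathbb{R}^{k+kD}$; $\Theta$ carries the resulting Borel sigma-algebra. Permutations. $S_k$ is the set of permutations of $\{1,\ldots,k\}$. For $\sigma\in S_k$ and $\theta=(w,v)\in\Theta_k$, $\theta[\sigma]:=(w_\sigma,v_\sigma)$ with $w_\sigma=(w_{\sigma_1},\ldots,w_{\sigma_k})$, $v_\sigma=(v_{\sigma_1},\ldots,v_{\sigma_k})$. For $\theta_0\in\Theta_k$ and $\varepsilon>0$, $$\tilde{B}(\theta_0,\varepsilon):=\bigcup_{\sigma\in S_k}\{\theta\in\Theta:d_\Theta(\theta,\theta_0[\sigma])<\varepsilon\}.$$ Lebesgue measure on $\Theta$. Let $\lambda_{\mathcal{V}^k}$ be Lebesgue measure on $\mathcal{V}^k\subseteq\mathbb{R}^{kD}$, and let $\lambda_{\Delta_k}$ be the measure on $\Delta_k$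 such that, for measurable $A\subseteq\Delta_k$, $\lambda_{\Delta_k}(A)$ is the Lebesgue measure of $\{w_{1:k-1}:w\in A\}\subseteq\mathbb{R}^{k-1}$ (for $k=1$, Lebesgue measure on the one-point space $\mathbb{R}^0$ is the unit point mass). For measurable $A\subseteq\Theta$, $\lambda(A):=\sum_{k=1}^\infty(\lambda_{\Delta_k}\times\lambda_{\mathcal{V}^k})(A\cap\Theta_k)$. Posterior. The conditional probabilities $\mathbb{P}(\,\cdot\mid X_1,\ldots,X_n)$ are those of the assumed model, i.e. given by a (fixed for each $n$) regular conditional distribution of $\boldsymbol{\theta}$ given $X_1,\ldots,X_n$ (with $K=k(\boldsymbol{\theta})$), evaluated at the data $X_1,\ldots,X_n$, which in the conclusion are drawn i.i.d. from $P_{\theta_0}$; "a.s.$[P_{\theta_0}]$" means almost surely when $X_1,X_2,\ldots$ are i.i.d. from $P_{\theta_0}$. *)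

theory Defs
  imports "HOL-Probability.Probability" "HOL-Combinatorics.Permutations"
begin

text \<open>
  Vectors with \<open>k\<close> entries are functions on \<open>nat\<close> that are extensional on \<open>{..<k}\<close>, so indices
  start at 0 and the first \<open>k - 1\<close> coordinates are those in \<open>{..<k - 1}\<close>. The Borel sigma-algebra
  and Lebesgue measure on $k$-fold powers are the finite products \<open>Pi\<^sub>M {..<k}\<close>; for \<open>k = 0\<close> that
  product is the unit point mass.
\<close>

definition prob_simplex :: "nat \<Rightarrow> (nat \<Rightarrow> real) set" where
  "prob_simplex k = {w \<in> {..<k} \<rightarrow>\<^sub>E {0<..1}. (\<Sum>i<k. w i) = 1}"

definition borel_simplex :: "nat \<Rightarrow> (nat \<Rightarrow> real) measure" where
  "borel_simplex k = restrict_space (Pi\<^sub>M {..<k} (\<lambda>_. borel)) (prob_simplex k)"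

definition borel_components :: "'v::euclidean_space set \<Rightarrow> nat \<Rightarrow> (nat \<Rightarrow> 'v) measure" where
  "borel_components V k = restrict_space (Pi\<^sub>M {..<k} (\<lambda>_. borel)) ({..<k} \<rightarrow>\<^sub>E V)"

text \<open>
  The measure \<open>\<Sum>i<k. w i * f (v i)\<close> on the measurable space of \<open>N\<close>. It is used both for the
  mixtures of the \<open>F v\<close> and, with \<open>f = return N\<close>, for the mixing measures
  \<open>\<Sum>i<k. w i * \<delta>\<^bsub>v i\<^esub>\<close>.
\<close>

definition mixture ::
  "'b measure \<Rightarrow> ('v \<Rightarrow> 'b measure) \<Rightarrow> nat \<Rightarrow> (nat \<Rightarrow> real) \<Rightarrow> (nat \<Rightarrow> 'v) \<Rightarrow> 'b measure" where
  "mixture N f k w v =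
     measure_of (space N) (sets N) (\<lambda>A. \<Sum>i<k. ennreal (w i) * emeasure (f (v i)) A)"

lemma space_mixture [simp]: "space (mixture N f k w v) = space N"
  by (simp add: mixture_def space_measure_of_conv)

lemma sets_mixture [simp, measurable_cong]: "sets (mixture N f k w v) = sets N"
  by (simp add: mixture_def)

lemma emeasure_mixture:
  fixes N :: "'a measure"
  assumes "\<And>i. i < k \<Longrightarrow> sets (f (v i)) = sets N" and A: "A \<in> sets N"
  shows "emeasure (mixture N f k w v) A = (\<Sum>i<k. ennreal (w i) * emeasure (f (v i)) A)"
  unfolding mixture_def
proof (rule emeasure_measure_of_sigma[OF sets.sigma_algebra_axioms _ _ A])
  show "positive (sets N) (\<lambda>A. \<Sum>i<k. ennreal (w i) * emeasure (f (v i)) A)"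
    by (simp add: positive_def)
  show "countably_additive (sets N) (\<lambda>A. \<Sum>i<k. ennreal (w i) * emeasure (f (v i)) A)"
  proof (rule countably_additiveI)
    fix B :: "nat \<Rightarrow> 'a set"
    assume B: "range B \<subseteq> sets N" "disjoint_family B"
    have "(\<Sum>n. \<Sum>i<k. ennreal (w i) * emeasure (f (v i)) (B n))
        = (\<Sum>i<k. \<Sum>n. ennreal (w i) * emeasure (f (v i)) (B n))"
      by (rule suminf_sum) auto
    also have "\<dots> = (\<Sum>i<k. ennreal (w i) * emeasure (f (v i)) (\<Union>n. B n))"
      using B assms(1) by (intro sum.cong) (auto simp: suminf_emeasure)
    finally show "(\<Sum>n. \<Sum>i<k. ennreal (w i) * emeasure (f (v i)) (B n))
        = (\<Sum>i<k. ennreal (w i) * emeasure (f (v i)) (\<Union>n. B n))" .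
  qed
qed

text \<open>A parameter carries its number of components, which makes the union over \<open>k\<close> disjoint.\<close>

type_synonym 'v param = "nat \<times> (nat \<Rightarrow> real) \<times> (nat \<Rightarrow> 'v)"

definition Theta :: "'v set \<Rightarrow> 'v param set" where
  "Theta V = {(k, w, v). 1 \<le> k \<and> w \<in> prob_simplex k \<and> v \<in> {..<k} \<rightarrow>\<^sub>E V}"

definition num_components :: "'v param \<Rightarrow> nat" where
  "num_components \<theta> = fst \<theta>"

definition mixture_param ::
  "'b measure \<Rightarrow> ('v \<Rightarrow> 'b measure) \<Rightarrow> 'v param \<Rightarrow> 'b measure" where
  "mixture_param N f = (\<lambda>(k, w, v). mixture N f k w v)"

definition dist_Theta :: "'v::euclidean_space param \<Rightarrow> 'v param \<Rightarrow> real" where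
  "dist_Theta = (\<lambda>(k, w, v) (k', w', v').
     if k = k'
     then min (sqrt ((\<Sum>i<k. (w i - w' i)\<^sup>2) + (\<Sum>i<k. (norm (v i - v' i))\<^sup>2))) 1
     else 1)"

lemma Metric_space_Theta: "Metric_space (Theta V) dist_Theta"
proof
  fix x y :: "'a param"
  show "0 \<le> dist_Theta x y"
    by (auto simp: dist_Theta_def split: prod.splits intro!: add_nonneg_nonneg sum_nonneg)
  show "dist_Theta x y = dist_Theta y x"
    by (auto simp: dist_Theta_def norm_minus_commute power2_commute split: prod.splits)
next
  fix x y :: "'a param"
  assume xy: "x \<in> Theta V" "y \<in> Theta V"
  obtain k w v k' w' v' where [simp]: "x = (k, w, v)" "y = (k', w', v')"
    by (metis prod_cases3)
  have "w = w' \<and> v = v'"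
    if k: "k = k'" and
       0: "(\<Sum>i<k. (w i - w' i)\<^sup>2) + (\<Sum>i<k. (norm (v i - v' i))\<^sup>2) = 0"
  proof -
    have "(\<Sum>i<k. (w i - w' i)\<^sup>2) \<ge> 0" "(\<Sum>i<k. (norm (v i - v' i))\<^sup>2) \<ge> 0"
      by (auto intro!: sum_nonneg)
    with 0 have "(\<Sum>i<k. (w i - w' i)\<^sup>2) = 0" "(\<Sum>i<k. (norm (v i - v' i))\<^sup>2) = 0"
      by linarith+
    then have "\<forall>i<k. w i = w' i" "\<forall>i<k. v i = v' i"
      by (auto simp: sum_nonneg_eq_0_iff)
    moreover have "w \<in> {..<k} \<rightarrow>\<^sub>E {0<..1}" "w' \<in> {..<k} \<rightarrow>\<^sub>E {0<..1}"
      "v \<in> {..<k} \<rightarrow>\<^sub>E V" "v' \<in> {..<k} \<rightarrow>\<^sub>E V"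
      using xy k by (auto simp: Theta_def prob_simplex_def)
    ultimately show ?thesis
      by (metis PiE_ext lessThan_iff)
  qed
  then show "dist_Theta x y = 0 \<longleftrightarrow> x = y"
    by (auto simp: dist_Theta_def min_def split: if_splits)
next
  fix x y z :: "'a param"
  obtain k w v k' w' v' l a b
    where [simp]: "x = (k, w, v)" "y = (k', w', v')" "z = (l, a, b)"
    by (metis prod_cases3)
  define N where "N k w v w' v' =
    sqrt ((\<Sum>i<k. (w i - w' i)\<^sup>2) + (\<Sum>i<k. (norm (v i - v' i))\<^sup>2))"
    for k and w w' :: "nat \<Rightarrow> real" and v v' :: "nat \<Rightarrow> 'a"
  have N: "N k w v w' v' =
      L2_set (\<lambda>j. case j of Inl i \<Rightarrow> \<bar>w i - w' i\<bar> | Inr i \<Rightarrow> norm (v i - v' i))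
        ({..<k} <+> {..<k})" for k w w' v v'
    by (simp add: N_def L2_set_def sum.Plus)
  have tri: "norm (p - r) \<le> norm (p - q) + norm (q - r)" for p q r :: 'a
    by (rule norm_diff_triangle_le[OF order_refl order_refl])
  have "N k w v a b \<le> N k w v w' v' + N k w' v' a b"
    unfolding N
    by (rule order_trans[OF L2_set_mono L2_set_triangle_ineq]) (auto simp: tri split: sum.splits)
  moreover have "0 \<le> N k w v w' v'" for k w w' v v'
    by (auto simp: N_def intro!: add_nonneg_nonneg sum_nonneg)
  note this[of k w v w' v'] this[of k' w' v' a b] this[of k w v a b]
  moreover have "dist_Theta x y = (if k = k' then min (N k w v w' v') 1 else 1)"
    "dist_Theta y z = (if k' = l then min (N k' w' v' a b) 1 else 1)"
    "dist_Theta x z = (if k = l then min (N k w v a b) 1 else 1)"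
    by (simp_all add: dist_Theta_def N_def)
  ultimately show "dist_Theta x z \<le> dist_Theta x y + dist_Theta y z"
    by (cases "k = k'"; cases "k' = l"; cases "k = l") (simp_all add: min_def)
qed

definition borel_Theta :: "'v::euclidean_space set \<Rightarrow> 'v param measure" where
  "borel_Theta V =
     sigma (Theta V) {U. openin (Metric_space.mtopology (Theta V) dist_Theta) U}"

definition permute_param :: "(nat \<Rightarrow> nat) \<Rightarrow> 'v param \<Rightarrow> 'v param" where
  "permute_param \<sigma> = (\<lambda>(k, w, v). (k, \<lambda>i. w (\<sigma> i), \<lambda>i. v (\<sigma> i)))"

definition perm_ball :: "'v::euclidean_space set \<Rightarrow> 'v param \<Rightarrow> real \<Rightarrow> 'v param set" where
  "perm_ball V \<theta>\<^sub>0 \<epsilon> =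
     (\<Union>\<sigma>\<in>{\<sigma>. \<sigma> permutes {..<num_components \<theta>\<^sub>0}}.
        {\<theta> \<in> Theta V. dist_Theta \<theta> (permute_param \<sigma> \<theta>\<^sub>0) < \<epsilon>})"

definition drop_last_coord :: "nat \<Rightarrow> (nat \<Rightarrow> real) \<Rightarrow> (nat \<Rightarrow> real)" where
  "drop_last_coord k w = restrict w {..<k - 1}"

definition lebesgue_simplex :: "nat \<Rightarrow> (nat \<Rightarrow> real) measure" where
  "lebesgue_simplex k = measure_of (prob_simplex k) (sets (borel_simplex k))
     (\<lambda>A. emeasure (Pi\<^sub>M {..<k - 1} (\<lambda>_. lborel)) (drop_last_coord k ` A))"

lemma space_borel_simplex [simp]: "space (borel_simplex k) = prob_simplex k"
  by (auto simp: borel_simplex_def space_restrict_space space_PiM prob_simplex_def)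

lemma prob_simplex_sets: "prob_simplex k \<in> sets (Pi\<^sub>M {..<k} (\<lambda>_. borel))"
proof -
  have "prob_simplex k = {w \<in> space (Pi\<^sub>M {..<k} (\<lambda>_. borel)).
      (\<forall>i\<in>{..<k}. 0 < w i \<and> w i \<le> 1) \<and> (\<Sum>i<k. w i) = 1}"
    by (auto simp: prob_simplex_def space_PiM PiE_iff)
  also have "\<dots> \<in> sets (Pi\<^sub>M {..<k} (\<lambda>_. borel))"
    by measurable
  finally show ?thesis .
qed

lemma prob_simplex_eqI:
  assumes w: "w \<in> prob_simplex k" and w': "w' \<in> prob_simplex k"
    and eq: "drop_last_coord k w = drop_last_coord k w'"
  shows "w = w'"
proof (cases k)
  case 0
  with w show ?thesis by (simp add: prob_simplex_def)
next
  case (Suc m)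
  have *: "w i = w' i" if "i < m" for i
    using fun_cong[OF eq, of i] that Suc by (simp add: drop_last_coord_def)
  then have "(\<Sum>i<m. w i) = (\<Sum>i<m. w' i)"
    by (intro sum.cong) auto
  moreover have "(\<Sum>i<m. w i) + w m = 1" "(\<Sum>i<m. w' i) + w' m = 1"
    using w w' Suc by (auto simp: prob_simplex_def)
  ultimately have "w m = w' m" by simp
  with * have "w i = w' i" if "i < k" for i
    using that Suc by (cases "i = m") auto
  moreover have "w \<in> {..<k} \<rightarrow>\<^sub>E {0<..1}" "w' \<in> {..<k} \<rightarrow>\<^sub>E {0<..1}"
    using w w' by (auto simp: prob_simplex_def)
  ultimately show ?thesis
    by (metis PiE_ext lessThan_iff)
qed

lemma drop_last_coord_image_sets:
  assumes A: "A \<in> sets (borel_simplex k)"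
  shows "drop_last_coord k ` A \<in> sets (Pi\<^sub>M {..<k - 1} (\<lambda>_. lborel))"
proof (cases k)
  case 0
  have "A \<subseteq> prob_simplex k"
    using sets.sets_into_space[OF A] by simp
  with 0 have "A = {}" by (auto simp: prob_simplex_def)
  then show ?thesis by simp
next
  case (Suc m)
  define g where "g u = (\<lambda>i\<in>{..<k}. if i < m then u i else 1 - (\<Sum>j<m. u j))"
    for u :: "nat \<Rightarrow> real"
  have A': "A \<in> sets (Pi\<^sub>M {..<k} (\<lambda>_. borel))" "A \<subseteq> prob_simplex k"
    using A prob_simplex_sets[of k]
    by (auto simp: borel_simplex_def sets_restrict_space_iff prob_simplex_def
        dest: sets.sets_into_space)
  have g [measurable]: "g \<in> Pi\<^sub>M {..<m} (\<lambda>_. borel) \<rightarrow>\<^sub>M Pi\<^sub>M {..<k} (\<lambda>_. borel)"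
    unfolding g_def
  proof (rule measurable_restrict)
    fix i
    have *: "(\<lambda>u. 1 - (\<Sum>j<m. u j)) \<in> borel_measurable (Pi\<^sub>M {..<m} (\<lambda>_. borel :: real measure))"
      by (intro borel_measurable_diff borel_measurable_sum borel_measurable_const
          measurable_component_singleton)
    show "(\<lambda>u :: nat \<Rightarrow> real. if i < m then u i else 1 - (\<Sum>j<m. u j)) \<in> borel_measurable (Pi\<^sub>M {..<m} (\<lambda>_. borel))"
    proof (cases "i < m")
      case True
      then show ?thesis by simp
    next
      case False
      show ?thesis unfolding if_not_P[OF False] by (rule *)
    qed
  qed
  have gr: "g (drop_last_coord k w) = w" if "w \<in> prob_simplex k" for w
  proof
    fix i
    have "w i = undefined" if "i \<ge> k"
      using \<open>w \<in> prob_simplex k\<close> that by (auto simp: prob_simplex_def PiE_def extensional_def)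
    moreover have "(\<Sum>i<m. w i) + w m = 1"
      using that Suc by (simp add: prob_simplex_def)
    ultimately show "g (drop_last_coord k w) i = w i"
      using Suc by (cases "i = m") (auto simp: g_def drop_last_coord_def)
  qed
  have rg: "drop_last_coord k (g u) = u" if "u \<in> space (Pi\<^sub>M {..<m} (\<lambda>_. borel))" for u
    using that Suc
    by (auto simp: drop_last_coord_def g_def space_PiM PiE_def extensional_def fun_eq_iff)
  have sp: "drop_last_coord k w \<in> space (Pi\<^sub>M {..<m} (\<lambda>_. borel))" for w :: "nat \<Rightarrow> real"
    using Suc by (simp add: drop_last_coord_def space_PiM)
  have "drop_last_coord k ` A = g -` A \<inter> space (Pi\<^sub>M {..<m} (\<lambda>_. borel))"
  proof (intro equalityI subsetI)
    fix u assume "u \<in> drop_last_coord k ` A"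
    then obtain w where "w \<in> A" "u = drop_last_coord k w" by auto
    with A'(2) gr sp show "u \<in> g -` A \<inter> space (Pi\<^sub>M {..<m} (\<lambda>_. borel))"
      by auto
  next
    fix u assume "u \<in> g -` A \<inter> space (Pi\<^sub>M {..<m} (\<lambda>_. borel))"
    then show "u \<in> drop_last_coord k ` A"
      using rg[of u] by (metis IntE image_eqI vimageE)
  qed
  also have "\<dots> \<in> sets (Pi\<^sub>M {..<m} (\<lambda>_. borel))"
    using g A'(1) by (rule measurable_sets)
  also have "sets (Pi\<^sub>M {..<m} (\<lambda>_. borel)) = sets (Pi\<^sub>M {..<m} (\<lambda>_. lborel :: real measure))"
    by (intro sets_PiM_cong) auto
  finally show ?thesis using Suc by simp
qed

lemma emeasure_lebesgue_simplex:
  assumes A: "A \<in> sets (borel_simplex k)"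
  shows "emeasure (lebesgue_simplex k) A =
    emeasure (Pi\<^sub>M {..<k - 1} (\<lambda>_. lborel)) (drop_last_coord k ` A)" (is "_ = ?\<mu> A")
proof -
  have sub: "B \<subseteq> prob_simplex k" if "B \<in> sets (borel_simplex k)" for B
    using sets.sets_into_space[OF that] by simp
  have "sigma_algebra (prob_simplex k) (sets (borel_simplex k))"
    using sets.sigma_algebra_axioms[of "borel_simplex k"] by simp
  moreover have "positive (sets (borel_simplex k)) ?\<mu>"
    by (simp add: positive_def)
  moreover have "countably_additive (sets (borel_simplex k)) ?\<mu>"
  proof (rule countably_additiveI)
    fix B :: "nat \<Rightarrow> (nat \<Rightarrow> real) set"
    assume B: "range B \<subseteq> sets (borel_simplex k)" "disjoint_family B"
    have "disjoint_family (\<lambda>n. drop_last_coord k ` B n)"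
      unfolding disjoint_family_on_def
    proof (intro ballI impI, rule ccontr)
      fix m n :: nat
      assume "m \<noteq> n" "drop_last_coord k ` B m \<inter> drop_last_coord k ` B n \<noteq> {}"
      then obtain w w' where "w \<in> B m" "w' \<in> B n" "drop_last_coord k w = drop_last_coord k w'"
        by auto
      moreover from this B(1) sub have "w \<in> prob_simplex k" "w' \<in> prob_simplex k"
        by blast+
      ultimately have "w \<in> B m \<inter> B n"
        using prob_simplex_eqI by blast
      with B(2) \<open>m \<noteq> n\<close> show False
        by (auto simp: disjoint_family_on_def)
    qed
    then show "(\<Sum>n. ?\<mu> (B n)) = ?\<mu> (\<Union>n. B n)"
      using B(1) drop_last_coord_image_sets
      by (subst suminf_emeasure) (auto simp: image_UN)
  qed
  ultimately show ?thesis
    unfolding lebesgue_simplex_def using A by (intro emeasure_measure_of_sigma)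
qed

definition lebesgue_components :: "'v::euclidean_space set \<Rightarrow> nat \<Rightarrow> (nat \<Rightarrow> 'v) measure" where
  "lebesgue_components V k = restrict_space (Pi\<^sub>M {..<k} (\<lambda>_. lborel)) ({..<k} \<rightarrow>\<^sub>E V)"

text \<open>A set function, to be applied to measurable subsets of \<open>Theta V\<close> only.\<close>

definition lebesgue_Theta :: "'v::euclidean_space set \<Rightarrow> 'v param set \<Rightarrow> ennreal" where
  "lebesgue_Theta V A =
     (\<Sum>j. let k = Suc j in
        emeasure (lebesgue_simplex k \<Otimes>\<^sub>M lebesgue_components V k) {(w, v). (k, w, v) \<in> A})"

definition prior ::
  "'v::euclidean_space set \<Rightarrow> nat measure \<Rightarrow> (nat \<Rightarrow> (nat \<Rightarrow> real) measure) \<Rightarrow>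
   (nat \<Rightarrow> (nat \<Rightarrow> 'v) measure) \<Rightarrow> 'v param measure" where
  "prior V \<pi> D G =
     \<pi> \<bind> (\<lambda>k. distr (D k \<Otimes>\<^sub>M G k) (borel_Theta V) (\<lambda>(w, v). (k, w, v)))"

text \<open>
  Joint law of the parameter and of the infinite sequence of observations. Entry \<open>i\<close> of the
  sequence is the observation $X_{i+1}$.
\<close>

definition model ::
  "'v::euclidean_space set \<Rightarrow> 'x measure \<Rightarrow> ('v \<Rightarrow> 'x measure) \<Rightarrow> nat measure \<Rightarrow>
   (nat \<Rightarrow> (nat \<Rightarrow> real) measure) \<Rightarrow> (nat \<Rightarrow> (nat \<Rightarrow> 'v) measure) \<Rightarrow>
   ('v param \<times> (nat \<Rightarrow> 'x)) measure" where
  "model V N F \<pi> D G =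
     prior V \<pi> D G \<bind> (\<lambda>\<theta>.
       distr (Pi\<^sub>M UNIV (\<lambda>_. mixture_param N F \<theta>)) (borel_Theta V \<Otimes>\<^sub>M Pi\<^sub>M UNIV (\<lambda>_. N))
         (\<lambda>x. (\<theta>, x)))"

text \<open>
  \<open>Q\<close> is a regular conditional distribution of \<open>Y\<close> given \<open>X\<close>: a probability kernel such that
  \<open>Q (X \<omega>) A\<close> is a version of the conditional probability of \<open>Y \<in> A\<close> given the sigma-algebra
  generated by \<open>X\<close>.
\<close>

definition regular_cond_distr ::
  "'a measure \<Rightarrow> 'b measure \<Rightarrow> ('a \<Rightarrow> 'b) \<Rightarrow> 'c measure \<Rightarrow> ('a \<Rightarrow> 'c) \<Rightarrow> ('b \<Rightarrow> 'c measure) \<Rightarrow> bool"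
  where
  "regular_cond_distr M S X T Y Q \<longleftrightarrow>
     Q \<in> S \<rightarrow>\<^sub>M prob_algebra T \<and>
     (\<forall>A\<in>sets T. AE \<omega> in M. measure (Q (X \<omega>)) A =
        real_cond_exp M (vimage_algebra (space M) X S) (\<lambda>\<omega>. indicator A (Y \<omega>)) \<omega>)"

definition obs :: "nat \<Rightarrow> (nat \<Rightarrow> 'x) \<Rightarrow> (nat \<Rightarrow> 'x)" where
  "obs n x = restrict x {..<n}"

end

theory Submission
  imports Defs
begin

text \<open>
  The proof follows Doob's idea: under the model, the data determine the parameter up to a
  permutation of its components, so posterior probabilities of permutation-invariant events
  converge to 0 or 1 by martingale convergence.

  In detail, let \<open>B\<close> be a measurable set of parameters that is invariant under permutations. The
  posterior probability of \<open>B\<close> given \<open>X\<^sub>1, \<dots>, X\<^sub>n\<close> is a conditional expectation of the indicator of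
  \<open>B\<close>. If that indicator is almost surely a function of the whole sequence of observations, Levy's
  upward theorem (\<open>levy_upward\<close>) says that these conditional expectations converge to the indicator
  almost surely (\<open>posterior_tendsto\<close>).

  The indicator of \<open>B\<close> is a function of the observations for the following reason
  (\<open>invariant_event_determined_by_data\<close>). Empirical frequencies of countably many sets \<open>A j\<close> that form
  an intersection-stable generator converge to the numbers \<open>P\<^sub>\<theta> (A j)\<close>, and these numbers
  determine \<open>P\<^sub>\<theta>\<close>. By identifiability they determine \<open>\<theta>\<close> up to a permutation, provided the
  components of \<open>\<theta>\<close> are distinct, which is almost surely the case. This only yields that
  \<open>B\<close> is the preimage of some set under the statistic \<open>T \<theta> = (P\<^sub>\<theta> (A j))\<^sub>j\<close>; that the set can be taken to be
  Borel, up to a null event, is usually quoted from descriptive set theory (Borel images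
  under injective Borel maps). Here a measure-theoretic argument suffices
  (\<open>ae_separated_by_borel_statistic\<close>): the law of the pair \<open>(\<theta>, T \<theta>)\<close> is inner regular, the graph of
  \<open>T\<close> over \<open>B\<close> is exhausted up to a null set by compact sets, and projections of compact sets are
  compact, hence Borel.

  Applying this to the countably many permutation-saturations of the members of a topological
  basis, and using Fubini, gives a set \<open>\<Theta>s\<close> of prior probability 1 at which the posterior
  concentrates on every \<open>perm_ball\<close>. For a radius at most 1 such a ball only contains parameters with the
  true number of components, which is the second claim.

  It remains to pass from the prior to Lebesgue measure (\<open>lebesgue_Theta_null\<close>). The exceptional set \<open>E\<close> is
  invariant under simultaneous permutations of weights and components. For Lebesgue almost every
  \<open>w\<close>, all rearrangements of \<open>w\<close> have sections of \<open>E\<close> that are null for the prior on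
  the components, because the null sets of the simplex are invariant under permutations
  (\<open>null_simplex_permute\<close>). By invariance of \<open>E\<close> this says that the section at \<open>w\<close> is null for
  all rearrangements of the prior on the components, so it is Lebesgue null.
\<close>

section \<open>Convergence of conditional probabilities along a filtration\<close>

locale prob_filtration = prob_space M for M :: "'a measure" +
  fixes F :: "nat \<Rightarrow> 'a measure"
  assumes subalgebra_F: "subalgebra M (F n)"
    and F_mono: "m \<le> n \<Longrightarrow> sets (F m) \<subseteq> sets (F n)"
begin

lemma space_F [simp]: "space (F n) = space M"
  using subalgebra_F[of n] by (simp add: subalgebra_def)

lemma sets_F_sets: "A \<in> sets (F n) \<Longrightarrow> A \<in> sets M"
  using subalgebra_F[of n] by (auto simp: subalgebra_def)

sublocale subalg: finite_measure_subalgebra M "F n" for n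
  by unfold_locales (rule subalgebra_F)

lemma measurable_F_cond_exp: "m \<le> n \<Longrightarrow> real_cond_exp M (F m) f \<in> borel_measurable (F n)"
  using F_mono[of m n]
  by (intro measurable_from_subalg[of "F n" "F m"] borel_measurable_cond_exp) (simp add: subalgebra_def)

text \<open>
  Doob's maximal inequality: split the event according to the first time at which the
  conditional expectation reaches \<open>c\<close>. That first time being \<open>n\<close> is an event of \<open>F n\<close>, on which the
  conditional expectation may be replaced by \<open>h\<close> under the integral.
\<close>

lemma maximal_inequality:
  assumes int: "integrable M h" and nonneg: "\<And>x. h x \<ge> 0" and c: "c > 0"
  shows "measure M {x\<in>space M. \<exists>n. real_cond_exp M (F n) h x \<ge> c} \<le> (\<integral>x. h x \<partial>M) / c"
proof -
  let ?E = "\<lambda>n. real_cond_exp M (F n) h"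
  define S where "S n = {x\<in>space M. ?E n x \<ge> c \<and> (\<forall>i<n. ?E i x < c)}" for n
  have S_F: "S n \<in> sets (F n)" for n
  proof -
    have E_F: "?E i \<in> borel_measurable (F n)" if "i \<le> n" for i
      using that by (rule measurable_F_cond_exp)
    have 1: "{x\<in>space (F n). ?E n x \<ge> c} \<in> sets (F n)"
      by (rule borel_measurable_le[OF borel_measurable_const E_F]) simp
    have 2: "{x\<in>space (F n). ?E i x < c} \<in> sets (F n)" if "i \<in> {..<n}" for i
      by (rule borel_measurable_less[OF E_F borel_measurable_const]) (use that in simp)
    have "{x\<in>space (F n). ?E n x \<ge> c \<and> (\<forall>i\<in>{..<n}. ?E i x < c)} \<in> sets (F n)"
    proof (rule sets.sets_Collect_conj[OF _ 1], rule sets.sets_Collect_finite_All)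
      fix i assume "i \<in> {..<n}"
      then show "{x\<in>space (F n). ?E i x < c} \<in> sets (F n)" by (rule 2)
    qed simp
    then show ?thesis by (simp only: S_def space_F lessThan_iff Ball_def)
  qed
  then have S_M [measurable]: "S n \<in> sets M" for n by (rule sets_F_sets)
  have disj: "disjoint_family S"
    unfolding disjoint_family_on_def
  proof (intro ballI impI equals0I)
    fix m n :: nat and x assume "m \<noteq> n" "x \<in> S m \<inter> S n"
    then show False by (cases m n rule: linorder_cases) (auto simp: S_def not_le[symmetric])
  qed
  have Union: "{x\<in>space M. \<exists>n. ?E n x \<ge> c} = (\<Union>n. S n)"
  proof (intro set_eqI iffI)
    fix x assume x: "x \<in> {x\<in>space M. \<exists>n. ?E n x \<ge> c}"
    define n where "n = (LEAST n. ?E n x \<ge> c)"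
    have "?E n x \<ge> c" unfolding n_def using x by (auto intro: LeastI)
    moreover have "?E i x < c" if "i < n" for i
      using not_less_Least[of i "\<lambda>n. ?E n x \<ge> c"] that unfolding n_def by auto
    ultimately show "x \<in> (\<Union>n. S n)" using x by (auto simp: S_def)
  qed (auto simp: S_def)
  have bound: "c * measure M (S n) \<le> (\<integral>x. indicator (S n) x * h x \<partial>M)" for n
  proof -
    have intE: "integrable M (?E n)" using int by (rule subalg.real_cond_exp_int)
    have "c * measure M (S n) = (\<integral>x. indicator (S n) x * c \<partial>M)"
      by simp
    also have "\<dots> \<le> (\<integral>x. indicator (S n) x * ?E n x \<partial>M)"
    proof (rule integral_mono)
      show "integrable M (\<lambda>x. indicator (S n) x * c)"
        by (intro integrable_mult_left integrable_real_indicator) (auto simp: less_top[symmetric])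
      show "integrable M (\<lambda>x. indicator (S n) x * ?E n x)"
        using integrable_mult_indicator[OF S_M intE] by simp
    qed (auto simp: S_def indicator_def)
    also have "\<dots> = (\<integral>x. indicator (S n) x * h x \<partial>M)"
      using subalg.real_cond_exp_intA[OF int S_F, of n]
      unfolding set_lebesgue_integral_def by simp
    finally show ?thesis .
  qed
  have "c * (\<Sum>n<N. measure M (S n)) \<le> (\<integral>x. h x \<partial>M)" for N
  proof -
    have ii: "integrable M (\<lambda>x. indicator (S n) x * h x)" for n
      using integrable_mult_indicator[OF S_M int] by simp
    have "c * (\<Sum>n<N. measure M (S n)) \<le> (\<Sum>n<N. \<integral>x. indicator (S n) x * h x \<partial>M)"
      unfolding sum_distrib_left by (intro sum_mono bound)
    also have "\<dots> = (\<integral>x. (\<Sum>n<N. indicator (S n) x) * h x \<partial>M)"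
      unfolding sum_distrib_right by (rule Bochner_Integration.integral_sum[symmetric]) (rule ii)
    also have "\<dots> = (\<integral>x. indicator (\<Union>n<N. S n) x * h x \<partial>M)"
    proof -
      have "disjoint_family_on S {..<N}" using disj by (auto simp: disjoint_family_on_def)
      then show ?thesis by (subst indicator_UN_disjoint) auto
    qed
    also have "\<dots> \<le> (\<integral>x. h x \<partial>M)"
    proof (rule integral_mono)
      show "integrable M (\<lambda>x. indicator (\<Union>n<N. S n) x * h x)"
        using integrable_mult_indicator[OF _ int, of "\<Union>n<N. S n"] by simp
    qed (use int nonneg in \<open>auto simp: indicator_def\<close>)
    finally show ?thesis .
  qed
  then have le: "(\<Sum>n<N. measure M (S n)) \<le> (\<integral>x. h x \<partial>M) / c" for N
    using c by (simp add: field_simps)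
  have "(\<lambda>n. measure M (S n)) sums measure M (\<Union>n. S n)"
    using disj by (intro finite_measure_UNION) auto
  then show ?thesis
    unfolding Union sums_def by (rule LIMSEQ_le_const2) (use le in blast)
qed

text \<open>
  The sets that can be approximated by members of the filtration form a sigma-algebra: for a
  countable union, cut off the union at a finite stage and approximate each of the finitely many
  remaining sets. Measurability of \<open>C\<close> is part of the conclusion because the induction needs it.
\<close>

lemma approximation_by_filtration:
  assumes C: "C \<in> sigma_sets (space M) (\<Union>n. sets (F n))" and e: "e > 0"
  shows "C \<in> sets M \<and> (\<exists>n. \<exists>A\<in>sets (F n). measure M (sym_diff C A) < e)"
  using C e
proof (induction arbitrary: e rule: sigma_sets.induct)
  case (Basic a)
  then obtain n where n: "a \<in> sets (F n)" by auto
  show ?case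
  proof (intro conjI exI bexI)
    show "a \<in> sets M" using n by (rule sets_F_sets)
    show "measure M (sym_diff a a) < e" using Basic.prems by simp
  qed (rule n)
next
  case Empty
  show ?case
  proof (intro conjI exI bexI)
    show "measure M (sym_diff {} {}) < e" using Empty.prems by simp
  qed auto
next
  case (Compl a)
  from Compl.IH[OF Compl.prems] obtain n A where A: "A \<in> sets (F n)" "measure M (sym_diff a A) < e" "a \<in> sets M"
    by auto
  have "sym_diff (space M - a) (space M - A) = sym_diff a A"
    using sets.sets_into_space[OF A(3)] sets.sets_into_space[OF sets_F_sets[OF A(1)]] by auto
  then have "measure M (sym_diff (space M - a) (space M - A)) < e" using A(2) by simp
  moreover have "space M - A \<in> sets (F n)" using sets.compl_sets[OF A(1)] by simp
  ultimately show ?case using A(3) by blast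
next
  case (Union a)
  have a [measurable]: "a i \<in> sets M" for i using Union.IH[of 1 i] by simp
  have "(\<lambda>n. measure M (\<Union>i\<le>n. a i)) \<longlonglongrightarrow> measure M (\<Union>n. \<Union>i\<le>n. a i)"
    by (rule finite_Lim_measure_incseq) (auto simp: incseq_def intro: order_trans)
  also have "(\<Union>n. \<Union>i\<le>n. a i) = (\<Union>i. a i)" by auto
  finally have "eventually (\<lambda>n. measure M (\<Union>i\<le>n. a i) > measure M (\<Union>i. a i) - e / 2) sequentially"
    using Union.prems by (intro order_tendstoD) auto
  then obtain N where N: "measure M (\<Union>i\<le>N. a i) > measure M (\<Union>i. a i) - e / 2"
    by (auto simp: eventually_sequentially)
  have "\<exists>n A. A \<in> sets (F n) \<and> measure M (sym_diff (a i) A) < e / (2 * Suc N)" for i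
    using Union.IH[of "e / (2 * Suc N)" i] Union.prems by auto
  then obtain n A where A: "\<And>i. A i \<in> sets (F (n i))"
    "\<And>i. measure M (sym_diff (a i) (A i)) < e / (2 * Suc N)" by metis
  have A_M [measurable]: "A i \<in> sets M" for i using A(1) by (rule sets_F_sets)
  define m where "m = Max (n ` {..N})"
  have Am: "(\<Union>i\<le>N. A i) \<in> sets (F m)"
  proof (intro sets.finite_UN)
    fix i assume "i \<in> {..N}"
    then have "n i \<le> m" unfolding m_def by (intro Max_ge) auto
    then show "A i \<in> sets (F m)" using A(1) F_mono by blast
  qed auto
  have "measure M (sym_diff (\<Union>i. a i) (\<Union>i\<le>N. A i))
      \<le> measure M (((\<Union>i. a i) - (\<Union>i\<le>N. a i)) \<union> (\<Union>i\<le>N. sym_diff (a i) (A i)))"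
    by (intro finite_measure_mono) auto
  also have "\<dots> \<le> measure M ((\<Union>i. a i) - (\<Union>i\<le>N. a i)) + measure M (\<Union>i\<le>N. sym_diff (a i) (A i))"
    by (intro measure_Un_le) auto
  also have "\<dots> \<le> measure M ((\<Union>i. a i) - (\<Union>i\<le>N. a i)) + (\<Sum>i\<le>N. measure M (sym_diff (a i) (A i)))"
    by (intro add_left_mono measure_UNION_le) auto
  also have "measure M ((\<Union>i. a i) - (\<Union>i\<le>N. a i)) = measure M (\<Union>i. a i) - measure M (\<Union>i\<le>N. a i)"
    by (intro finite_measure_Diff) auto
  also have "\<dots> + (\<Sum>i\<le>N. measure M (sym_diff (a i) (A i))) < e / 2 + (\<Sum>i\<le>N. e / (2 * Suc N))"
    using N A(2) by (intro add_strict_mono sum_strict_mono) auto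
  also have "\<dots> = e" by (simp add: field_simps)
  finally have "measure M (sym_diff (\<Union>i. a i) (\<Union>i\<le>N. A i)) < e" .
  moreover have "(\<Union>i. a i) \<in> sets M" by simp
  ultimately show ?case using Am by blast
qed

text \<open>
  Levy's upward theorem for indicators. If \<open>A\<close> is a member of \<open>F m\<close> close to \<open>C\<close>, then from time \<open>m\<close> on
  the conditional probability of \<open>C\<close> differs from the indicator of \<open>A\<close> by at most the conditional
  probability of the symmetric difference \<open>D\<close>, which by the maximal inequality is uniformly small
  except on a small event.
\<close>

theorem levy_upward:
  assumes C: "C \<in> sigma_sets (space M) (\<Union>n. sets (F n))"
  shows "AE x in M. (\<lambda>n. real_cond_exp M (F n) (indicator C) x) \<longlonglongrightarrow> indicator C x"
proof -
  have C_M [measurable]: "C \<in> sets M" using approximation_by_filtration[OF C, of 1] by simp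
  define f where "f n x = real_cond_exp M (F n) (indicator C) x" for n x
  have f_M [measurable]: "f n \<in> borel_measurable M" for n unfolding f_def by simp
  have int_ind: "integrable M (indicator A :: _ \<Rightarrow> real)" if "A \<in> sets M" for A
    using that by (intro integrable_real_indicator) (auto simp: less_top[symmetric])
  define Bad where "Bad c = {x\<in>space M. \<forall>N. \<exists>n\<ge>N. \<bar>f n x - indicator C x\<bar> \<ge> c}" for c :: real
  have Bad_M [measurable]: "Bad c \<in> sets M" for c unfolding Bad_def by measurable
  have small: "measure M (Bad c) \<le> d * (1 / c + 1)" if c: "0 < c" "c \<le> 1" and d: "0 < d" for c d
  proof -
    obtain m A where A: "A \<in> sets (F m)" and Ad: "measure M (sym_diff C A) < d"
      using approximation_by_filtration[OF C d] by auto
    have A_M [measurable]: "A \<in> sets M" using A by (rule sets_F_sets)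
    define D where "D = sym_diff C A"
    have D_M [measurable]: "D \<in> sets M" unfolding D_def by simp
    let ?h = "indicator D :: 'a \<Rightarrow> real"
    define H where "H = {x\<in>space M. \<exists>n. real_cond_exp M (F n) ?h x \<ge> c}"
    have H_M [measurable]: "H \<in> sets M" unfolding H_def by measurable
    have *: "AE x in M. \<bar>f n x - indicator A x\<bar> \<le> real_cond_exp M (F n) ?h x" if "n \<ge> m" for n
    proof -
      have "A \<in> sets (F n)" using A F_mono[OF that] by auto
      then have 1: "AE x in M. real_cond_exp M (F n) (indicator A) x = (indicator A x :: real)"
        by (intro subalg.real_cond_exp_F_meas int_ind) auto
      have 2: "AE x in M. real_cond_exp M (F n) (\<lambda>x. indicator C x - indicator A x) x =
          real_cond_exp M (F n) (indicator C) x - real_cond_exp M (F n) (indicator A) x"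
        by (intro subalg.real_cond_exp_diff int_ind) auto
      have 3: "AE x in M. real_cond_exp M (F n) (\<lambda>x. indicator C x - indicator A x) x \<le> real_cond_exp M (F n) ?h x"
        by (intro subalg.real_cond_exp_mono int_ind Bochner_Integration.integrable_diff)
          (auto simp: D_def indicator_def)
      have 4: "AE x in M. real_cond_exp M (F n) (\<lambda>x. - 1 * ?h x) x \<le> real_cond_exp M (F n) (\<lambda>x. indicator C x - indicator A x) x"
        by (intro subalg.real_cond_exp_mono int_ind Bochner_Integration.integrable_diff integrable_mult_right)
          (auto simp: D_def indicator_def)
      have 5: "AE x in M. real_cond_exp M (F n) (\<lambda>x. - 1 * ?h x) x = - 1 * real_cond_exp M (F n) ?h x"
        by (intro subalg.real_cond_exp_cmult int_ind) auto
      show ?thesis using 1 2 3 4 5 by eventually_elim (auto simp: f_def)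
    qed
    have "AE x in M. \<forall>n. n \<ge> m \<longrightarrow> \<bar>f n x - indicator A x\<bar> \<le> real_cond_exp M (F n) ?h x"
      unfolding AE_all_countable using * by auto
    then have "AE x in M. x \<in> Bad c \<longrightarrow> x \<in> H \<union> D"
    proof eventually_elim
      case (elim x)
      show ?case
      proof (intro impI, rule ccontr)
        assume x: "x \<in> Bad c" "x \<notin> H \<union> D"
        then obtain n where n: "n \<ge> m" "\<bar>f n x - indicator C x\<bar> \<ge> c" by (auto simp: Bad_def)
        have "indicator C x = (indicator A x :: real)" using x by (auto simp: D_def indicator_def)
        then have "real_cond_exp M (F n) ?h x \<ge> c" using n elim by fastforce
        then show False using x by (auto simp: H_def Bad_def)
      qed
    qed
    then have "measure M (Bad c) \<le> measure M (H \<union> D)" by (intro finite_measure_mono_AE) auto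
    also have "\<dots> \<le> measure M H + measure M D" by (intro measure_Un_le) auto
    also have "measure M H \<le> (\<integral>x. ?h x \<partial>M) / c"
      unfolding H_def by (rule maximal_inequality) (auto intro: int_ind c)
    also have "(\<integral>x. ?h x \<partial>M) = measure M D" by simp
    also have "measure M D / c + measure M D = measure M D * (1 / c + 1)" by (simp add: field_simps)
    also have "\<dots> \<le> d * (1 / c + 1)" using Ad c unfolding D_def by (intro mult_right_mono) auto
    finally show ?thesis by simp
  qed
  have null: "measure M (Bad c) = 0" if c: "0 < c" "c \<le> 1" for c
  proof (rule ccontr)
    assume "measure M (Bad c) \<noteq> 0"
    then have pos: "measure M (Bad c) > 0" using measure_nonneg[of M "Bad c"] by linarith
    \<comment> \<open>Chosen so that the bound in \<open>small\<close> is half of the measure of \<open>Bad c\<close>.\<close>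
    define d where "d = measure M (Bad c) / (2 * (1 / c + 1))"
    have d: "d > 0" unfolding d_def using pos c by (intro divide_pos_pos) (auto intro: add_pos_pos)
    have "1 / c + 1 > 0" using c by (auto intro: add_pos_pos)
    then have "d * (1 / c + 1) = measure M (Bad c) / 2" unfolding d_def by (simp add: field_simps)
    then show False using small[OF c d] pos by simp
  qed
  have "AE x in M. \<forall>k. x \<notin> Bad (1 / Suc k)"
    unfolding AE_all_countable
  proof
    fix k
    have "Bad (1 / Suc k) \<in> null_sets M" using null[of "1 / Suc k"] by (auto simp: emeasure_eq_measure)
    then show "AE x in M. x \<notin> Bad (1 / Suc k)" by (rule AE_not_in)
  qed
  with AE_space show ?thesis
  proof eventually_elim
    case (elim x)
    show ?case
    proof (rule LIMSEQ_I)
      fix r :: real assume "r > 0"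
      then obtain k where k: "1 / Suc k < r" using nat_approx_posE by auto
      obtain N where "\<forall>n\<ge>N. \<bar>f n x - indicator C x\<bar> < 1 / Suc k"
        using elim(2)[rule_format, of k] elim(1) unfolding Bad_def mem_Collect_eq not_le[symmetric] by blast
      then show "\<exists>N. \<forall>n\<ge>N. norm (real_cond_exp M (F n) (indicator C) x - indicator C x) < r"
        using k by (intro exI[of _ N]) (auto simp: f_def intro: less_trans)
    qed
  qed
qed

end

section \<open>Recovering a Borel set from a separating statistic\<close>

text \<open>
  A substitute for the measurability of Borel images. The law \<open>\<rho>\<close> of \<open>(x, T x)\<close> is inner
  regular, so the graph \<open>\<Gamma>\<close> of \<open>T\<close> over \<open>B\<close> is, up to a null set, a countable union of compact sets;
  \<open>Z\<close> is the union of their projections. A point of \<open>C\<close> cannot be mapped into \<open>Z\<close> since \<open>Z\<close> only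
  contains values that \<open>T\<close> takes on \<open>B\<close>.
\<close>

lemma ae_separated_by_borel_statistic:
  fixes \<mu> :: "'p::{complete_space, second_countable_topology} measure"
    and T :: "'p \<Rightarrow> 'z::{complete_space, second_countable_topology}"
  assumes \<mu>: "prob_space \<mu>" "sets \<mu> = sets borel"
    and T [measurable]: "T \<in> borel \<rightarrow>\<^sub>M borel"
    and B: "B \<in> sets borel"
    and sep: "\<And>x y. x \<in> B \<Longrightarrow> y \<in> C \<Longrightarrow> T x \<noteq> T y"
  shows "\<exists>Z\<in>sets borel. AE x in \<mu>. (x \<in> B \<longrightarrow> T x \<in> Z) \<and> (x \<in> C \<longrightarrow> T x \<notin> Z)"
proof -
  interpret prob_space \<mu> by (rule \<mu>)
  have space: "space \<mu> = UNIV" using sets_eq_imp_space_eq[OF \<mu>(2)] by simp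
  have [measurable_cong]: "sets \<mu> = sets borel" by (rule \<mu>)
  have B_\<mu> [measurable]: "B \<in> sets \<mu>" using B \<mu> by simp
  define \<rho> where "\<rho> = distr \<mu> borel (\<lambda>x. (x, T x))"
  have g [measurable]: "(\<lambda>x. (x, T x)) \<in> \<mu> \<rightarrow>\<^sub>M borel"
    unfolding borel_prod[symmetric] by measurable
  interpret \<rho>: prob_space \<rho> unfolding \<rho>_def by (rule prob_space_distr) measurable
  define \<Gamma> where "\<Gamma> = {(x, z). x \<in> B \<and> T x = z}"
  have \<Gamma>: "\<Gamma> \<in> sets borel"
  proof -
    have "Measurable.pred (borel \<Otimes>\<^sub>M borel) (\<lambda>(x, z). x \<in> B \<and> T x = z)"
      using B by measurable
    then show ?thesis unfolding \<Gamma>_def pred_def borel_prod by (simp add: space_pair_measure)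
  qed
  have "\<exists>K. K \<subseteq> \<Gamma> \<and> compact K \<and> measure \<rho> \<Gamma> < measure \<rho> K + 1 / Suc n" for n
  proof -
    have SUP: "emeasure \<rho> \<Gamma> = (SUP K \<in> {K. K \<subseteq> \<Gamma> \<and> compact K}. emeasure \<rho> K)"
    proof (rule inner_regular)
      show "sets \<rho> = sets borel" by (simp add: \<rho>_def)
      show "emeasure \<rho> (space \<rho>) \<noteq> \<infinity>" by (simp add: \<rho>.emeasure_space_1)
    qed (rule \<Gamma>)
    show ?thesis
    proof (rule ccontr)
      assume "\<not> ?thesis"
      then have *: "measure \<rho> K \<le> measure \<rho> \<Gamma> - 1 / Suc n" if "K \<subseteq> \<Gamma>" "compact K" for K
        using that by (force simp: not_less)
      have "emeasure \<rho> \<Gamma> \<le> ennreal (measure \<rho> \<Gamma> - 1 / Suc n)"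
        unfolding SUP by (rule SUP_least) (unfold \<rho>.emeasure_eq_measure, intro ennreal_leI *, auto)
      moreover have "0 \<le> measure \<rho> \<Gamma> - 1 / Suc n"
        using *[of "{}"] by simp
      ultimately show False by (simp add: \<rho>.emeasure_eq_measure)
    qed
  qed
  then obtain K where K: "\<And>n. K n \<subseteq> \<Gamma>" "\<And>n. compact (K n)" "\<And>n. measure \<rho> \<Gamma> < measure \<rho> (K n) + 1 / Suc n"
    by metis
  define Z where "Z = (\<Union>n. snd ` K n)"
  have "snd ` K n \<in> sets borel" for n
    by (intro borel_closed compact_imp_closed compact_continuous_image continuous_on_snd continuous_on_id K)
  then have Z: "Z \<in> sets borel" unfolding Z_def by blast
  have K_\<rho> [measurable]: "K n \<in> sets \<rho>" for n
    unfolding \<rho>_def using K(2) by (simp add: borel_closed compact_imp_closed)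
  have \<Gamma>_\<rho> [measurable]: "\<Gamma> \<in> sets \<rho>" unfolding \<rho>_def using \<Gamma> by simp
  have "measure \<rho> (\<Gamma> - (\<Union>n. K n)) \<le> 1 / Suc n" for n
  proof -
    have "measure \<rho> (\<Gamma> - (\<Union>n. K n)) \<le> measure \<rho> (\<Gamma> - K n)"
      by (intro \<rho>.finite_measure_mono) auto
    also have "\<dots> = measure \<rho> \<Gamma> - measure \<rho> (K n)"
      by (intro \<rho>.finite_measure_Diff) (use K in auto)
    also have "\<dots> \<le> 1 / Suc n" using K(3)[of n] by simp
    finally show ?thesis .
  qed
  then have "measure \<rho> (\<Gamma> - (\<Union>n. K n)) \<le> 0"
    by (intro LIMSEQ_le_const[OF LIMSEQ_Suc[OF lim_1_over_n]]) (auto simp: of_nat_Suc)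
  then have "\<Gamma> - (\<Union>n. K n) \<in> null_sets \<rho>"
    by (auto simp: null_sets_def \<rho>.emeasure_eq_measure measure_le_0_iff)
  then have "AE p in \<rho>. p \<notin> \<Gamma> - (\<Union>n. K n)" by (rule AE_not_in)
  then have "AE x in \<mu>. (x, T x) \<notin> \<Gamma> - (\<Union>n. K n)"
    unfolding \<rho>_def by (rule AE_distrD[OF g])
  moreover have "T x \<in> Z" if "(x, T x) \<notin> \<Gamma> - (\<Union>n. K n)" "x \<in> B" for x
    using that unfolding Z_def \<Gamma>_def by force
  moreover have "T y \<notin> Z" if y: "y \<in> C" for y
  proof
    assume "T y \<in> Z"
    then obtain n x where "(x, T y) \<in> K n" unfolding Z_def by auto
    then have "x \<in> B" "T x = T y" using K(1)[of n] by (auto simp: \<Gamma>_def)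
    then show False using sep y by blast
  qed
  ultimately show ?thesis using Z by (intro bexI[of _ Z]) auto
qed

section \<open>Infinite products and empirical frequencies\<close>

text \<open>
  It suffices to look at cylinder sets, whose probability is a finite product.
\<close>

lemma prob_algebra_PiM:
  assumes K: "K \<in> S \<rightarrow>\<^sub>M prob_algebra N"
  shows "(\<lambda>s. Pi\<^sub>M UNIV (\<lambda>_::nat. K s)) \<in> S \<rightarrow>\<^sub>M prob_algebra (Pi\<^sub>M UNIV (\<lambda>_. N))"
proof (rule measurable_prob_algebra_generated[OF sets_PiM Int_stable_prod_algebra prod_algebra_sets_into_space])
  fix s assume "s \<in> space S"
  then have s: "prob_space (K s)" "sets (K s) = sets N"
    using measurable_space[OF K] by (auto simp: space_prob_algebra)
  show "prob_space (Pi\<^sub>M UNIV (\<lambda>_. K s))" by (rule prob_space_PiM) (rule s)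
  show "sets (Pi\<^sub>M UNIV (\<lambda>_. K s)) = sets (Pi\<^sub>M UNIV (\<lambda>_. N))"
    by (rule sets_PiM_cong) (auto simp: s)
next
  fix A assume "A \<in> prod_algebra UNIV (\<lambda>_::nat. N)"
  then obtain J E where J: "finite J" "\<And>j. j \<in> J \<Longrightarrow> E j \<in> sets N" "A = prod_emb UNIV (\<lambda>_. N) J (Pi\<^sub>E J E)"
    by (auto elim!: prod_algebraE)
  have "emeasure (Pi\<^sub>M UNIV (\<lambda>_. K s)) A = (\<Prod>j\<in>J. emeasure (K s) (E j))" if "s \<in> space S" for s
  proof -
    have s: "prob_space (K s)" "sets (K s) = sets N"
      using that measurable_space[OF K] by (auto simp: space_prob_algebra)
    interpret product_prob_space "\<lambda>_::nat. K s" UNIV by (simp add: product_prob_spaceI s)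
    have "A = prod_emb UNIV (\<lambda>_. K s) J (Pi\<^sub>E J E)"
      using J(3) sets_eq_imp_space_eq[OF s(2)] by (simp add: prod_emb_def)
    then show ?thesis using J(1,2) s(2) by (simp add: emeasure_PiM_emb)
  qed
  moreover have "(\<lambda>s. \<Prod>j\<in>J. emeasure (K s) (E j)) \<in> borel_measurable S"
    using J(2) K by (intro borel_measurable_prod_ennreal measurable_compose[OF measurable_prob_algebraD[OF K] measurable_emeasure_subprob_algebra])
  ultimately show "(\<lambda>s. emeasure (Pi\<^sub>M UNIV (\<lambda>_. K s)) A) \<in> borel_measurable S"
    by (simp cong: measurable_cong)
qed

definition freq :: "'x set \<Rightarrow> nat \<Rightarrow> (nat \<Rightarrow> 'x) \<Rightarrow> real" where
  "freq A n x = (\<Sum>i<n. indicator A (x i)) / n"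

text \<open>
  The strong law of large numbers for indicators: Hoeffding's inequality makes the deviation
  probabilities summable, and the Borel-Cantelli lemma applies.
\<close>

lemma freq_tendsto_AE:
  assumes P: "prob_space P" and A: "A \<in> sets P"
  shows "AE x in Pi\<^sub>M UNIV (\<lambda>_::nat. P). (\<lambda>n. freq A n x) \<longlonglongrightarrow> measure P A"
proof -
  interpret P: prob_space P by (rule P)
  interpret S: product_prob_space "\<lambda>_::nat. P" UNIV by (simp add: product_prob_spaceI P)
  let ?M = "Pi\<^sub>M UNIV (\<lambda>_::nat. P)"
  let ?X = "\<lambda>i (x::nat \<Rightarrow> 'a). indicator A (x i) :: real"
  have [measurable]: "A \<in> sets P" by fact
  have ind: "S.indep_vars (\<lambda>_. borel) ?X UNIV"
  proof -
    have "S.indep_vars (\<lambda>_. P) (\<lambda>i x. x i) UNIV"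
    proof (subst S.indep_vars_iff_distr_eq_PiM)
      have "distr ?M (Pi\<^sub>M UNIV (\<lambda>_. P)) (\<lambda>x. \<lambda>i\<in>UNIV. x i) = ?M"
        by (simp add: restrict_def distr_id[unfolded id_def])
      then show "distr ?M (Pi\<^sub>M UNIV (\<lambda>_. P)) (\<lambda>x. \<lambda>i\<in>UNIV. x i) = Pi\<^sub>M UNIV (\<lambda>i. distr ?M P (\<lambda>x. x i))"
        by (simp add: S.PiM_component)
    qed auto
    then show ?thesis by (rule S.indep_vars_compose2) measurable
  qed
  have conc: "measure ?M {x\<in>space ?M. \<bar>freq A n x - measure P A\<bar> \<ge> e} \<le> 2 * exp (-2 * real n * e\<^sup>2)"
    if n: "n > 0" and e: "e > 0" for n e
  proof -
    interpret H: Hoeffding_ineq_iid ?M "{..<n}" ?X "?X 0" 0 1 "measure P A"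
    proof unfold_locales
      show "S.indep_vars (\<lambda>_. borel) ?X {..<n}" using ind by (rule S.indep_vars_subset) auto
      show "distr ?M borel (?X i) = distr ?M borel (?X 0)" for i
      proof -
        have "distr ?M borel (?X i) = distr (distr ?M P (\<lambda>x. x i)) borel (indicator A)" for i
          by (subst distr_distr) (auto simp: comp_def)
        then show ?thesis by (simp add: S.PiM_component)
      qed
      have "S.expectation (?X 0) = (\<integral>y. indicator A y \<partial>distr ?M P (\<lambda>x. x 0))"
        by (subst integral_distr) auto
      then show "measure P A \<equiv> S.expectation (?X 0)" by (simp add: S.PiM_component)
    qed auto
    have "{..<n} \<noteq> {}" using n by auto
    then show ?thesis
      using H.Hoeffding_ineq_abs_ge'[of e] e by (simp add: freq_def)
  qed
  have "AE x in ?M. \<forall>k. eventually (\<lambda>n. \<bar>freq A n x - measure P A\<bar> < 1 / Suc k) sequentially"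
    unfolding AE_all_countable
  proof
    fix k
    define e :: real where "e = 1 / Suc k"
    have e: "e > 0" by (simp add: e_def)
    have fm [measurable]: "freq A n \<in> borel_measurable ?M" for n unfolding freq_def by measurable
    have "AE x in ?M. eventually (\<lambda>n. x \<in> space ?M - {x\<in>space ?M. \<bar>freq A n x - measure P A\<bar> \<ge> e}) sequentially"
    proof (rule borel_cantelli_AE1)
      show "summable (\<lambda>n. measure ?M {x\<in>space ?M. \<bar>freq A n x - measure P A\<bar> \<ge> e})"
      proof (rule summable_comparison_test_ev)
        show "summable (\<lambda>n. 2 * (exp (-2 * e\<^sup>2)) ^ n)"
          using e by (intro summable_mult summable_geometric) auto
        show "eventually (\<lambda>n. norm (measure ?M {x\<in>space ?M. \<bar>freq A n x - measure P A\<bar> \<ge> e}) \<le> 2 * (exp (-2 * e\<^sup>2)) ^ n) sequentially"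
          using eventually_gt_at_top[of 0]
        proof eventually_elim
          case (elim n)
          then show ?case using conc[OF elim e] by (simp add: exp_of_nat_mult[symmetric] mult_ac)
        qed
      qed
    qed (auto simp: S.emeasure_eq_measure less_top[symmetric])
    then show "AE x in ?M. eventually (\<lambda>n. \<bar>freq A n x - measure P A\<bar> < 1 / Suc k) sequentially"
      by (rule AE_mp) (auto simp: e_def elim!: eventually_mono intro!: AE_I2)
  qed
  then show ?thesis
  proof eventually_elim
    case (elim x)
    show ?case
    proof (rule LIMSEQ_I)
      fix r :: real assume "r > 0"
      then obtain k where k: "1 / Suc k < r" using nat_approx_posE by auto
      show "\<exists>N. \<forall>n\<ge>N. norm (freq A n x - measure P A) < r"
        using elim[rule_format, of k] k unfolding eventually_sequentially real_norm_def
        by (meson less_trans)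
    qed
  qed
qed

section \<open>The parameter space as a Borel subset of a Polish space\<close>

text \<open>
  Indices outside \<open>{..<k}\<close> are included: there both vectors are \<open>undefined\<close>.
\<close>

lemma dist_Theta_coords:
  assumes "(k, w, v) \<in> Theta V" "(k', w', v') \<in> Theta V" "dist_Theta (k, w, v) (k', w', v') < 1"
  shows "k = k'" "dist (w i) (w' i) \<le> dist_Theta (k, w, v) (k', w', v')"
    "dist (v i) (v' i) \<le> dist_Theta (k, w, v) (k', w', v')"
proof -
  show k: "k = k'" using assms(3) by (auto simp: dist_Theta_def split: if_splits)
  let ?s = "(\<Sum>i<k. (w i - w' i)\<^sup>2) + (\<Sum>i<k. (norm (v i - v' i))\<^sup>2)"
  have d: "dist_Theta (k, w, v) (k', w', v') = sqrt ?s"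
    using assms(3) k by (auto simp: dist_Theta_def min_def split: if_splits)
  have nonneg: "0 \<le> (\<Sum>i<k. (w i - w' i)\<^sup>2)" "0 \<le> (\<Sum>i<k. (norm (v i - v' i))\<^sup>2)"
    by (auto intro!: sum_nonneg)
  show "dist (w i) (w' i) \<le> dist_Theta (k, w, v) (k', w', v')"
  proof (cases "i < k")
    case True
    then have "(w i - w' i)\<^sup>2 \<le> (\<Sum>i<k. (w i - w' i)\<^sup>2)" by (intro member_le_sum) auto
    then have "(w i - w' i)\<^sup>2 \<le> ?s" using nonneg by linarith
    then show ?thesis unfolding d dist_real_def by (metis real_sqrt_abs real_sqrt_le_iff)
  next
    case False
    then have "w i = w' i"
      using assms(1,2) k by (auto simp: Theta_def prob_simplex_def PiE_def extensional_def)
    then show ?thesis using nonneg by (simp add: d)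
  qed
  show "dist (v i) (v' i) \<le> dist_Theta (k, w, v) (k', w', v')"
  proof (cases "i < k")
    case True
    then have "(norm (v i - v' i))\<^sup>2 \<le> (\<Sum>i<k. (norm (v i - v' i))\<^sup>2)"
      by (intro member_le_sum[of _ _ "\<lambda>i. (norm (v i - v' i))\<^sup>2"]) auto
    then have "(norm (v i - v' i))\<^sup>2 \<le> ?s" using nonneg by linarith
    then show ?thesis unfolding d dist_norm by (rule real_le_rsqrt)
  next
    case False
    then have "v i = v' i"
      using assms(1,2) k by (auto simp: Theta_def PiE_def extensional_def)
    then show ?thesis using nonneg by (simp add: d)
  qed
qed

lemma continuous_map_Theta_coord:
  fixes f :: "'v::euclidean_space param \<Rightarrow> 'b::metric_space"
  assumes f: "\<And>x y. \<lbrakk>x \<in> Theta V; y \<in> Theta V; dist_Theta x y < 1\<rbrakk> \<Longrightarrow> dist (f x) (f y) \<le> dist_Theta x y"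
  shows "continuous_map (Metric_space.mtopology (Theta V) dist_Theta) euclidean f"
proof -
  interpret Metric_space "Theta V" dist_Theta by (rule Metric_space_Theta)
  have "openin mtopology {x \<in> Theta V. f x \<in> U}" if "open U" for U
    unfolding openin_mtopology
  proof safe
    fix x assume x: "x \<in> Theta V" "f x \<in> U"
    then obtain e where e: "e > 0" "\<And>z. dist (f x) z < e \<Longrightarrow> z \<in> U"
      using \<open>open U\<close> by (metis open_dist dist_commute)
    have "mball x (min e 1) \<subseteq> {x \<in> Theta V. f x \<in> U}"
    proof
      fix y assume y: "y \<in> mball x (min e 1)"
      then have "dist (f x) (f y) \<le> dist_Theta x y" using f[of x y] by auto
      then show "y \<in> {x \<in> Theta V. f x \<in> U}" using y e(2)[of "f y"] by auto
    qed
    then show "\<exists>r>0. mball x r \<subseteq> {x \<in> Theta V. f x \<in> U}"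
      using e(1) by (intro exI[of _ "min e 1"]) auto
  qed
  then show ?thesis by (auto simp: continuous_map_def)
qed

text \<open>
  The metric \<open>dist_Theta\<close> induces the topology that the parameter space inherits from the product
  topology on \<^typ>\<open>'v param\<close>. Consequently \<open>borel_Theta\<close> is the trace of the Borel
  sigma-algebra of that product, and measurability can be checked coordinate by coordinate.
\<close>

lemma openin_Theta_iff:
  "openin (Metric_space.mtopology (Theta V) dist_Theta) U \<longleftrightarrow> openin (top_of_set (Theta V)) U"
    (is "?d \<longleftrightarrow> ?e")
proof
  interpret Metric_space "Theta V" dist_Theta by (rule Metric_space_Theta)
  assume U: ?d
  have "\<exists>T. openin (top_of_set (Theta V)) T \<and> x \<in> T \<and> T \<subseteq> U" if xU: "x \<in> U" for x
  proof -
    obtain r where r: "r > 0" "mball x r \<subseteq> U" and xT: "x \<in> Theta V"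
      using U xU unfolding openin_mtopology by blast
    obtain k w v where x: "x = (k, w, v)" by (metis prod_cases3)
    define Ob where "Ob = {y::'a param. fst y \<in> {k} \<and>
      sqrt ((\<Sum>i<k. (w i - fst (snd y) i)\<^sup>2) + (\<Sum>i<k. (norm (v i - snd (snd y) i))\<^sup>2)) < r}"
    have "open (fst -` {k} :: 'a param set)"
      by (rule open_vimage[OF _ continuous_on_fst[OF continuous_on_id]]) (rule Topological_Spaces.open_discrete)
    moreover have "open {y::'a param.
      sqrt ((\<Sum>i<k. (w i - fst (snd y) i)\<^sup>2) + (\<Sum>i<k. (norm (v i - snd (snd y) i))\<^sup>2)) < r}"
      by (intro open_Collect_less continuous_intros
          continuous_on_product_then_coordinatewise[of UNIV "\<lambda>y. fst (snd y)"]
          continuous_on_product_then_coordinatewise[of UNIV "\<lambda>y. snd (snd y)"])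
    ultimately have "open Ob" unfolding Ob_def Collect_conj_eq vimage_def by (rule open_Int)
    then have "openin (top_of_set (Theta V)) (Theta V \<inter> Ob)" by blast
    moreover have "x \<in> Theta V \<inter> Ob" using r xT by (simp add: Ob_def x)
    moreover have "Theta V \<inter> Ob \<subseteq> mball x r"
      unfolding mball_def using xT by (auto simp: Ob_def x) (simp add: dist_Theta_def)
    ultimately show ?thesis using r by blast
  qed
  then show ?e by (subst openin_subopen) blast
next
  interpret Metric_space "Theta V" dist_Theta by (rule Metric_space_Theta)
  assume ?e
  then obtain W where W: "open W" "U = Theta V \<inter> W" by (auto simp: openin_open)
  have k: "continuous_map mtopology euclidean (fst :: 'a param \<Rightarrow> nat)"
  proof -
    have "openin mtopology {x \<in> Theta V. fst x \<in> S}" for S :: "nat set"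
      unfolding openin_mtopology
    proof safe
      fix k w v assume "(k, w, v) \<in> Theta V" "fst (k, w, v) \<in> S"
      then have "mball (k, w, v) 1 \<subseteq> {x \<in> Theta V. fst x \<in> S}"
        by (auto dest: dist_Theta_coords)
      then show "\<exists>r>0. mball (k, w, v) r \<subseteq> {x \<in> Theta V. fst x \<in> S}" by (intro exI[of _ 1]) auto
    qed
    then show ?thesis by (auto simp: continuous_map_def)
  qed
  have w: "continuous_map mtopology euclidean (\<lambda>x::'a param. fst (snd x) i)" for i
    by (rule continuous_map_Theta_coord) (auto intro: dist_Theta_coords)
  have v: "continuous_map mtopology euclidean (\<lambda>x::'a param. snd (snd x) i)" for i
    by (rule continuous_map_Theta_coord) (auto intro: dist_Theta_coords)
  have w': "continuous_map mtopology euclidean (\<lambda>x::'a param. fst (snd x))"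
    unfolding euclidean_product_topology[symmetric] by (auto simp: continuous_map_componentwise_UNIV w)
  have v': "continuous_map mtopology euclidean (\<lambda>x::'a param. snd (snd x))"
    unfolding euclidean_product_topology[symmetric] by (auto simp: continuous_map_componentwise_UNIV v)
  have "continuous_map mtopology (prod_topology euclidean (prod_topology euclidean euclidean)) (\<lambda>x::'a param. (fst x, fst (snd x), snd (snd x)))"
    by (intro continuous_map_pairedI k w' v')
  then have "continuous_map mtopology euclidean (\<lambda>x::'a param. x)"
    by (simp add: prod_topology_euclidean)
  from openin_continuous_map_preimage[OF this, of W] W show ?d
    by (simp add: Int_def conj_commute)
qed

lemma space_borel_Theta [simp]: "space (borel_Theta V) = Theta V"
  by (simp add: borel_Theta_def space_measure_of_conv)

lemma sets_borel_Theta: "sets (borel_Theta V) = sets (restrict_space borel (Theta V))"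
proof -
  have eq: "{U. openin (Metric_space.mtopology (Theta V) dist_Theta) U} = {Theta V \<inter> W | W. open W}"
    unfolding openin_Theta_iff openin_open by auto
  have "sets (borel_Theta V) = sigma_sets (Theta V) {Theta V \<inter> W | W. open W}"
    unfolding borel_Theta_def eq by (rule sets_measure_of) auto
  also have "{Theta V \<inter> W | W. open W} = {(\<lambda>x. x) -` W \<inter> Theta V | W. W \<in> {S. open S}}"
    by (auto simp: Int_commute)
  also have "sigma_sets (Theta V) \<dots> = {(\<lambda>x. x) -` A \<inter> Theta V | A. A \<in> sigma_sets UNIV {S. open S}}"
    by (rule sigma_sets_vimage_commute[symmetric]) auto
  also have "\<dots> = sets (restrict_space borel (Theta V))"
    by (auto simp: sets_restrict_space borel_def image_def Int_commute)
  finally show ?thesis .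
qed

lemma id_borel_Theta: "(\<lambda>\<theta>. \<theta>) \<in> borel_Theta V \<rightarrow>\<^sub>M borel"
  using measurable_restrict_space1[OF measurable_ident, of borel "Theta V"]
  by (simp add: measurable_cong_sets[OF sets_borel_Theta refl] id_def)

lemma measurable_borel_Theta_I:
  assumes "f \<in> S \<rightarrow>\<^sub>M borel" "\<And>x. x \<in> space S \<Longrightarrow> f x \<in> Theta V"
  shows "f \<in> S \<rightarrow>\<^sub>M borel_Theta V"
  unfolding measurable_cong_sets[OF refl sets_borel_Theta]
  by (rule measurable_restrict_space2) (use assms in auto)

lemma measurable_param_coords [measurable]:
  "(fst :: 'v::euclidean_space param \<Rightarrow> nat) \<in> borel \<rightarrow>\<^sub>M count_space UNIV"
  "(\<lambda>\<theta>. fst (snd \<theta>) i) \<in> (borel :: 'v param measure) \<rightarrow>\<^sub>M borel"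
  "(\<lambda>\<theta>. snd (snd \<theta>) i) \<in> (borel :: 'v param measure) \<rightarrow>\<^sub>M borel"
proof -
  have "open (fst -` {k} :: 'v param set)" for k :: nat
    by (rule open_vimage[OF Topological_Spaces.open_discrete continuous_on_fst[OF continuous_on_id]])
  then show "(fst :: 'v param \<Rightarrow> nat) \<in> borel \<rightarrow>\<^sub>M count_space UNIV"
    by (simp add: measurable_count_space_eq2_countable)
  show "(\<lambda>\<theta>. fst (snd \<theta>) i) \<in> (borel :: 'v param measure) \<rightarrow>\<^sub>M borel"
    by (intro borel_measurable_continuous_onI continuous_intros
          continuous_on_product_then_coordinatewise[of UNIV "\<lambda>y. fst (snd y)"])
  show "(\<lambda>\<theta>. snd (snd \<theta>) i) \<in> (borel :: 'v param measure) \<rightarrow>\<^sub>M borel"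
    by (intro borel_measurable_continuous_onI continuous_intros
          continuous_on_product_then_coordinatewise[of UNIV "\<lambda>y. snd (snd y)"])
qed

lemmas measurable_Theta_coords [measurable] =
  measurable_compose[OF id_borel_Theta measurable_param_coords(1)]
  measurable_compose[OF id_borel_Theta measurable_param_coords(2)]
  measurable_compose[OF id_borel_Theta measurable_param_coords(3)]

lemma measurable_to_param:
  fixes f :: "'s \<Rightarrow> nat" and g :: "'s \<Rightarrow> nat \<Rightarrow> real" and h :: "'s \<Rightarrow> nat \<Rightarrow> 'v::euclidean_space"
  assumes f: "f \<in> S \<rightarrow>\<^sub>M count_space UNIV" and g: "\<And>i. (\<lambda>x. g x i) \<in> S \<rightarrow>\<^sub>M borel"
    and h: "\<And>i. (\<lambda>x. h x i) \<in> S \<rightarrow>\<^sub>M borel"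
  shows "(\<lambda>x. (f x, g x, h x)) \<in> S \<rightarrow>\<^sub>M borel"
proof -
  have "f \<in> S \<rightarrow>\<^sub>M borel"
    by (rule measurable_compose[OF f]) simp
  moreover have "g \<in> S \<rightarrow>\<^sub>M borel"
    unfolding measurable_cong_sets[OF refl sets_PiM_equal_borel[symmetric]]
    by (rule measurable_PiM_single') (auto intro: g)
  moreover have "h \<in> S \<rightarrow>\<^sub>M borel"
    unfolding measurable_cong_sets[OF refl sets_PiM_equal_borel[symmetric]]
    by (rule measurable_PiM_single') (auto intro: h)
  ultimately show ?thesis unfolding borel_prod[symmetric] by (intro measurable_Pair)
qed

lemma prob_simplex_iff:
  "w \<in> prob_simplex k \<longleftrightarrow>
    (\<forall>i. (i < k \<longrightarrow> 0 < w i \<and> w i \<le> 1) \<and> (\<not> i < k \<longrightarrow> w i = undefined)) \<and> (\<Sum>i<k. w i) = 1"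
  by (auto simp: prob_simplex_def PiE_iff extensional_def)

lemma Theta_borel:
  fixes V :: "'a::euclidean_space set"
  assumes [measurable]: "V \<in> sets borel"
  shows "Theta V \<in> sets borel"
proof -
  define a where "a i \<theta> = fst (snd \<theta>) i" for i and \<theta> :: "'a param"
  define b where "b i \<theta> = snd (snd \<theta>) i" for i and \<theta> :: "'a param"
  have [measurable]: "a i \<in> borel \<rightarrow>\<^sub>M borel" "b i \<in> borel \<rightarrow>\<^sub>M borel" for i
    unfolding a_def b_def by (rule measurable_param_coords)+
  define P where "P k \<theta> \<longleftrightarrow> 1 \<le> k \<and>
      (\<forall>i. (i < k \<longrightarrow> 0 < a i \<theta> \<and> a i \<theta> \<le> 1) \<and> (\<not> i < k \<longrightarrow> a i \<theta> = undefined))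
      \<and> (\<Sum>i<k. a i \<theta>) = 1 \<and>
      (\<forall>i. (i < k \<longrightarrow> b i \<theta> \<in> V) \<and> (\<not> i < k \<longrightarrow> b i \<theta> = undefined))"
    for k and \<theta> :: "'a param"
  have [measurable]: "P k \<in> borel \<rightarrow>\<^sub>M count_space UNIV" for k
    unfolding P_def by measurable
  have "(\<lambda>\<theta>. P (fst \<theta>) \<theta>) \<in> borel \<rightarrow>\<^sub>M count_space UNIV"
    by (rule measurable_compose_countable[of P]) (auto intro: measurable_param_coords)
  then have "{\<theta>. P (fst \<theta>) \<theta>} \<in> sets borel" by (simp add: pred_def)
  also have "{\<theta>. P (fst \<theta>) \<theta>} = Theta V"
    by (auto simp: Theta_def P_def a_def b_def prob_simplex_iff PiE_iff extensional_def)
  finally show ?thesis .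
qed

section \<open>The model as a probability kernel\<close>

text \<open>
  The number of components takes countably many values, so measurability can be checked for each
  of them separately; the finite sum is then measurable as long as each \<open>v i\<close> may be any vector,
  whence the extension \<open>c\<close> by 0 outside \<open>V\<close>.
\<close>

lemma mixture_param_kernel:
  fixes F :: "'v::euclidean_space \<Rightarrow> 'x measure"
  assumes V [measurable]: "V \<in> sets borel"
    and F: "\<And>v. v \<in> V \<Longrightarrow> F v \<in> space (prob_algebra N)"
    and F_meas: "\<And>A. A \<in> sets N \<Longrightarrow> (\<lambda>v. measure (F v) A) \<in> borel_measurable (restrict_space borel V)"
  shows "mixture_param N F \<in> borel_Theta V \<rightarrow>\<^sub>M prob_algebra N"
proof (rule measurable_prob_algebra_generated[OF sets.sigma_sets_eq[symmetric] sets.Int_stable sets.space_closed])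
  have em: "emeasure (mixture_param N F (k, w, v)) A = (\<Sum>i<k. ennreal (w i) * emeasure (F (v i)) A)"
    if "(k, w, v) \<in> Theta V" "A \<in> sets N" for k w v A
    unfolding mixture_param_def split_conv
    by (rule emeasure_mixture) (use that F in \<open>auto simp: Theta_def space_prob_algebra PiE_iff\<close>)
  show "sets (mixture_param N F \<theta>) = sets N" for \<theta>
    by (auto simp: mixture_param_def split: prod.splits)
  have sp: "space (mixture_param N F \<theta>) = space N" for \<theta>
    by (auto simp: mixture_param_def split: prod.splits)
  show "prob_space (mixture_param N F \<theta>)" if "\<theta> \<in> space (borel_Theta V)" for \<theta>
  proof
    obtain k w v where [simp]: "\<theta> = (k, w, v)" by (metis prod_cases3)
    have \<theta>: "(k, w, v) \<in> Theta V" using that by simp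
    have "emeasure (F (v i)) (space N) = 1" if "i < k" for i
      using F[of "v i"] \<theta> that by (auto simp: Theta_def PiE_iff in_space_prob_algebra)
    then have "emeasure (mixture_param N F \<theta>) (space N) = (\<Sum>i<k. ennreal (w i))"
      using em[OF \<theta>, of "space N"] by simp
    also have "\<dots> = ennreal (\<Sum>i<k. w i)"
      using \<theta> by (intro sum_ennreal) (auto simp: Theta_def prob_simplex_iff intro: less_imp_le)
    also have "\<dots> = 1" using \<theta> by (simp add: Theta_def prob_simplex_def)
    finally show "emeasure (mixture_param N F \<theta>) (space (mixture_param N F \<theta>)) = 1" by (simp add: sp)
  qed
  fix A assume A: "A \<in> sets N"
  define c where "c v = (if v \<in> V then measure (F v) A else 0)" for v
  have [measurable]: "c \<in> borel_measurable borel"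
    unfolding c_def by (rule measurable_restrict_space_iff[THEN iffD1, OF _ _ F_meas[OF A]]) auto
  define g where "g k \<theta> = (\<Sum>i<k. ennreal (fst (snd \<theta>) i) * ennreal (c (snd (snd \<theta>) i)))" for k and \<theta> :: "'v param"
  have "(\<lambda>\<theta>. g (fst \<theta>) \<theta>) \<in> borel_measurable (borel_Theta V)"
  proof (rule measurable_compose_countable[of g])
    show "g k \<in> borel_measurable (borel_Theta V)" for k
      unfolding g_def
      by (intro borel_measurable_sum borel_measurable_times_ennreal measurable_compose[OF _ measurable_ennreal]
          measurable_Theta_coords measurable_compose[OF measurable_Theta_coords(3) \<open>c \<in> borel_measurable borel\<close>])
  qed (rule measurable_Theta_coords)
  moreover have "emeasure (mixture_param N F \<theta>) A = g (fst \<theta>) \<theta>" if "\<theta> \<in> space (borel_Theta V)" for \<theta>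
  proof -
    obtain k w v where [simp]: "\<theta> = (k, w, v)" by (metis prod_cases3)
    have \<theta>: "(k, w, v) \<in> Theta V" using that by simp
    have "emeasure (F (v i)) A = ennreal (c (v i))" if "i < k" for i
    proof -
      have "v i \<in> V" using \<theta> that by (auto simp: Theta_def PiE_iff)
      then interpret prob_space "F (v i)" using F[of "v i"] by (auto simp: space_prob_algebra)
      show ?thesis using \<open>v i \<in> V\<close> by (simp add: c_def emeasure_eq_measure)
    qed
    then show ?thesis using em[OF \<theta> A] by (simp add: g_def)
  qed
  ultimately show "(\<lambda>\<theta>. emeasure (mixture_param N F \<theta>) A) \<in> borel_measurable (borel_Theta V)"
    by (subst measurable_cong[of _ _ "\<lambda>\<theta>. g (fst \<theta>) \<theta>"]) auto
qed

section \<open>Lebesgue null sets and permutations\<close>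

text \<open>
  The transposition of the coordinates \<open>a\<close> and \<open>m\<close> of a probability vector with \<open>m + 1\<close> entries,
  expressed in its first \<open>m\<close> entries.
\<close>

definition swap_last :: "nat \<Rightarrow> nat \<Rightarrow> (nat \<Rightarrow> real) \<Rightarrow> nat \<Rightarrow> real" where
  "swap_last m a u = u(a := 1 - (\<Sum>i<m. u i))"

lemma swap_last_measurable [measurable]:
  assumes "a < m"
  shows "swap_last m a \<in> Pi\<^sub>M {..<m} (\<lambda>_. lborel) \<rightarrow>\<^sub>M Pi\<^sub>M {..<m} (\<lambda>_. lborel)"
proof -
  have "(\<lambda>u. u(a := 1 - (\<Sum>i<m. u i))) \<in> Pi\<^sub>M {..<m} (\<lambda>_. lborel :: real measure) \<rightarrow>\<^sub>M Pi\<^sub>M {..<m} (\<lambda>_. lborel)"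
  proof (rule measurable_fun_upd[of _ "{..<m}"])
    show "(\<lambda>u. 1 - (\<Sum>i<m. u i)) \<in> Pi\<^sub>M {..<m} (\<lambda>_. lborel :: real measure) \<rightarrow>\<^sub>M lborel"
      by simp
  qed (use assms in auto)
  then show ?thesis unfolding swap_last_def .
qed

text \<open>
  With the other coordinates held fixed, the coordinate \<open>a\<close> is reflected at a point, which
  preserves Lebesgue measure on the line.
\<close>

lemma emeasure_vimage_swap_last:
  assumes a: "a < m" and A: "A \<in> sets (Pi\<^sub>M {..<m} (\<lambda>_. lborel))"
  shows "emeasure (Pi\<^sub>M {..<m} (\<lambda>_. lborel)) (swap_last m a -` A \<inter> space (Pi\<^sub>M {..<m} (\<lambda>_. lborel)))
    = emeasure (Pi\<^sub>M {..<m} (\<lambda>_. lborel)) A"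
proof -
  interpret product_sigma_finite "\<lambda>_::nat. lborel :: real measure"
    by (unfold product_sigma_finite_def) (auto intro: sigma_finite_lborel)
  let ?P = "Pi\<^sub>M {..<m} (\<lambda>_. lborel :: real measure)"
  let ?I = "{..<m} - {a}"
  let ?Q = "Pi\<^sub>M ?I (\<lambda>_. lborel :: real measure)"
  have ins: "insert a ?I = {..<m}" using a by auto
  note [measurable] = swap_last_measurable[OF a] A
  have fold: "(\<integral>\<^sup>+u. f u \<partial>?P) = (\<integral>\<^sup>+x. \<integral>\<^sup>+y. f (x(a := y)) \<partial>lborel \<partial>?Q)"
    if "f \<in> borel_measurable ?P" for f
    using product_nn_integral_insert[of ?I a f] that unfolding ins by simp
  have upd: "(\<lambda>y. x(a := y)) \<in> lborel \<rightarrow>\<^sub>M ?P" if "x \<in> space ?Q" for x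
    using measurable_fun_upd[of "{..<m}" ?I a "\<lambda>_. x" lborel "\<lambda>_. lborel" "\<lambda>y. y"] that ins by auto
  have "emeasure ?P (swap_last m a -` A \<inter> space ?P) = (\<integral>\<^sup>+u. indicator A (swap_last m a u) \<partial>?P)"
  proof -
    have "emeasure ?P (swap_last m a -` A \<inter> space ?P) = (\<integral>\<^sup>+u. indicator (swap_last m a -` A \<inter> space ?P) u \<partial>?P)"
      by (rule nn_integral_indicator[symmetric]) measurable
    also have "\<dots> = (\<integral>\<^sup>+u. indicator A (swap_last m a u) \<partial>?P)"
      by (rule nn_integral_cong) (simp add: indicator_def)
    finally show ?thesis .
  qed
  also have "\<dots> = (\<integral>\<^sup>+x. \<integral>\<^sup>+y. indicator A (swap_last m a (x(a := y))) \<partial>lborel \<partial>?Q)"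
    by (rule fold) measurable
  also have "\<dots> = (\<integral>\<^sup>+x. \<integral>\<^sup>+y. indicator A (x(a := y)) \<partial>lborel \<partial>?Q)"
  proof (rule nn_integral_cong)
    fix x assume x: "x \<in> space ?Q"
    define s where "s = 1 - (\<Sum>i\<in>?I. x i)"
    have "swap_last m a (x(a := y)) = x(a := s + (-1) * y)" for y
    proof -
      have "(\<Sum>i<m. (x(a := y)) i) = y + (\<Sum>i\<in>?I. x i)"
        using a by (subst sum.remove[of _ a]) (auto intro!: sum.cong)
      then show ?thesis by (simp add: swap_last_def s_def algebra_simps)
    qed
    moreover have "(\<integral>\<^sup>+y. indicator A (x(a := y)) \<partial>lborel) = (\<integral>\<^sup>+y. indicator A (x(a := s + (-1) * y)) \<partial>lborel)"
      using nn_integral_real_affine[of "\<lambda>y. indicator A (x(a := y))" "-1" s]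
        measurable_compose[OF upd[OF x], of "indicator A" borel] by simp
    ultimately show "(\<integral>\<^sup>+y. indicator A (swap_last m a (x(a := y))) \<partial>lborel) = (\<integral>\<^sup>+y. indicator A (x(a := y)) \<partial>lborel)"
      by (simp only:)
  qed
  also have "\<dots> = (\<integral>\<^sup>+u. indicator A u \<partial>?P)"
    by (rule fold[symmetric]) measurable
  finally show ?thesis by simp
qed

lemma prob_simplex_permute:
  assumes "w \<in> prob_simplex k" "\<sigma> permutes {..<k}"
  shows "(\<lambda>i. w (\<sigma> i)) \<in> prob_simplex k"
proof -
  have "(\<Sum>i<k. w (\<sigma> i)) = (\<Sum>i<k. w i)"
    using sum.permute[OF assms(2), of w] by (simp add: comp_def)
  moreover have "\<sigma> i < k \<longleftrightarrow> i < k" for i using permutes_in_image[OF assms(2), of i] by auto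
  ultimately show ?thesis using assms permutes_not_in[OF assms(2)] by (auto simp: prob_simplex_iff)
qed

lemma borel_simplex_permute:
  assumes "\<sigma> permutes {..<k}"
  shows "(\<lambda>w i. w (\<sigma> i)) \<in> borel_simplex k \<rightarrow>\<^sub>M borel_simplex k"
  unfolding borel_simplex_def
proof (rule measurable_restrict_space3)
  have "\<sigma> i < k \<longleftrightarrow> i < k" for i using permutes_in_image[OF assms, of i] by auto
  then show "(\<lambda>w i. w (\<sigma> i)) \<in> Pi\<^sub>M {..<k} (\<lambda>_. borel :: real measure) \<rightarrow>\<^sub>M Pi\<^sub>M {..<k} (\<lambda>_. borel)"
    using permutes_not_in[OF assms] by (intro measurable_PiM_single') (auto simp: space_PiM PiE_iff extensional_def)
qed (auto intro: prob_simplex_permute assms)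

lemma null_simplex_permute_aux:
  assumes A: "A \<in> sets (borel_simplex k)"
    and null: "emeasure (Pi\<^sub>M {..<k - 1} (\<lambda>_. lborel)) (drop_last_coord k ` A) = 0"
    and k: "k = Suc m" and a: "a < m"
  shows "emeasure (Pi\<^sub>M {..<k - 1} (\<lambda>_. lborel))
    (drop_last_coord k ` {w \<in> prob_simplex k. (\<lambda>i. w (Transposition.transpose a m i)) \<in> A}) = 0"
proof -
  let ?P = "Pi\<^sub>M {..<m} (\<lambda>_. lborel :: real measure)"
  let ?\<tau> = "Transposition.transpose a m"
  have perm: "?\<tau> permutes {..<k}" using k a by (intro permutes_swap_id) auto
  have A': "A \<subseteq> prob_simplex k" using sets.sets_into_space[OF A] by simp
  have drop: "drop_last_coord k (\<lambda>i. w (?\<tau> i)) = swap_last m a (drop_last_coord k w)"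
    if "w \<in> prob_simplex k" for w
  proof
    fix i
    have "(\<Sum>i<m. w i) + w m = 1" using that k by (simp add: prob_simplex_def)
    then show "drop_last_coord k (\<lambda>i. w (?\<tau> i)) i = swap_last m a (drop_last_coord k w) i"
      using k a by (auto simp: drop_last_coord_def swap_last_def Transposition.transpose_def)
  qed
  have sub: "drop_last_coord k ` {w \<in> prob_simplex k. (\<lambda>i. w (?\<tau> i)) \<in> A}
      \<subseteq> swap_last m a -` (drop_last_coord k ` A) \<inter> space ?P" (is "?L \<subseteq> ?R")
  proof
    fix u assume "u \<in> ?L"
    then obtain w where w: "w \<in> prob_simplex k" "(\<lambda>i. w (?\<tau> i)) \<in> A" "u = drop_last_coord k w" by auto
    then have "swap_last m a u \<in> drop_last_coord k ` A" using drop[OF w(1)] by (metis image_eqI)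
    moreover have "u \<in> space ?P" using k by (simp add: w(3) drop_last_coord_def space_PiM)
    ultimately show "u \<in> ?R" by simp
  qed
  have R0: "emeasure ?P ?R = 0"
    using emeasure_vimage_swap_last[OF a, of "drop_last_coord k ` A"] drop_last_coord_image_sets[OF A] null k by simp
  have Rs: "?R \<in> sets ?P"
    using drop_last_coord_image_sets[OF A] k by (intro measurable_sets[OF swap_last_measurable[OF a]]) simp
  have "emeasure ?P ?L = 0" by (rule emeasure_eq_0[OF Rs R0 sub])
  then show ?thesis using k by simp
qed

text \<open>
  Transpositions with the last index generate all permutations:
  \<open>(a b) = (a m) (b m) (a m)\<close>.
\<close>

lemma null_simplex_permute:
  assumes \<sigma>: "\<sigma> permutes {..<k}" and A: "A \<in> sets (borel_simplex k)"
    and null: "emeasure (Pi\<^sub>M {..<k - 1} (\<lambda>_. lborel)) (drop_last_coord k ` A) = 0"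
  shows "emeasure (Pi\<^sub>M {..<k - 1} (\<lambda>_. lborel))
    (drop_last_coord k ` {w \<in> prob_simplex k. (\<lambda>i. w (\<sigma> i)) \<in> A}) = 0"
proof -
  let ?\<mu> = "\<lambda>A. emeasure (Pi\<^sub>M {..<k - 1} (\<lambda>_. lborel)) (drop_last_coord k ` A)"
  define Q where "Q \<sigma> \<longleftrightarrow> \<sigma> permutes {..<k} \<and> (\<forall>A\<in>sets (borel_simplex k). ?\<mu> A = 0 \<longrightarrow>
      ?\<mu> {w \<in> prob_simplex k. (\<lambda>i. w (\<sigma> i)) \<in> A} = 0)" for \<sigma>
  have comp: "Q (\<sigma> \<circ> \<tau>)" if Q: "Q \<sigma>" "Q \<tau>" for \<sigma> \<tau>
    unfolding Q_def
  proof (intro conjI ballI impI)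
    show "\<sigma> \<circ> \<tau> permutes {..<k}" using Q by (auto simp: Q_def intro: permutes_compose)
    fix A assume A: "A \<in> sets (borel_simplex k)" "?\<mu> A = 0"
    define B where "B = {w \<in> prob_simplex k. (\<lambda>i. w (\<tau> i)) \<in> A}"
    have "B \<in> sets (borel_simplex k)"
      using measurable_sets[OF borel_simplex_permute A(1)] Q unfolding B_def Q_def
      by (simp add: vimage_def Int_def conj_commute)
    moreover have "?\<mu> B = 0" unfolding B_def using Q(2) A by (simp add: Q_def)
    ultimately have "?\<mu> {w \<in> prob_simplex k. (\<lambda>i. w (\<sigma> i)) \<in> B} = 0" using Q(1) by (simp add: Q_def)
    also have "{w \<in> prob_simplex k. (\<lambda>i. w (\<sigma> i)) \<in> B} = {w \<in> prob_simplex k. (\<lambda>i. w ((\<sigma> \<circ> \<tau>) i)) \<in> A}"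
      using Q by (auto simp: B_def Q_def intro: prob_simplex_permute)
    finally show "?\<mu> \<dots> = 0" .
  qed
  have last: "Q (Transposition.transpose a m)" if "k = Suc m" "a < m" for a m
    using null_simplex_permute_aux[OF _ _ that] permutes_swap_id[of a "{..<k}" m] that by (auto simp: Q_def)
  have transpose: "Q (Transposition.transpose a b)" if ab: "a < k" "b < k" "a \<noteq> b" for a b
  proof -
    obtain m where m: "k = Suc m" using ab by (cases k) auto
    consider "b = m" | "a = m" | "a < m" "b < m" using ab m by linarith
    then show ?thesis
    proof cases
      case 1 then show ?thesis using last[OF m, of a] ab m by simp
    next
      case 2 then show ?thesis using last[OF m, of b] ab m by (simp add: Transposition.transpose_commute)
    next
      case 3
      have "Transposition.transpose a b = Transposition.transpose a m \<circ> Transposition.transpose b m \<circ> Transposition.transpose a m"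
        using 3 ab(3) by (auto simp: fun_eq_iff Transposition.transpose_def)
      then show ?thesis using comp[OF comp[OF last[OF m 3(1)] last[OF m 3(2)]] last[OF m 3(1)]] by simp
    qed
  qed
  have "A' \<in> sets (borel_simplex k) \<Longrightarrow> {w \<in> prob_simplex k. w \<in> A'} = A'" for A'
    using sets.sets_into_space[of A' "borel_simplex k"] by auto
  then have "Q id" by (auto simp: Q_def permutes_id)
  have "Q \<sigma>"
    using \<sigma>
  proof (rule permutes_induct)
    show "Q id" by fact
    show "Q (Transposition.transpose a b \<circ> p)" if "a \<in> {..<k}" "b \<in> {..<k}" "a \<noteq> b" "Q p" for a b p
      using that by (intro comp transpose) auto
  qed simp
  then show ?thesis using A null by (simp add: Q_def)
qed

lemma param_pair_measurable:
  assumes "1 \<le> k"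
  shows "(\<lambda>(w, v). (k, w, v)) \<in> borel_simplex k \<Otimes>\<^sub>M borel_components V k \<rightarrow>\<^sub>M borel_Theta V"
proof (rule measurable_borel_Theta_I)
  have w: "(\<lambda>w. w i) \<in> borel_simplex k \<rightarrow>\<^sub>M borel" for i
  proof (cases "i < k")
    case True
    then show ?thesis unfolding borel_simplex_def
      by (intro measurable_restrict_space1 measurable_component_singleton) simp
  next
    case False
    then have "(\<lambda>w. w i) \<in> borel_simplex k \<rightarrow>\<^sub>M borel \<longleftrightarrow> (\<lambda>w. undefined) \<in> borel_simplex k \<rightarrow>\<^sub>M (borel :: real measure)"
      by (intro measurable_cong) (auto simp: prob_simplex_iff)
    then show ?thesis by simp
  qed
  have v: "(\<lambda>v. v i) \<in> borel_components V k \<rightarrow>\<^sub>M borel" for i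
  proof (cases "i < k")
    case True
    then show ?thesis unfolding borel_components_def
      by (intro measurable_restrict_space1 measurable_component_singleton) simp
  next
    case False
    then have "(\<lambda>v. v i) \<in> borel_components V k \<rightarrow>\<^sub>M borel \<longleftrightarrow> (\<lambda>v. undefined) \<in> borel_components V k \<rightarrow>\<^sub>M (borel :: 'a measure)"
      by (intro measurable_cong) (auto simp: borel_components_def space_restrict_space PiE_iff extensional_def)
    then show ?thesis by simp
  qed
  show "(\<lambda>(w, v). (k, w, v)) \<in> borel_simplex k \<Otimes>\<^sub>M borel_components V k \<rightarrow>\<^sub>M borel"
    unfolding split_beta'
    by (rule measurable_to_param) (auto intro: measurable_compose[OF measurable_fst w] measurable_compose[OF measurable_snd v])
  show "(case x of (w, v) \<Rightarrow> (k, w, v)) \<in> Theta V" if "x \<in> space (borel_simplex k \<Otimes>\<^sub>M borel_components V k)" for x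
    using that assms by (auto simp: space_pair_measure Theta_def borel_components_def space_restrict_space)
qed

lemma space_borel_components [simp]: "space (borel_components V k) = ({..<k} \<rightarrow>\<^sub>E V)"
  by (auto simp: borel_components_def space_restrict_space space_PiM)

lemma sets_lebesgue_simplex: "sets (lebesgue_simplex k) = sets (borel_simplex k)"
  using sets.space_closed[of "borel_simplex k"] sets.sigma_sets_eq[of "borel_simplex k"]
  by (simp add: lebesgue_simplex_def)

lemma sets_lebesgue_components: "sets (lebesgue_components V k) = sets (borel_components V k)"
  unfolding lebesgue_components_def borel_components_def
  by (intro sets_restrict_space_cong sets_PiM_cong) auto

text \<open>
  The set \<open>A\<close> below collects the weights \<open>w\<close> whose section of \<open>E\<close> is not null for \<open>G k\<close>. Not only \<open>A\<close> but also
  each of its permuted copies is Lebesgue null; this is needed because the condition on \<open>G k\<close>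
  concerns all rearrangements of the components.
\<close>

lemma lebesgue_Theta_null:
  fixes V :: "'v::euclidean_space set"
  assumes V: "V \<in> sets borel"
    and E: "E \<in> sets (borel_Theta V)"
    and invariant: "\<And>k w v \<sigma>. \<lbrakk>(k, w, v) \<in> E; \<sigma> permutes {..<k}\<rbrakk> \<Longrightarrow> permute_param \<sigma> (k, w, v) \<in> E"
    and D: "\<And>k. 1 \<le> k \<Longrightarrow> D k \<in> space (prob_algebra (borel_simplex k))"
    and G: "\<And>k. 1 \<le> k \<Longrightarrow> G k \<in> space (prob_algebra (borel_components V k))"
    and null: "\<And>k. 1 \<le> k \<Longrightarrow> AE (w, v) in D k \<Otimes>\<^sub>M G k. (k, w, v) \<notin> E"
    and D_null: "\<And>k A. \<lbrakk>1 \<le> k; A \<in> sets (borel_simplex k); measure (D k) A = 0\<rbrakk> \<Longrightarrow>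
      emeasure (Pi\<^sub>M {..<k - 1} (\<lambda>_. lborel)) (drop_last_coord k ` A) = 0"
    and G_null: "\<And>k A. \<lbrakk>1 \<le> k; A \<in> sets (borel_components V k);
       (\<Sum>\<sigma> | \<sigma> permutes {..<k}. \<P>(v in G k. (\<lambda>i. v (\<sigma> i)) \<in> A)) = 0\<rbrakk> \<Longrightarrow>
      emeasure (Pi\<^sub>M {..<k} (\<lambda>_. lborel)) A = 0"
  shows "lebesgue_Theta V E = 0"
proof -
  have "emeasure (lebesgue_simplex k \<Otimes>\<^sub>M lebesgue_components V k) {(w, v). (k, w, v) \<in> E} = 0"
    if k: "1 \<le> k" for k
  proof -
    let ?S = "lebesgue_simplex k" and ?C = "lebesgue_components V k"
    define E' where "E' = {(w, v). (k, w, v) \<in> E}"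
    have sets_D: "sets (D k) = sets (borel_simplex k)" and sets_G: "sets (G k) = sets (borel_components V k)"
      using D[OF k] G[OF k] by (auto simp: space_prob_algebra)
    note space_D = sets_eq_imp_space_eq[OF sets_D] and space_G = sets_eq_imp_space_eq[OF sets_G]
    interpret D: prob_space "D k" using D[OF k] by (simp add: space_prob_algebra)
    interpret G: prob_space "G k" using G[OF k] by (simp add: space_prob_algebra)
    interpret DG: pair_prob_space "D k" "G k" ..
    have E_sub: "E \<subseteq> Theta V" using sets.sets_into_space[OF E] by simp
    have "E' = (\<lambda>(w, v). (k, w, v)) -` E \<inter> space (borel_simplex k \<Otimes>\<^sub>M borel_components V k)"
      using E_sub by (auto simp: E'_def space_pair_measure Theta_def)
    then have E': "E' \<in> sets (borel_simplex k \<Otimes>\<^sub>M borel_components V k)"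
      using measurable_sets[OF param_pair_measurable[OF k] E] by simp
    then have E'_DG: "E' \<in> sets (D k \<Otimes>\<^sub>M G k)" and E'_SC: "E' \<in> sets (?S \<Otimes>\<^sub>M ?C)"
      by (simp_all add: sets_pair_measure_cong[OF sets_D sets_G]
          sets_pair_measure_cong[OF sets_lebesgue_simplex sets_lebesgue_components])
    define A where "A = {w \<in> prob_simplex k. emeasure (G k) (Pair w -` E') \<noteq> 0}"
    have "(\<lambda>w. emeasure (G k) (Pair w -` E')) \<in> borel_measurable (D k)"
      by (rule G.measurable_emeasure_Pair[OF E'_DG])
    then have "{w \<in> space (D k). emeasure (G k) (Pair w -` E') \<noteq> 0} \<in> sets (D k)" by measurable
    then have A_D: "A \<in> sets (D k)" by (simp add: A_def space_D)
    then have A: "A \<in> sets (borel_simplex k)" using sets_D by simp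
    have "AE p in D k \<Otimes>\<^sub>M G k. p \<notin> E'"
      using null[OF k] by (simp add: E'_def split_beta')
    then have "AE w in D k. AE v in G k. (w, v) \<notin> E'" by (rule DG.AE_pair)
    then have "AE w in D k. w \<notin> A"
    proof eventually_elim
      case (elim w)
      have "Pair w -` E' \<in> null_sets (G k)"
        using elim by (simp add: AE_iff_null_sets[OF sets_Pair1[OF E'_DG]])
      then show ?case by (auto simp: A_def)
    qed
    then have "measure (D k) A = 0"
      using A_D by (simp add: D.prob_eq_0)
    then have A_null: "emeasure (Pi\<^sub>M {..<k - 1} (\<lambda>_. lborel)) (drop_last_coord k ` A) = 0"
      by (rule D_null[OF k A])
    have "AE w in ?S. (\<lambda>i. w (\<sigma> i)) \<notin> A" if \<sigma>: "\<sigma> permutes {..<k}" for \<sigma>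
    proof -
      define B where "B = {w \<in> prob_simplex k. (\<lambda>i. w (\<sigma> i)) \<in> A}"
      have B: "B \<in> sets (borel_simplex k)"
        using measurable_sets[OF borel_simplex_permute[OF \<sigma>] A] unfolding B_def
        by (simp add: vimage_def Int_def conj_commute)
      have "emeasure ?S B = 0"
        unfolding emeasure_lebesgue_simplex[OF B] unfolding B_def by (rule null_simplex_permute[OF \<sigma> A A_null])
      then have "B \<in> null_sets ?S" using B by (simp add: null_sets_def sets_lebesgue_simplex)
      then have "AE w in ?S. w \<notin> B" by (rule AE_not_in)
      with AE_space show ?thesis
      proof eventually_elim
        case (elim w)
        then show ?case using sets_eq_imp_space_eq[OF sets_lebesgue_simplex, of k] by (simp add: B_def)
      qed
    qed
    then have "AE w in ?S. \<forall>\<sigma>\<in>{\<sigma>. \<sigma> permutes {..<k}}. (\<lambda>i. w (\<sigma> i)) \<notin> A"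
      by (intro AE_finite_allI finite_permutations) auto
    moreover note AE_space[of ?S]
    ultimately have ae: "AE w in ?S. emeasure ?C (Pair w -` E') = 0"
    proof eventually_elim
      case (elim w)
      have w: "w \<in> prob_simplex k"
        using elim(2) sets_eq_imp_space_eq[OF sets_lebesgue_simplex, of k] by simp
      let ?X = "Pair w -` E'"
      have X: "?X \<in> sets (borel_components V k)" by (rule sets_Pair1[OF E'])
      have "\<P>(v in G k. (\<lambda>i. v (\<sigma> i)) \<in> ?X) = 0" if \<sigma>: "\<sigma> permutes {..<k}" for \<sigma>
      proof -
        \<comment> \<open>By invariance of \<open>E\<close>, rearranging \<open>v\<close> by \<open>\<sigma>\<close> has the same effect as rearranging \<open>w\<close> by the inverse.\<close>
        define \<tau> where "\<tau> = inv \<sigma>"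
        have \<tau>: "\<tau> permutes {..<k}" unfolding \<tau>_def by (rule permutes_inv[OF \<sigma>])
        let ?Y = "Pair (\<lambda>i. w (\<tau> i)) -` E'"
        have "(\<lambda>i. w (\<tau> i)) \<notin> A" using elim(1) \<tau> by auto
        then have Y0: "emeasure (G k) ?Y = 0"
          using prob_simplex_permute[OF w \<tau>] by (simp add: A_def)
        have sub: "{v \<in> space (G k). (\<lambda>i. v (\<sigma> i)) \<in> ?X} \<subseteq> ?Y"
        proof
          fix v assume "v \<in> {v \<in> space (G k). (\<lambda>i. v (\<sigma> i)) \<in> ?X}"
          then have "(k, w, \<lambda>i. v (\<sigma> i)) \<in> E" by (simp add: E'_def)
          from invariant[OF this \<tau>] show "v \<in> ?Y"
            using permutes_inverses[OF \<sigma>] by (simp add: E'_def permute_param_def \<tau>_def)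
        qed
        have "emeasure (G k) {v \<in> space (G k). (\<lambda>i. v (\<sigma> i)) \<in> ?X} = 0"
          by (rule emeasure_eq_0[OF sets_Pair1[OF E'_DG] Y0 sub])
        then show ?thesis by (simp add: measure_def)
      qed
      then have "emeasure (Pi\<^sub>M {..<k} (\<lambda>_. lborel)) ?X = 0"
        by (intro G_null[OF k X]) simp
      moreover have "?X \<subseteq> {..<k} \<rightarrow>\<^sub>E V" using sets.sets_into_space[OF X] by simp
      moreover have "({..<k} \<rightarrow>\<^sub>E V) \<in> sets (Pi\<^sub>M {..<k} (\<lambda>_. lborel))"
        using V by (intro sets_PiM_I_finite) auto
      ultimately show ?case
        unfolding lebesgue_components_def by (subst emeasure_restrict_space) (auto dest: sets.sets_into_space)
    qed
    interpret P: product_sigma_finite "\<lambda>_::nat. lborel :: 'v measure"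
      by (unfold product_sigma_finite_def) (auto intro: sigma_finite_lborel)
    interpret P: sigma_finite_measure "Pi\<^sub>M {..<k} (\<lambda>_. lborel :: 'v measure)"
      by (rule P.sigma_finite) simp
    have "sigma_finite_measure ?C"
      unfolding lebesgue_components_def
      by (rule sigma_finite_measure_restrict_space) (use V in \<open>auto intro!: sets_PiM_I_finite P.sigma_finite_measure_axioms\<close>)
    then interpret C: sigma_finite_measure ?C .
    have "emeasure (?S \<Otimes>\<^sub>M ?C) E' = (\<integral>\<^sup>+w. emeasure ?C (Pair w -` E') \<partial>?S)"
      by (rule C.emeasure_pair_measure_alt[OF E'_SC])
    also have "\<dots> = 0"
      using ae by (subst nn_integral_0_iff_AE) (auto intro: C.measurable_emeasure_Pair[OF E'_SC])
    finally show ?thesis unfolding E'_def .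
  qed
  then show ?thesis by (simp add: lebesgue_Theta_def Let_def)
qed

section \<open>Identifiability up to permutation\<close>

text \<open>
  When the components are distinct, the mixing measure is a finite measure whose atoms are the
  components, with the weights as masses. Matching equal atoms gives the permutation.
\<close>

lemma equal_mixing_measure_permute:
  fixes V :: "'v::euclidean_space set"
  assumes \<theta>: "(k, w, v) \<in> Theta V" "inj_on v {..<k}"
    and \<theta>': "(k', w', v') \<in> Theta V" "inj_on v' {..<k'}"
    and eq: "mixture (restrict_space borel V) (return (restrict_space borel V)) k w v =
      mixture (restrict_space borel V) (return (restrict_space borel V)) k' w' v'"
  shows "\<exists>\<sigma>. \<sigma> permutes {..<k} \<and> (k', w', v') = permute_param \<sigma> (k, w, v)"
proof -
  let ?B = "restrict_space borel V :: 'v measure"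
  have sp: "space ?B = V" by (simp add: space_restrict_space)
  have x: "{x} \<in> sets ?B" if "x \<in> V" for x
    using that by (auto simp: sets_restrict_space intro!: image_eqI[of _ _ "{x}"])
  have mass: "emeasure (mixture ?B (return ?B) k w v) {x} = (\<Sum>i<k. ennreal (w i) * indicator {x} (v i))"
    if "x \<in> V" for x k w and v :: "nat \<Rightarrow> 'v"
    using x[OF that] by (subst emeasure_mixture) (auto simp: emeasure_return)
  have mass_at: "emeasure (mixture ?B (return ?B) k w v) {v i} = ennreal (w i)"
    if "(k, w, v) \<in> Theta V" "inj_on v {..<k}" "i < k" for k w v i
  proof -
    have "v i \<in> V" using that by (auto simp: Theta_def PiE_iff)
    then have "emeasure (mixture ?B (return ?B) k w v) {v i} = (\<Sum>j<k. if j = i then ennreal (w i) else 0)"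
      unfolding mass[OF \<open>v i \<in> V\<close>] using that(2,3) by (intro sum.cong refl) (auto simp: indicator_def inj_on_def)
    then show ?thesis using that(3) by simp
  qed
  have pos: "w i > 0" if "(k, w, v) \<in> Theta V" "i < k" for k w v i
    using that by (auto simp: Theta_def prob_simplex_iff)
  have sub: "v ` {..<k} \<subseteq> v' ` {..<k'}"
    if \<theta>: "(k, w, v) \<in> Theta V" "inj_on v {..<k}"
      and eq: "mixture ?B (return ?B) k w v = mixture ?B (return ?B) k' w' v'" for k w v k' w' v'
  proof safe
    fix i assume i: "i < k"
    then have vi: "v i \<in> V" using \<theta> by (auto simp: Theta_def PiE_iff)
    show "v i \<in> v' ` {..<k'}"
    proof (rule ccontr)
      assume "v i \<notin> v' ` {..<k'}"
      then have "emeasure (mixture ?B (return ?B) k' w' v') {v i} = 0"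
        unfolding mass[OF vi] by (intro sum.neutral) (force simp: indicator_def)
      then show False using mass_at[OF \<theta> i] pos[OF \<theta>(1) i] eq by simp
    qed
  qed
  have img: "v ` {..<k} = v' ` {..<k'}"
    using sub[OF \<theta> eq] sub[OF \<theta>' eq[symmetric]] by auto
  have k: "k' = k"
    using card_image[OF \<theta>(2)] card_image[OF \<theta>'(2)] img by simp
  define \<sigma> where "\<sigma> i = (if i < k then inv_into {..<k} v (v' i) else i)" for i
  have v\<sigma>: "v (\<sigma> i) = v' i" "\<sigma> i < k" if "i < k" for i
  proof -
    have "v' i \<in> v ` {..<k}" using that img k by auto
    then show "v (\<sigma> i) = v' i" "\<sigma> i < k"
      using that f_inv_into_f[of "v' i" v "{..<k}"] inv_into_into[of "v' i" v "{..<k}"] by (auto simp: \<sigma>_def)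
  qed
  have "\<sigma> permutes {..<k}"
  proof (rule bij_imp_permutes)
    have "inj_on \<sigma> {..<k}"
      using \<theta>'(2) v\<sigma>(1) k by (intro inj_onI) (metis inj_onD lessThan_iff)
    then show "bij_betw \<sigma> {..<k} {..<k}"
      using v\<sigma>(2) by (intro bij_betw_imageI endo_inj_surj) auto
  qed (simp add: \<sigma>_def)
  moreover have "w (\<sigma> i) = w' i" for i
  proof (cases "i < k")
    case True
    have "ennreal (w (\<sigma> i)) = ennreal (w' i)"
      using mass_at[OF \<theta> v\<sigma>(2)[OF True]] mass_at[OF \<theta>', of i] True k eq v\<sigma>(1)[OF True] by simp
    then show ?thesis
      using pos[OF \<theta>(1) v\<sigma>(2)[OF True]] pos[OF \<theta>'(1), of i] True k by simp
  next
    case False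
    then show ?thesis using \<theta> \<theta>' k by (auto simp: \<sigma>_def Theta_def prob_simplex_iff)
  qed
  moreover have "v (\<sigma> i) = v' i" for i
  proof (cases "i < k")
    case False
    then show ?thesis using \<theta> \<theta>' k by (auto simp: \<sigma>_def Theta_def PiE_iff extensional_def)
  qed (rule v\<sigma>)
  ultimately show ?thesis using k by (intro exI[of _ \<sigma>]) (simp add: permute_param_def)
qed

lemma mixture_param_permute:
  assumes \<sigma>: "\<sigma> permutes {..<num_components \<theta>}"
  shows "mixture_param N F (permute_param \<sigma> \<theta>) = mixture_param N F \<theta>"
proof -
  obtain k w v where [simp]: "\<theta> = (k, w, v)" by (metis prod_cases3)
  have "(\<Sum>i<k. ennreal (w (\<sigma> i)) * emeasure (F (v (\<sigma> i))) A) = (\<Sum>i<k. ennreal (w i) * emeasure (F (v i)) A)" for A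
    using sum.permute[OF \<sigma>[simplified num_components_def], of "\<lambda>i. ennreal (w i) * emeasure (F (v i)) A"]
    by (simp add: comp_def)
  then show ?thesis by (simp add: mixture_param_def permute_param_def mixture_def)
qed

lemma permute_param_Theta:
  assumes \<theta>: "\<theta> \<in> Theta V" and \<sigma>: "\<sigma> permutes {..<num_components \<theta>}"
  shows "permute_param \<sigma> \<theta> \<in> Theta V"
proof -
  obtain k w v where [simp]: "\<theta> = (k, w, v)" by (metis prod_cases3)
  have \<sigma>': "\<sigma> permutes {..<k}" using \<sigma> by (simp add: num_components_def)
  have "\<sigma> i < k \<longleftrightarrow> i < k" for i using permutes_in_image[OF \<sigma>', of i] by auto
  then have "(\<lambda>i. v (\<sigma> i)) \<in> {..<k} \<rightarrow>\<^sub>E V"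
    using \<theta> permutes_not_in[OF \<sigma>'] by (auto simp: Theta_def PiE_iff extensional_def)
  then show ?thesis
    using \<theta> prob_simplex_permute[OF _ \<sigma>'] by (auto simp: Theta_def permute_param_def)
qed

lemma permute_param_inv:
  assumes "\<sigma> permutes S"
  shows "permute_param (inv \<sigma>) (permute_param \<sigma> \<theta>) = \<theta>" "permute_param \<sigma> (permute_param (inv \<sigma>) \<theta>) = \<theta>"
  using permutes_inverses[OF assms] by (auto simp: permute_param_def split: prod.splits)

lemma num_components_permute [simp]: "num_components (permute_param \<sigma> \<theta>) = num_components \<theta>"
  by (auto simp: num_components_def permute_param_def split: prod.splits)

lemma dist_Theta_permute:
  assumes \<sigma>: "\<sigma> permutes {..<num_components \<theta>}"
  shows "dist_Theta (permute_param \<sigma> \<theta>) (permute_param \<sigma> \<theta>') = dist_Theta \<theta> \<theta>'"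
proof -
  obtain k w v k' w' v' where [simp]: "\<theta> = (k, w, v)" "\<theta>' = (k', w', v')" by (metis prod_cases3)
  have \<sigma>': "\<sigma> permutes {..<k}" using \<sigma> by (simp add: num_components_def)
  show ?thesis
    using sum.permute[OF \<sigma>', of "\<lambda>i. (w i - w' i)\<^sup>2"] sum.permute[OF \<sigma>', of "\<lambda>i. (norm (v i - v' i))\<^sup>2"]
    by (cases "k' = k") (simp_all add: dist_Theta_def permute_param_def comp_def)
qed

lemma permute_param_measurable:
  fixes V :: "'v::euclidean_space set"
  shows "permute_param \<sigma> \<in> (borel :: 'v param measure) \<rightarrow>\<^sub>M borel"
proof -
  have "(\<lambda>\<theta> :: 'v param. (fst \<theta>, \<lambda>i. fst (snd \<theta>) (\<sigma> i), \<lambda>i. snd (snd \<theta>) (\<sigma> i))) \<in> borel \<rightarrow>\<^sub>M borel"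
    by (intro measurable_to_param measurable_param_coords)
  then show ?thesis by (simp add: permute_param_def split_beta')
qed

text \<open>
  Finite intersections of members of a countable basis. The empty intersection accounts for \<open>X\<close>
  itself.
\<close>

lemma countable_generator_restrict_borel:
  fixes X :: "'x::second_countable_topology set"
  shows "\<exists>A :: nat \<Rightarrow> 'x set. Int_stable (range A) \<and> X \<in> range A \<and> range A \<subseteq> Pow X \<and>
    sets (restrict_space borel X) = sigma_sets X (range A)"
proof -
  obtain B :: "'x set set" where B: "countable B" "topological_basis B"
    using ex_countable_basis by auto
  define \<A> where "\<A> = (\<lambda>b. X \<inter> \<Inter>b) ` {b. finite b \<and> b \<subseteq> B}"
  have "countable \<A>" unfolding \<A>_def
    by (intro countable_image countable_Collect_finite_subset B)
  moreover have X: "X \<in> \<A>" unfolding \<A>_def by (intro image_eqI[of _ _ "{}"]) auto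
  ultimately have range: "range (from_nat_into \<A>) = \<A>" by (intro range_from_nat_into) auto
  have "Int_stable \<A>"
    unfolding Int_stable_def
  proof safe
    fix a b assume "a \<in> \<A>" "b \<in> \<A>"
    then obtain a' b' where "finite a'" "a' \<subseteq> B" "a = X \<inter> \<Inter>a'" "finite b'" "b' \<subseteq> B" "b = X \<inter> \<Inter>b'"
      by (auto simp: \<A>_def)
    then show "a \<inter> b \<in> \<A>" unfolding \<A>_def by (intro image_eqI[of _ _ "a' \<union> b'"]) auto
  qed
  moreover have "sets (restrict_space borel X) = sigma_sets X \<A>"
  proof
    have "sets borel = sigma_sets UNIV B"
      by (subst borel_eq_countable_basis[OF B]) simp
    then have "sets (restrict_space borel X) = {(\<lambda>x. x) -` A \<inter> X | A. A \<in> sigma_sets UNIV B}"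
      by (auto simp: sets_restrict_space image_def Int_commute)
    also have "\<dots> = sigma_sets X {(\<lambda>x. x) -` W \<inter> X | W. W \<in> B}"
      by (rule sigma_sets_vimage_commute) auto
    also have "\<dots> \<subseteq> sigma_sets X \<A>"
    proof (rule sigma_sets_mono')
      show "{(\<lambda>x. x) -` W \<inter> X | W. W \<in> B} \<subseteq> \<A>"
      proof safe
        fix W assume "W \<in> B"
        then show "(\<lambda>x. x) -` W \<inter> X \<in> \<A>" unfolding \<A>_def by (intro image_eqI[of _ _ "{W}"]) auto
      qed
    qed
    finally show "sets (restrict_space borel X) \<subseteq> sigma_sets X \<A>" .
    have "\<A> \<subseteq> sets (restrict_space borel X)"
    proof
      fix a assume "a \<in> \<A>"
      then obtain b where b: "finite b" "b \<subseteq> B" "a = X \<inter> \<Inter>b" by (auto simp: \<A>_def)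
      have "\<Inter>b \<in> sets borel"
        using b B(2) by (intro borel_open open_Inter) (auto simp: topological_basis_open)
      then show "a \<in> sets (restrict_space borel X)" using b by (auto simp: sets_restrict_space)
    qed
    then have "sigma_sets (space (restrict_space borel X)) \<A> \<subseteq> sets (restrict_space borel X)"
      by (rule sets.sigma_sets_subset)
    then show "sigma_sets X \<A> \<subseteq> sets (restrict_space borel X)" by (simp add: space_restrict_space)
  qed
  moreover have "\<A> \<subseteq> Pow X" by (auto simp: \<A>_def)
  ultimately show ?thesis using X by (intro exI[of _ "from_nat_into \<A>"]) (simp add: range)
qed

section \<open>The posterior under the model\<close>

locale mixture_model =
  fixes V :: "'v::euclidean_space set"
    and \<X> :: "'x::polish_space set"
    and F :: "'v \<Rightarrow> 'x measure"
    and \<pi> :: "nat measure"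
    and D :: "nat \<Rightarrow> (nat \<Rightarrow> real) measure"
    and G :: "nat \<Rightarrow> (nat \<Rightarrow> 'v) measure"
    and N :: "'x measure"
  assumes N_eq: "N = restrict_space borel \<X>"
    and V: "V \<in> sets borel"
    and F: "\<And>v. v \<in> V \<Longrightarrow> F v \<in> space (prob_algebra N)"
    and \<pi>: "\<pi> \<in> space (prob_algebra (count_space {1..}))"
    and D: "\<And>k. 1 \<le> k \<Longrightarrow> D k \<in> space (prob_algebra (borel_simplex k))"
    and G: "\<And>k. 1 \<le> k \<Longrightarrow> G k \<in> space (prob_algebra (borel_components V k))"
    and F_measurable: "\<And>A. A \<in> sets N \<Longrightarrow>
      (\<lambda>v. measure (F v) A) \<in> borel_measurable (restrict_space borel V)"
begin

abbreviation "P \<equiv> mixture_param N F"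
abbreviation "seqs \<equiv> Pi\<^sub>M (UNIV :: nat set) (\<lambda>_. N)"
abbreviation "data \<theta> \<equiv> Pi\<^sub>M (UNIV :: nat set) (\<lambda>_. P \<theta>)"
abbreviation "\<mu> \<equiv> prior V \<pi> D G"
abbreviation "M \<equiv> model V N F \<pi> D G"

lemma P_kernel: "P \<in> borel_Theta V \<rightarrow>\<^sub>M prob_algebra N"
  by (rule mixture_param_kernel[OF V F F_measurable])

lemma P_prob: "\<theta> \<in> Theta V \<Longrightarrow> prob_space (P \<theta>)" "\<theta> \<in> Theta V \<Longrightarrow> sets (P \<theta>) = sets N"
  using measurable_space[OF P_kernel, of \<theta>] by (auto simp: space_prob_algebra)

lemma data_kernel: "data \<in> borel_Theta V \<rightarrow>\<^sub>M prob_algebra seqs"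
  by (rule prob_algebra_PiM[OF P_kernel])

lemma data_prob: "\<theta> \<in> Theta V \<Longrightarrow> prob_space (data \<theta>)" "\<theta> \<in> Theta V \<Longrightarrow> sets (data \<theta>) = sets seqs"
  using measurable_space[OF data_kernel, of \<theta>] by (auto simp: space_prob_algebra)

lemma sets_\<pi>: "sets \<pi> = Pow {1..}" and space_\<pi>: "space \<pi> = {1..}" and prob_\<pi>: "prob_space \<pi>"
  using \<pi> sets_eq_imp_space_eq[of \<pi> "count_space {1..}"] by (auto simp: space_prob_algebra)

definition component_prior :: "nat \<Rightarrow> 'v param measure" where
  "component_prior k = distr (D k \<Otimes>\<^sub>M G k) (borel_Theta V) (\<lambda>(w, v). (k, w, v))"

lemma component_map_measurable:
  assumes k: "1 \<le> k"
  shows "(\<lambda>(w, v). (k, w, v)) \<in> D k \<Otimes>\<^sub>M G k \<rightarrow>\<^sub>M borel_Theta V"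
  using param_pair_measurable[OF k, of V] D[OF k] G[OF k]
  by (simp add: space_prob_algebra cong: measurable_cong_sets sets_pair_measure_cong)

lemma component_prior_prob: "1 \<le> k \<Longrightarrow> component_prior k \<in> space (prob_algebra (borel_Theta V))"
  using D[of k] G[of k] component_map_measurable[of k]
  unfolding component_prior_def space_prob_algebra
  by (auto intro!: prob_space.prob_space_distr prob_space_pair)

lemma component_prior_kernel: "component_prior \<in> \<pi> \<rightarrow>\<^sub>M prob_algebra (borel_Theta V)"
proof -
  have "component_prior \<in> count_space {1..} \<rightarrow>\<^sub>M prob_algebra (borel_Theta V)"
    using component_prior_prob by auto
  then show ?thesis
    by (subst measurable_cong_sets[of \<pi> "count_space {1..}"]) (auto simp: sets_\<pi>)
qed

lemma prior_eq: "\<mu> = \<pi> \<bind> component_prior"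
  by (simp add: prior_def component_prior_def[abs_def])

lemma prior_prob: "\<mu> \<in> space (prob_algebra (borel_Theta V))"
proof -
  have \<pi>': "\<pi> \<in> space (prob_algebra \<pi>)" using prob_\<pi> by (simp add: space_prob_algebra)
  show ?thesis
    unfolding space_prob_algebra prior_eq
    using prob_space_bind'[OF \<pi>' component_prior_kernel] sets_bind'[OF \<pi>' component_prior_kernel] by simp
qed

lemma sets_prior: "sets \<mu> = sets (borel_Theta V)" and space_prior: "space \<mu> = Theta V"
  using prior_prob sets_eq_imp_space_eq[of \<mu> "borel_Theta V"] by (auto simp: space_prob_algebra)

lemma AE_prior:
  assumes Q: "{\<theta> \<in> Theta V. Q \<theta>} \<in> sets (borel_Theta V)"
  shows "(AE \<theta> in \<mu>. Q \<theta>) \<longleftrightarrow> (AE k in \<pi>. AE (w, v) in D k \<Otimes>\<^sub>M G k. Q (k, w, v))"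
proof -
  have Q': "Measurable.pred (borel_Theta V) Q" using Q by (simp add: pred_def)
  have "(AE \<theta> in \<mu>. Q \<theta>) \<longleftrightarrow> (AE k in \<pi>. AE \<theta> in component_prior k. Q \<theta>)"
    unfolding prior_eq by (rule AE_bind[OF measurable_prob_algebraD[OF component_prior_kernel] Q'])
  also have "\<dots> \<longleftrightarrow> (AE k in \<pi>. AE (w, v) in D k \<Otimes>\<^sub>M G k. Q (k, w, v))"
  proof (rule AE_cong)
    fix k assume "k \<in> space \<pi>"
    then have k: "1 \<le> k" by (simp add: space_\<pi>)
    show "(AE \<theta> in component_prior k. Q \<theta>) \<longleftrightarrow> (AE (w, v) in D k \<Otimes>\<^sub>M G k. Q (k, w, v))"
      unfolding component_prior_def
      using AE_distr_iff[OF component_map_measurable[OF k], of Q] Q by (simp add: split_beta')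
  qed
  finally show ?thesis .
qed

abbreviation "joint \<theta> \<equiv> distr (data \<theta>) (borel_Theta V \<Otimes>\<^sub>M seqs) (\<lambda>x. (\<theta>, x))"

lemma joint_kernel: "joint \<in> borel_Theta V \<rightarrow>\<^sub>M prob_algebra (borel_Theta V \<Otimes>\<^sub>M seqs)"
  by (rule measurable_distr_prob_space2[OF data_kernel]) simp

lemma model_eq: "M = \<mu> \<bind> joint"
  by (simp add: model_def)

lemma prob_M: "prob_space M" and sets_M: "sets M = sets (borel_Theta V \<Otimes>\<^sub>M seqs)"
  unfolding model_eq
  using prob_space_bind'[OF prior_prob joint_kernel] sets_bind'[OF prior_prob joint_kernel] by auto

lemma space_M: "space M = Theta V \<times> space seqs"
  using sets_eq_imp_space_eq[OF sets_M] by (simp add: space_pair_measure)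

lemma AE_model:
  assumes Q: "{\<omega> \<in> space M. Q \<omega>} \<in> sets M"
  shows "(AE \<omega> in M. Q \<omega>) \<longleftrightarrow> (AE \<theta> in \<mu>. AE x in data \<theta>. Q (\<theta>, x))"
proof -
  have Q': "{\<omega> \<in> space (borel_Theta V \<Otimes>\<^sub>M seqs). Q \<omega>} \<in> sets (borel_Theta V \<Otimes>\<^sub>M seqs)"
    using Q by (simp add: sets_M sets_eq_imp_space_eq[OF sets_M])
  have "joint \<in> \<mu> \<rightarrow>\<^sub>M subprob_algebra (borel_Theta V \<Otimes>\<^sub>M seqs)"
    using measurable_prob_algebraD[OF joint_kernel] by (simp add: measurable_cong_sets[OF sets_prior refl])
  then have "(AE \<omega> in M. Q \<omega>) \<longleftrightarrow> (AE \<theta> in \<mu>. AE \<omega> in joint \<theta>. Q \<omega>)"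
    unfolding model_eq by (rule AE_bind) (use Q' in \<open>simp add: pred_def\<close>)
  also have "\<dots> \<longleftrightarrow> (AE \<theta> in \<mu>. AE x in data \<theta>. Q (\<theta>, x))"
  proof (rule AE_cong)
    fix \<theta> assume "\<theta> \<in> space \<mu>"
    then have \<theta>: "\<theta> \<in> Theta V" by (simp add: space_prior)
    have "(\<lambda>x. (\<theta>, x)) \<in> data \<theta> \<rightarrow>\<^sub>M borel_Theta V \<Otimes>\<^sub>M seqs"
      using \<theta> data_prob(2)[OF \<theta>] by (intro measurable_Pair measurable_const measurable_ident_sets) auto
    then show "(AE \<omega> in joint \<theta>. Q \<omega>) \<longleftrightarrow> (AE x in data \<theta>. Q (\<theta>, x))"
      using Q' by (rule AE_distr_iff)
  qed
  finally show ?thesis .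
qed

lemma distinguishing_sets:
  "\<exists>A :: nat \<Rightarrow> 'x set. range A \<subseteq> sets N \<and> (\<forall>\<theta>\<in>Theta V. \<forall>\<theta>'\<in>Theta V.
    (\<forall>j. measure (P \<theta>) (A j) = measure (P \<theta>') (A j)) \<longrightarrow> P \<theta> = P \<theta>')"
proof -
  have space_N: "space N = \<X>" by (simp add: N_eq space_restrict_space)
  obtain A :: "nat \<Rightarrow> 'x set" where A: "Int_stable (range A)" "\<X> \<in> range A" "range A \<subseteq> Pow \<X>"
    "sets N = sigma_sets \<X> (range A)"
    using countable_generator_restrict_borel[of \<X>] unfolding N_eq by auto
  have "P \<theta> = P \<theta>'" if \<theta>: "\<theta> \<in> Theta V" "\<theta>' \<in> Theta V"
    and eq: "\<And>j. measure (P \<theta>) (A j) = measure (P \<theta>') (A j)" for \<theta> \<theta>'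
  proof (rule measure_eqI_generator_eq[OF A(1,3)])
    interpret P: prob_space "P \<theta>" by (rule P_prob[OF \<theta>(1)])
    interpret P': prob_space "P \<theta>'" by (rule P_prob[OF \<theta>(2)])
    show "emeasure (P \<theta>) X = emeasure (P \<theta>') X" if "X \<in> range A" for X
      using that eq by (auto simp: P.emeasure_eq_measure P'.emeasure_eq_measure)
    show "sets (P \<theta>) = sigma_sets \<X> (range A)" "sets (P \<theta>') = sigma_sets \<X> (range A)"
      using P_prob(2) \<theta> A(4) by auto
    show "range (\<lambda>_::nat. \<X>) \<subseteq> range A" "(\<Union>i::nat. \<X>) = \<X>" using A(2) by auto
    show "emeasure (P \<theta>) \<X> \<noteq> \<infinity>" by simp
  qed
  moreover have "range A \<subseteq> sets N" unfolding A(4) by (auto intro: sigma_sets.Basic)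
  ultimately show ?thesis by (intro exI[of _ A]) blast
qed

lemma frequencies_determine_statistic:
  fixes A :: "nat \<Rightarrow> 'x set"
  assumes A: "range A \<subseteq> sets N"
  shows "(\<lambda>x j. lim (\<lambda>n. freq (A j) n x)) \<in> seqs \<rightarrow>\<^sub>M borel"
    and "\<theta> \<in> Theta V \<Longrightarrow> AE x in data \<theta>. (\<lambda>j. lim (\<lambda>n. freq (A j) n x)) = (\<lambda>j. measure (P \<theta>) (A j))"
proof -
  have A_N: "A j \<in> sets N" for j using A by auto
  have freq: "freq (A j) n \<in> seqs \<rightarrow>\<^sub>M borel" for j n
    unfolding freq_def
    by (intro borel_measurable_divide borel_measurable_sum borel_measurable_const
        measurable_compose[OF measurable_component_singleton borel_measurable_indicator] A_N) auto
  have "(\<lambda>x. lim (\<lambda>n. freq (A j) n x)) \<in> seqs \<rightarrow>\<^sub>M borel" for j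
    by (rule borel_measurable_lim_metric) (rule freq)
  then show "(\<lambda>x j. lim (\<lambda>n. freq (A j) n x)) \<in> seqs \<rightarrow>\<^sub>M borel"
    unfolding measurable_cong_sets[OF refl sets_PiM_equal_borel[symmetric]]
    by (intro measurable_PiM_single') auto
  assume \<theta>: "\<theta> \<in> Theta V"
  have "AE x in data \<theta>. \<forall>j. (\<lambda>n. freq (A j) n x) \<longlonglongrightarrow> measure (P \<theta>) (A j)"
    unfolding AE_all_countable
    using P_prob[OF \<theta>] A_N by (intro allI freq_tendsto_AE) auto
  then show "AE x in data \<theta>. (\<lambda>j. lim (\<lambda>n. freq (A j) n x)) = (\<lambda>j. measure (P \<theta>) (A j))"
    by eventually_elim (auto intro: limI)
qed

end

definition perm_invariant :: "'v param set \<Rightarrow> bool" where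
  "perm_invariant B \<longleftrightarrow>
    (\<forall>\<theta>\<in>B. \<forall>\<sigma>. \<sigma> permutes {..<num_components \<theta>} \<longrightarrow> permute_param \<sigma> \<theta> \<in> B)"

definition distinct_Theta :: "'v set \<Rightarrow> 'v param set" where
  "distinct_Theta V = {(k, w, v) \<in> Theta V. inj_on v {..<k}}"

locale identifiable_mixture = mixture_model V \<X> F \<pi> D G N
  for V :: "'v::euclidean_space set" and \<X> :: "'x::polish_space set" and F \<pi> D G N +
  assumes identifiable: "\<And>k k' w w' v v'.
      \<lbrakk>1 \<le> k; 1 \<le> k'; w \<in> prob_simplex k; w' \<in> prob_simplex k'; v \<in> {..<k} \<rightarrow>\<^sub>E V; v' \<in> {..<k'} \<rightarrow>\<^sub>E V;
       mixture N F k w v = mixture N F k' w' v'\<rbrakk> \<Longrightarrow>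
      mixture (restrict_space borel V) (return (restrict_space borel V)) k w v =
      mixture (restrict_space borel V) (return (restrict_space borel V)) k' w' v'"
    and distinct: "\<And>k i j. \<lbrakk>1 \<le> k; i < j; j < k\<rbrakk> \<Longrightarrow> \<P>(v in G k. v i = v j) = 0"
begin

lemma identifiable_permute:
  assumes "\<theta> \<in> distinct_Theta V" "\<theta>' \<in> distinct_Theta V" "P \<theta> = P \<theta>'"
  shows "\<exists>\<sigma>. \<sigma> permutes {..<num_components \<theta>} \<and> \<theta>' = permute_param \<sigma> \<theta>"
proof -
  obtain k w v k' w' v' where [simp]: "\<theta> = (k, w, v)" "\<theta>' = (k', w', v')" by (metis prod_cases3)
  have \<theta>: "(k, w, v) \<in> Theta V" "inj_on v {..<k}" "(k', w', v') \<in> Theta V" "inj_on v' {..<k'}"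
    using assms by (auto simp: distinct_Theta_def)
  have "mixture N F k w v = mixture N F k' w' v'" using assms(3) by (simp add: mixture_param_def)
  then have "mixture (restrict_space borel V) (return (restrict_space borel V)) k w v =
      mixture (restrict_space borel V) (return (restrict_space borel V)) k' w' v'"
    using \<theta> by (intro identifiable) (auto simp: Theta_def)
  from equal_mixing_measure_permute[OF \<theta> this] show ?thesis by (simp add: num_components_def)
qed

lemma distinct_Theta_borel: "distinct_Theta V \<in> sets borel"
proof -
  define b where "b i \<theta> = snd (snd \<theta>) i" for i and \<theta> :: "'v param"
  have [measurable]: "b i \<in> borel \<rightarrow>\<^sub>M borel" for i
    unfolding b_def by (rule measurable_param_coords)
  define Q where "Q k \<theta> \<longleftrightarrow> (\<forall>i j. i < k \<longrightarrow> j < k \<longrightarrow> b i \<theta> = b j \<theta> \<longrightarrow> i = j)" for k \<theta>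
  have [measurable]: "Q k \<in> borel \<rightarrow>\<^sub>M count_space UNIV" for k
    unfolding Q_def by measurable
  have "(\<lambda>\<theta>. Q (fst \<theta>) \<theta>) \<in> borel \<rightarrow>\<^sub>M count_space UNIV"
    by (rule measurable_compose_countable[of Q]) (auto intro: measurable_param_coords)
  then have "{\<theta>. Q (fst \<theta>) \<theta>} \<in> sets borel" by (simp add: pred_def)
  then have "{\<theta>. Q (fst \<theta>) \<theta>} \<inter> Theta V \<in> sets borel" using Theta_borel[OF V] by auto
  also have "{\<theta>. Q (fst \<theta>) \<theta>} \<inter> Theta V = distinct_Theta V"
    by (auto simp: distinct_Theta_def Q_def b_def inj_on_def)
  finally show ?thesis .
qed

lemma sets_borel_Theta_iff: "B \<in> sets (borel_Theta V) \<longleftrightarrow> B \<subseteq> Theta V \<and> B \<in> sets borel"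
  unfolding sets_borel_Theta using Theta_borel[OF V] by (subst sets_restrict_space_iff) auto

lemma AE_distinct: "AE \<theta> in \<mu>. \<theta> \<in> distinct_Theta V"
proof -
  have meas: "{\<theta> \<in> Theta V. \<theta> \<in> distinct_Theta V} \<in> sets (borel_Theta V)"
    using distinct_Theta_borel Theta_borel[OF V] by (auto simp: sets_borel_Theta_iff)
  have comp: "AE (w, v) in D k \<Otimes>\<^sub>M G k. (k, w, v) \<in> distinct_Theta V" if "k \<in> space \<pi>" for k
  proof -
    have k: "1 \<le> k" using that by (simp add: space_\<pi>)
    have sets_D: "sets (D k) = sets (borel_simplex k)" and sets_G: "sets (G k) = sets (borel_components V k)"
      using D[OF k] G[OF k] by (auto simp: space_prob_algebra)
    note space_D = sets_eq_imp_space_eq[OF sets_D] and space_G = sets_eq_imp_space_eq[OF sets_G]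
    interpret D: prob_space "D k" using D[OF k] by (simp add: space_prob_algebra)
    interpret G: prob_space "G k" using G[OF k] by (simp add: space_prob_algebra)
    interpret DG: pair_prob_space "D k" "G k" ..
    have ne: "AE v in G k. v i \<noteq> v j" if ij: "i < j" "j < k" for i j
    proof -
      have c: "(\<lambda>v. v l) \<in> G k \<rightarrow>\<^sub>M borel" if "l < k" for l
        unfolding measurable_cong_sets[OF sets_G refl] borel_components_def
        using that by (intro measurable_restrict_space1 measurable_component_singleton) simp
      have "{v \<in> space (G k). v i = v j} \<in> sets (G k)"
        using ij by (intro measurable_equality_set c) auto
      then show ?thesis using distinct[OF k ij] by (simp add: G.prob_eq_0)
    qed
    have "AE v in G k. \<forall>j. \<forall>i. i < j \<and> j < k \<longrightarrow> v i \<noteq> v j"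
      unfolding AE_all_countable using ne by auto
    then have inj: "AE v in G k. inj_on v {..<k}"
      by eventually_elim (auto simp: inj_on_def, metis linorder_neqE_nat)
    have "AE w in D k. AE v in G k. (k, fst (w, v), snd (w, v)) \<in> distinct_Theta V"
    proof (rule AE_I2)
      fix w assume w: "w \<in> space (D k)"
      show "AE v in G k. (k, fst (w, v), snd (w, v)) \<in> distinct_Theta V"
        using inj AE_space
      proof eventually_elim
        case (elim v)
        then show ?case using w k by (simp add: distinct_Theta_def Theta_def space_D space_G)
      qed
    qed
    then show ?thesis
      unfolding split_beta'
    proof (rule DG.AE_pair_measure[rotated])
      show "{x \<in> space (D k \<Otimes>\<^sub>M G k). (k, fst x, snd x) \<in> distinct_Theta V} \<in> sets (D k \<Otimes>\<^sub>M G k)"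
        using measurable_sets[OF component_map_measurable[OF k] meas]
        by (simp add: vimage_def Int_def split_beta' conj_commute distinct_Theta_def cong: conj_cong)
    qed
  qed
  show ?thesis unfolding AE_prior[OF meas] by (rule AE_I2) (rule comp)
qed

end

context mixture_model
begin

text \<open>
  The sigma-algebra generated by the first \<open>n\<close> observations, in the form in which it occurs in
  \<open>regular_cond_distr\<close>.
\<close>

definition info :: "nat \<Rightarrow> ('v param \<times> (nat \<Rightarrow> 'x)) measure" where
  "info n = vimage_algebra (space M) (\<lambda>\<omega>. obs n (snd \<omega>)) (Pi\<^sub>M {..<n} (\<lambda>_. N))"

lemma obs_measurable: "obs n \<in> seqs \<rightarrow>\<^sub>M Pi\<^sub>M {..<n} (\<lambda>_. N)"
  unfolding obs_def by (rule measurable_restrict_subset) simp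

lemma fst_snd_measurable: "fst \<in> M \<rightarrow>\<^sub>M borel_Theta V" "snd \<in> M \<rightarrow>\<^sub>M seqs"
  unfolding measurable_cong_sets[OF sets_M refl] by (rule measurable_fst measurable_snd)+

lemma obs_model_measurable: "(\<lambda>\<omega>. obs n (snd \<omega>)) \<in> M \<rightarrow>\<^sub>M Pi\<^sub>M {..<n} (\<lambda>_. N)"
  by (rule measurable_compose[OF fst_snd_measurable(2) obs_measurable])

lemma obs_info: "(\<lambda>\<omega>. obs n (snd \<omega>)) \<in> info n \<rightarrow>\<^sub>M Pi\<^sub>M {..<n} (\<lambda>_. N)"
  unfolding info_def
  by (rule measurable_vimage_algebra1) (use measurable_space[OF obs_model_measurable] in auto)

lemma sets_info: "sets (info n) = {(\<lambda>\<omega>. obs n (snd \<omega>)) -` A \<inter> space M | A. A \<in> sets (Pi\<^sub>M {..<n} (\<lambda>_. N))}"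
  unfolding info_def
  by (rule sets_vimage_algebra2) (use measurable_space[OF obs_model_measurable] in auto)

lemma space_info: "space (info n) = space M"
  by (simp add: info_def)

lemma filtration_info: "prob_filtration M info"
proof (rule prob_filtration.intro)
  show "prob_space M" by (rule prob_M)
  show "prob_filtration_axioms M info"
  proof (rule prob_filtration_axioms.intro)
    show "subalgebra M (info n)" for n
      using measurable_sets[OF obs_model_measurable] by (auto simp: subalgebra_def space_info sets_info)
    fix m n :: nat assume "m \<le> n"
    have "(\<lambda>x. restrict x {..<m}) \<in> Pi\<^sub>M {..<n} (\<lambda>_. N) \<rightarrow>\<^sub>M Pi\<^sub>M {..<m} (\<lambda>_. N)"
      using \<open>m \<le> n\<close> by (intro measurable_restrict_subset) auto
    from measurable_compose[OF obs_info this]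
    have "(\<lambda>\<omega>. obs m (snd \<omega>)) \<in> info n \<rightarrow>\<^sub>M Pi\<^sub>M {..<m} (\<lambda>_. N)"
      using \<open>m \<le> n\<close> by (simp add: obs_def restrict_restrict Int_absorb1 lessThan_subset_iff)
    from measurable_sets[OF this] show "sets (info m) \<subseteq> sets (info n)"
      by (auto simp: sets_info[of m] space_info)
  qed
qed

lemma data_event_in_info:
  assumes C: "C \<in> sets seqs"
  shows "{\<omega> \<in> space M. snd \<omega> \<in> C} \<in> sigma_sets (space M) (\<Union>n. sets (info n))"
proof -
  let ?S = "sigma (space M) (\<Union>n. sets (info n))"
  have sub: "(\<Union>n. sets (info n)) \<subseteq> Pow (space M)" by (auto simp: sets_info)
  have sets_S: "sets ?S = sigma_sets (space M) (\<Union>n. sets (info n))"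
    and space_S: "space ?S = space M" using sub by simp_all
  have "(\<lambda>\<omega> i. snd \<omega> i) \<in> ?S \<rightarrow>\<^sub>M seqs"
  proof (rule measurable_PiM_single')
    fix i :: nat
    have "(\<lambda>\<omega>. obs (Suc i) (snd \<omega>) i) \<in> info (Suc i) \<rightarrow>\<^sub>M N"
      by (rule measurable_compose[OF obs_info measurable_component_singleton]) simp
    then have i: "(\<lambda>\<omega>. snd \<omega> i) \<in> info (Suc i) \<rightarrow>\<^sub>M N" by (simp add: obs_def)
    show "(\<lambda>\<omega>. snd \<omega> i) \<in> ?S \<rightarrow>\<^sub>M N"
    proof (rule measurableI)
      show "snd \<omega> i \<in> space N" if "\<omega> \<in> space ?S" for \<omega>
        using that measurable_space[OF i, of \<omega>] by (simp only: space_S space_info)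
      fix A assume "A \<in> sets N"
      from measurable_sets[OF i this]
      show "(\<lambda>\<omega>. snd \<omega> i) -` A \<inter> space ?S \<in> sets ?S"
        unfolding sets_S space_S space_info by (blast intro: sigma_sets.Basic)
    qed
  next
    show "(\<lambda>\<omega> i. snd \<omega> i) \<in> space ?S \<rightarrow> (\<Pi>\<^sub>E i\<in>UNIV. space N)"
      unfolding space_S by (auto simp: space_M space_PiM)
  qed
  from measurable_sets[OF this C] show ?thesis
    unfolding sets_S space_S by (simp add: vimage_def Int_def conj_commute)
qed

text \<open>
  Posterior probabilities of \<open>B\<close> are conditional probabilities of \<open>C\<close> along the filtration \<open>info\<close>.
\<close>

lemma posterior_tendsto:
  assumes Q: "\<And>n. 1 \<le> n \<Longrightarrow>
      regular_cond_distr M (Pi\<^sub>M {..<n} (\<lambda>_. N)) (\<lambda>\<omega>. obs n (snd \<omega>)) (borel_Theta V) fst (Q n)"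
    and B: "B \<in> sets (borel_Theta V)" and C: "C \<in> sets seqs"
    and eq: "AE \<omega> in M. fst \<omega> \<in> B \<longleftrightarrow> snd \<omega> \<in> C"
  shows "AE \<omega> in M. (\<lambda>n. measure (Q n (obs n (snd \<omega>))) B) \<longlonglongrightarrow> indicator B (fst \<omega>)"
proof -
  interpret prob_filtration M info by (rule filtration_info)
  define C' where "C' = {\<omega> \<in> space M. snd \<omega> \<in> C}"
  have C'_M: "C' \<in> sets M"
    using measurable_sets[OF fst_snd_measurable(2) C] by (simp add: C'_def vimage_def Int_def conj_commute)
  have levy: "AE \<omega> in M. (\<lambda>n. real_cond_exp M (info n) (indicator C') \<omega>) \<longlonglongrightarrow> indicator C' \<omega>"
    unfolding C'_def by (rule levy_upward[OF data_event_in_info[OF C]])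
  have B_M: "(\<lambda>\<omega>. indicator B (fst \<omega>) :: real) \<in> borel_measurable M"
    by (rule measurable_compose[OF fst_snd_measurable(1) borel_measurable_indicator[OF B]])
  have ind: "AE \<omega> in M. indicator B (fst \<omega>) = (indicator C' \<omega> :: real)"
    using eq AE_space by eventually_elim (auto simp: C'_def indicator_def)
  have "AE \<omega> in M. \<forall>n. 1 \<le> n \<longrightarrow>
    measure (Q n (obs n (snd \<omega>))) B = real_cond_exp M (info n) (indicator C') \<omega>"
    unfolding AE_all_countable
  proof
    fix n
    show "AE \<omega> in M. 1 \<le> n \<longrightarrow> measure (Q n (obs n (snd \<omega>))) B = real_cond_exp M (info n) (indicator C') \<omega>"
    proof (cases "1 \<le> n")
      case True
      have "AE \<omega> in M. measure (Q n (obs n (snd \<omega>))) B = real_cond_exp M (info n) (\<lambda>\<omega>. indicator B (fst \<omega>)) \<omega>"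
        using Q[OF True] B unfolding regular_cond_distr_def info_def by auto
      moreover have "AE \<omega> in M. real_cond_exp M (info n) (\<lambda>\<omega>. indicator B (fst \<omega>)) \<omega> = real_cond_exp M (info n) (indicator C') \<omega>"
        by (rule subalg.real_cond_exp_cong[OF ind B_M borel_measurable_indicator[OF C'_M]])
      ultimately show ?thesis by eventually_elim simp
    qed simp
  qed
  with levy ind show ?thesis
  proof eventually_elim
    case (elim \<omega>)
    have "(\<lambda>n. measure (Q n (obs n (snd \<omega>))) B) \<longlonglongrightarrow> indicator C' \<omega>"
      by (rule Lim_transform_eventually[OF elim(1)])
        (use elim(3) in \<open>auto simp: eventually_sequentially intro!: exI[of _ 1]\<close>)
    then show ?case using elim(2) by simp
  qed
qed

end

context identifiable_mixture
begin

text \<open>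
  The statistic \<open>T\<close> separates \<open>B\<close> from its complement among parameters with distinct components:
  two such parameters with equal statistic have the same \<open>P\<close>, hence are permutations of each other,
  and \<open>B\<close> is invariant. The separating Borel set \<open>Z\<close> is then pulled back along the limits \<open>L\<close> of
  empirical frequencies, which agree with \<open>T\<close> almost surely.
\<close>

lemma invariant_event_determined_by_data:
  assumes B: "B \<in> sets (borel_Theta V)" and inv: "perm_invariant B"
  shows "\<exists>C\<in>sets seqs. AE \<omega> in M. fst \<omega> \<in> B \<longleftrightarrow> snd \<omega> \<in> C"
proof -
  from distinguishing_sets obtain A :: "nat \<Rightarrow> 'x set" where A: "range A \<subseteq> sets N"
    and A': "\<forall>\<theta>\<in>Theta V. \<forall>\<theta>'\<in>Theta V. (\<forall>j. measure (P \<theta>) (A j) = measure (P \<theta>') (A j)) \<longrightarrow> P \<theta> = P \<theta>'"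
    by (elim exE conjE)
  have A_sep: "P \<theta> = P \<theta>'"
    if "\<theta> \<in> Theta V" "\<theta>' \<in> Theta V" "\<And>j. measure (P \<theta>) (A j) = measure (P \<theta>') (A j)" for \<theta> \<theta>'
    by (rule A'[rule_format]) (rule that)+
  define T where "T \<theta> = (\<lambda>j. measure (P \<theta>) (A j))" for \<theta>
  \<comment> \<open>\<open>T\<close> is measurable on the parameter space; extended by a constant it is measurable everywhere.\<close>
  define T' where "T' \<theta> = (if \<theta> \<in> Theta V then T \<theta> else (\<lambda>_. 0))" for \<theta>
  have "(\<lambda>\<theta>. measure (P \<theta>) (A j)) \<in> borel_Theta V \<rightarrow>\<^sub>M borel" for j
    using A by (intro measurable_compose[OF P_kernel measurable_measure_prob_algebra]) auto
  then have T_meas: "T \<in> borel_Theta V \<rightarrow>\<^sub>M borel"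
    unfolding T_def measurable_cong_sets[OF refl sets_PiM_equal_borel[symmetric]]
    by (intro measurable_PiM_single') auto
  have T'_meas: "T' \<in> borel \<rightarrow>\<^sub>M borel"
    unfolding T'_def
  proof (rule measurable_restrict_space_iff[THEN iffD1])
    show "T \<in> restrict_space borel (Theta V) \<rightarrow>\<^sub>M borel"
      using T_meas by (simp add: measurable_cong_sets[OF sets_borel_Theta refl])
  qed (use Theta_borel[OF V] in auto)
  \<comment> \<open>Inner regularity holds on complete metric spaces; viewing the number of components as a real gives one.\<close>
  define \<iota> :: "'v param \<Rightarrow> real \<times> (nat \<Rightarrow> real) \<times> (nat \<Rightarrow> 'v)"
    where "\<iota> \<theta> = (real (fst \<theta>), fst (snd \<theta>), snd (snd \<theta>))" for \<theta>
  define \<kappa> :: "real \<times> (nat \<Rightarrow> real) \<times> (nat \<Rightarrow> 'v) \<Rightarrow> 'v param"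
    where "\<kappa> y = (nat \<lfloor>fst y\<rfloor>, fst (snd y), snd (snd y))" for y
  have \<kappa>\<iota> [simp]: "\<kappa> (\<iota> \<theta>) = \<theta>" for \<theta> by (simp add: \<kappa>_def \<iota>_def)
  have \<iota>_meas: "\<iota> \<in> \<mu> \<rightarrow>\<^sub>M borel"
  proof -
    have "(\<lambda>\<theta>. real (fst \<theta>)) \<in> (borel :: 'v param measure) \<rightarrow>\<^sub>M borel"
      by (rule measurable_compose[OF measurable_param_coords(1)]) simp
    moreover have "(\<lambda>\<theta>. fst (snd \<theta>)) \<in> (borel :: 'v param measure) \<rightarrow>\<^sub>M borel"
      "(\<lambda>\<theta>. snd (snd \<theta>)) \<in> (borel :: 'v param measure) \<rightarrow>\<^sub>M borel"
      by (intro borel_measurable_continuous_onI continuous_intros)+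
    ultimately have "\<iota> \<in> borel \<rightarrow>\<^sub>M borel"
      unfolding \<iota>_def borel_prod[symmetric, where 'a=real] borel_prod[symmetric, where 'a="nat \<Rightarrow> real"]
      by (intro measurable_Pair)
    from measurable_compose[OF id_borel_Theta this] show ?thesis
      by (simp add: measurable_cong_sets[OF sets_prior refl])
  qed
  have \<kappa>_meas: "\<kappa> \<in> borel \<rightarrow>\<^sub>M borel"
    unfolding \<kappa>_def
  proof (rule measurable_to_param)
    have "(fst :: real \<times> (nat \<Rightarrow> real) \<times> (nat \<Rightarrow> 'v) \<Rightarrow> real) \<in> borel \<rightarrow>\<^sub>M borel"
      by (intro borel_measurable_continuous_onI continuous_intros)
    from measurable_compose[OF this measurable_real_floor]
    show "(\<lambda>y :: real \<times> (nat \<Rightarrow> real) \<times> (nat \<Rightarrow> 'v). nat \<lfloor>fst y\<rfloor>) \<in> borel \<rightarrow>\<^sub>M count_space UNIV"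
      by (rule measurable_compose) simp
    show "(\<lambda>y :: real \<times> (nat \<Rightarrow> real) \<times> (nat \<Rightarrow> 'v). fst (snd y) i) \<in> borel \<rightarrow>\<^sub>M borel" for i
      by (intro borel_measurable_continuous_onI continuous_intros
          continuous_on_product_then_coordinatewise[of UNIV "\<lambda>y. fst (snd y)"])
    show "(\<lambda>y :: real \<times> (nat \<Rightarrow> real) \<times> (nat \<Rightarrow> 'v). snd (snd y) i) \<in> borel \<rightarrow>\<^sub>M borel" for i
      by (intro borel_measurable_continuous_onI continuous_intros
          continuous_on_product_then_coordinatewise[of UNIV "\<lambda>y. snd (snd y)"])
  qed
  let ?D = "distinct_Theta V"
  have B_borel: "B \<in> sets borel" "B \<subseteq> Theta V" using B by (auto simp: sets_borel_Theta_iff)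
  have D_sub: "?D \<subseteq> Theta V" by (auto simp: distinct_Theta_def)
  have "prob_space \<mu>" using prior_prob by (simp add: space_prob_algebra)
  then have "prob_space (distr \<mu> borel \<iota>)" by (rule prob_space.prob_space_distr) (rule \<iota>_meas)
  moreover have "\<kappa> -` (B \<inter> ?D) \<in> sets borel"
    using measurable_sets[OF \<kappa>_meas, of "B \<inter> ?D"] B_borel distinct_Theta_borel by auto
  moreover have "T' (\<kappa> x) \<noteq> T' (\<kappa> y)" if "x \<in> \<kappa> -` (B \<inter> ?D)" "y \<in> \<kappa> -` (?D - B)" for x y
  proof
    assume eq: "T' (\<kappa> x) = T' (\<kappa> y)"
    have xy: "\<kappa> x \<in> B" "\<kappa> x \<in> ?D" "\<kappa> y \<in> ?D" "\<kappa> y \<notin> B" using that by auto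
    then have \<Theta>: "\<kappa> x \<in> Theta V" "\<kappa> y \<in> Theta V" using D_sub by auto
    then have "T (\<kappa> x) = T (\<kappa> y)" using eq by (simp add: T'_def)
    then have "P (\<kappa> x) = P (\<kappa> y)"
      by (intro A_sep \<Theta>) (simp add: T_def fun_eq_iff)
    then obtain \<sigma> where "\<sigma> permutes {..<num_components (\<kappa> x)}" "\<kappa> y = permute_param \<sigma> (\<kappa> x)"
      by (elim identifiable_permute[OF xy(2,3), THEN exE] conjE)
    then show False using inv xy by (auto simp: perm_invariant_def)
  qed
  ultimately obtain Z where Z: "Z \<in> sets borel"
    "AE y in distr \<mu> borel \<iota>. (y \<in> \<kappa> -` (B \<inter> ?D) \<longrightarrow> T' (\<kappa> y) \<in> Z) \<and> (y \<in> \<kappa> -` (?D - B) \<longrightarrow> T' (\<kappa> y) \<notin> Z)"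
    using ae_separated_by_borel_statistic[of "distr \<mu> borel \<iota>" "\<lambda>y. T' (\<kappa> y)" "\<kappa> -` (B \<inter> ?D)" "\<kappa> -` (?D - B)"]
      measurable_compose[OF \<kappa>_meas T'_meas] by auto
  have TZ: "AE \<theta> in \<mu>. \<theta> \<in> B \<longleftrightarrow> T \<theta> \<in> Z"
    using AE_distrD[OF \<iota>_meas Z(2)] AE_distinct
  proof eventually_elim
    case (elim \<theta>)
    moreover have "T' \<theta> = T \<theta>" using elim(2) D_sub by (auto simp: T'_def)
    ultimately show ?case by auto
  qed
  define L where "L x = (\<lambda>j. lim (\<lambda>n. freq (A j) n x))" for x
  have L_meas: "L \<in> seqs \<rightarrow>\<^sub>M borel"
    unfolding L_def by (rule frequencies_determine_statistic(1)[OF A])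
  define C where "C = L -` Z \<inter> space seqs"
  have C: "C \<in> sets seqs" unfolding C_def by (rule measurable_sets[OF L_meas Z(1)])
  have meas: "{\<omega> \<in> space M. fst \<omega> \<in> B \<longleftrightarrow> snd \<omega> \<in> C} \<in> sets M"
  proof -
    have "fst -` B \<inter> space M \<in> sets M" "snd -` C \<inter> space M \<in> sets M"
      by (rule measurable_sets[OF fst_snd_measurable(1) B] measurable_sets[OF fst_snd_measurable(2) C])+
    then have "space M - sym_diff (fst -` B \<inter> space M) (snd -` C \<inter> space M) \<in> sets M" by auto
    also have "space M - sym_diff (fst -` B \<inter> space M) (snd -` C \<inter> space M) = {\<omega> \<in> space M. fst \<omega> \<in> B \<longleftrightarrow> snd \<omega> \<in> C}"
      by auto
    finally show ?thesis .
  qed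
  have "AE \<theta> in \<mu>. AE x in data \<theta>. \<theta> \<in> B \<longleftrightarrow> x \<in> C"
    using TZ AE_space
  proof eventually_elim
    case (elim \<theta>)
    then have \<theta>: "\<theta> \<in> Theta V" by (simp add: space_prior)
    have "AE x in data \<theta>. L x = T \<theta>"
      unfolding L_def T_def by (rule frequencies_determine_statistic(2)[OF A \<theta>])
    then show ?case
      using AE_space
    proof eventually_elim
      case (elim x)
      then have "x \<in> space seqs" using sets_eq_imp_space_eq[OF data_prob(2)[OF \<theta>]] by simp
      then show ?case using elim(1) \<open>\<theta> \<in> B \<longleftrightarrow> T \<theta> \<in> Z\<close> by (simp add: C_def)
    qed
  qed
  then have "AE \<omega> in M. fst \<omega> \<in> B \<longleftrightarrow> snd \<omega> \<in> C"
    unfolding AE_model[OF meas] by simp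
  then show ?thesis using C by blast
qed

end

section \<open>Permutation-invariant neighbourhoods\<close>

definition saturation :: "'v::euclidean_space set \<Rightarrow> 'v param set \<Rightarrow> 'v param set" where
  "saturation V W = {\<theta> \<in> Theta V. \<exists>\<sigma>. \<sigma> permutes {..<num_components \<theta>} \<and> permute_param \<sigma> \<theta> \<in> W}"

lemma saturation_invariant: "perm_invariant (saturation V W)"
  unfolding perm_invariant_def
proof (intro ballI allI impI)
  fix \<theta> \<tau> assume "\<theta> \<in> saturation V W" and \<tau>: "\<tau> permutes {..<num_components \<theta>}"
  then obtain \<sigma> where \<theta>: "\<theta> \<in> Theta V" and \<sigma>: "\<sigma> permutes {..<num_components \<theta>}" "permute_param \<sigma> \<theta> \<in> W"
    by (auto simp: saturation_def)
  have "permute_param (inv \<tau> \<circ> \<sigma>) (permute_param \<tau> \<theta>) = permute_param \<sigma> \<theta>"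
    using permutes_inverses[OF \<tau>] by (auto simp: permute_param_def split: prod.splits)
  moreover have "inv \<tau> \<circ> \<sigma> permutes {..<num_components \<theta>}"
    using permutes_compose[OF \<sigma>(1) permutes_inv[OF \<tau>]] .
  ultimately show "permute_param \<tau> \<theta> \<in> saturation V W"
    using permute_param_Theta[OF \<theta> \<tau>] \<sigma>(2) unfolding saturation_def by auto
qed

lemma saturation_sets:
  fixes V :: "'v::euclidean_space set"
  assumes V: "V \<in> sets borel" and W: "W \<in> sets borel"
  shows "saturation V W \<in> sets (borel_Theta V)"
proof -
  define E where "E k \<sigma> = (fst -` {k} \<inter> permute_param \<sigma> -` W :: 'v param set)" for k \<sigma>
  have "E k \<sigma> \<in> sets borel" for k \<sigma>
    unfolding E_def
    using measurable_sets[OF measurable_param_coords(1), of "{k}"] measurable_sets[OF permute_param_measurable W, of \<sigma>]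
    by auto
  then have "(\<Union>\<sigma>\<in>{\<sigma>. \<sigma> permutes {..<k}}. E k \<sigma>) \<in> sets borel" for k
    by (intro sets.finite_UN finite_permutations) auto
  then have "(\<Union>k. \<Union>\<sigma>\<in>{\<sigma>. \<sigma> permutes {..<k}}. E k \<sigma>) \<in> sets borel"
    by (intro sets.countable_UN) auto
  then have "Theta V \<inter> (\<Union>k. \<Union>\<sigma>\<in>{\<sigma>. \<sigma> permutes {..<k}}. E k \<sigma>) \<in> sets (borel_Theta V)"
    unfolding sets_borel_Theta sets_restrict_space by blast
  also have "Theta V \<inter> (\<Union>k. \<Union>\<sigma>\<in>{\<sigma>. \<sigma> permutes {..<k}}. E k \<sigma>) = saturation V W"
    by (auto simp: saturation_def E_def num_components_def)
  finally show ?thesis .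
qed

lemma openin_dist_ball:
  assumes "c \<in> Theta V"
  shows "openin (Metric_space.mtopology (Theta V) dist_Theta) {\<theta> \<in> Theta V. dist_Theta \<theta> c < \<epsilon>}"
proof -
  interpret Metric_space "Theta V" dist_Theta by (rule Metric_space_Theta)
  have "mball c \<epsilon> = {\<theta> \<in> Theta V. dist_Theta \<theta> c < \<epsilon>}"
    unfolding mball_def using assms commute by auto
  then show ?thesis using openin_mball by metis
qed

lemma perm_ball_sets:
  assumes \<theta>: "\<theta>\<^sub>0 \<in> Theta V"
  shows "perm_ball V \<theta>\<^sub>0 \<epsilon> \<in> sets (borel_Theta V)"
  unfolding perm_ball_def
proof (rule sets.finite_UN)
  show "finite {\<sigma>. \<sigma> permutes {..<num_components \<theta>\<^sub>0}}" by (rule finite_permutations) simp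
  fix \<sigma> assume "\<sigma> \<in> {\<sigma>. \<sigma> permutes {..<num_components \<theta>\<^sub>0}}"
  then have "openin (Metric_space.mtopology (Theta V) dist_Theta) {\<theta> \<in> Theta V. dist_Theta \<theta> (permute_param \<sigma> \<theta>\<^sub>0) < \<epsilon>}"
    by (intro openin_dist_ball permute_param_Theta[OF \<theta>]) simp
  then have "openin (top_of_set (Theta V)) {\<theta> \<in> Theta V. dist_Theta \<theta> (permute_param \<sigma> \<theta>\<^sub>0) < \<epsilon>}"
    by (simp only: openin_Theta_iff)
  then show "{\<theta> \<in> Theta V. dist_Theta \<theta> (permute_param \<sigma> \<theta>\<^sub>0) < \<epsilon>} \<in> sets (borel_Theta V)"
    unfolding sets_borel_Theta sets_restrict_space openin_open by (auto intro: borel_open)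
qed

text \<open>
  Saturations of basic open sets are small enough: \<open>dist_Theta\<close> is unchanged when both arguments are
  permuted, so a permutation that moves \<open>\<theta>\<close> close to \<open>\<theta>\<^sub>0\<close> can be undone on \<open>\<theta>\<^sub>0\<close>.
\<close>

lemma saturation_in_perm_ball:
  assumes basis: "topological_basis \<B>" and \<theta>: "\<theta>\<^sub>0 \<in> Theta V" and \<epsilon>: "\<epsilon> > 0"
  shows "\<exists>W\<in>\<B>. \<theta>\<^sub>0 \<in> saturation V W \<and> saturation V W \<subseteq> perm_ball V \<theta>\<^sub>0 \<epsilon>"
proof -
  interpret Metric_space "Theta V" dist_Theta by (rule Metric_space_Theta)
  have "openin (top_of_set (Theta V)) {\<theta> \<in> Theta V. dist_Theta \<theta> \<theta>\<^sub>0 < \<epsilon>}"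
    using openin_dist_ball[OF \<theta>] by (simp only: openin_Theta_iff)
  then obtain U where U: "open U" "{\<theta> \<in> Theta V. dist_Theta \<theta> \<theta>\<^sub>0 < \<epsilon>} = Theta V \<inter> U"
    by (auto simp: openin_open)
  have "dist_Theta \<theta>\<^sub>0 \<theta>\<^sub>0 = 0" using zero[OF \<theta> \<theta>] by simp
  then have "\<theta>\<^sub>0 \<in> Theta V \<inter> U" unfolding U(2)[symmetric] using \<theta> \<epsilon> by simp
  then have \<theta>U: "\<theta>\<^sub>0 \<in> U" by simp
  obtain W where W: "W \<in> \<B>" "\<theta>\<^sub>0 \<in> W" "W \<subseteq> U"
    by (rule topological_basisE[OF basis U(1) \<theta>U])
  have "\<theta>\<^sub>0 \<in> saturation V W"
  proof -
    have "permute_param id \<theta>\<^sub>0 = \<theta>\<^sub>0" by (auto simp: permute_param_def split: prod.splits)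
    then show ?thesis
      using \<theta> W(2) permutes_id[of "{..<num_components \<theta>\<^sub>0}"] by (auto simp: saturation_def intro!: exI[of _ id])
  qed
  moreover have "saturation V W \<subseteq> perm_ball V \<theta>\<^sub>0 \<epsilon>"
  proof
    fix \<theta> assume "\<theta> \<in> saturation V W"
    then obtain \<sigma> where \<theta>': "\<theta> \<in> Theta V" and \<sigma>: "\<sigma> permutes {..<num_components \<theta>}" "permute_param \<sigma> \<theta> \<in> W"
      by (auto simp: saturation_def)
    have "permute_param \<sigma> \<theta> \<in> Theta V \<inter> U"
      using permute_param_Theta[OF \<theta>' \<sigma>(1)] \<sigma>(2) W(3) by auto
    then have d: "dist_Theta (permute_param \<sigma> \<theta>) \<theta>\<^sub>0 < \<epsilon>" unfolding U(2)[symmetric] by simp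
    show "\<theta> \<in> perm_ball V \<theta>\<^sub>0 \<epsilon>"
    proof (cases "num_components \<theta> = num_components \<theta>\<^sub>0")
      case True
      have "dist_Theta \<theta> (permute_param (inv \<sigma>) \<theta>\<^sub>0) =
          dist_Theta (permute_param \<sigma> \<theta>) (permute_param \<sigma> (permute_param (inv \<sigma>) \<theta>\<^sub>0))"
        by (rule dist_Theta_permute[OF \<sigma>(1), symmetric])
      then have "dist_Theta \<theta> (permute_param (inv \<sigma>) \<theta>\<^sub>0) < \<epsilon>"
        using d by (simp add: permute_param_inv[OF \<sigma>(1)])
      moreover have "inv \<sigma> permutes {..<num_components \<theta>\<^sub>0}"
        using permutes_inv[OF \<sigma>(1)] True by simp
      ultimately show ?thesis using \<theta>' by (auto simp: perm_ball_def)
    next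
      case False
      \<comment> \<open>Different numbers of components: the distance is 1, so \<open>\<epsilon>\<close> exceeds 1 and the ball contains everything.\<close>
      have far: "dist_Theta \<theta> \<theta>\<^sub>0 = 1" "dist_Theta (permute_param \<sigma> \<theta>) \<theta>\<^sub>0 = 1"
        using False by (auto simp: dist_Theta_def num_components_def permute_param_def split: prod.splits)
      have "permute_param id \<theta>\<^sub>0 = \<theta>\<^sub>0" by (auto simp: permute_param_def split: prod.splits)
      then have "dist_Theta \<theta> (permute_param id \<theta>\<^sub>0) < \<epsilon>" using far d by simp
      then show ?thesis
        using \<theta>' permutes_id[of "{..<num_components \<theta>\<^sub>0}"] by (auto simp: perm_ball_def intro!: exI[of _ id])
    qed
  qed
  ultimately show ?thesis using W(1) by blast
qed

lemma perm_ball_num_components: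
  assumes "\<theta> \<in> perm_ball V \<theta>\<^sub>0 1"
  shows "num_components \<theta> = num_components \<theta>\<^sub>0"
  using assms by (auto simp: perm_ball_def dist_Theta_def num_components_def permute_param_def
      split: prod.splits if_splits)

lemma LIMSEQ_iff_inverse_Suc:
  fixes X :: "nat \<Rightarrow> real"
  shows "X \<longlonglongrightarrow> L \<longleftrightarrow> (\<forall>m::nat. \<exists>n0::nat. \<forall>n::nat. n0 \<le> n \<longrightarrow> \<bar>X n - L\<bar> < 1 / Suc m)"
proof
  assume "X \<longlonglongrightarrow> L"
  then show "\<forall>m::nat. \<exists>n0::nat. \<forall>n::nat. n0 \<le> n \<longrightarrow> \<bar>X n - L\<bar> < 1 / Suc m"
    using LIMSEQ_D[of X L] by (auto simp: real_norm_def) 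
next
  assume *: "\<forall>m::nat. \<exists>n0::nat. \<forall>n::nat. n0 \<le> n \<longrightarrow> \<bar>X n - L\<bar> < 1 / Suc m"
  show "X \<longlonglongrightarrow> L"
  proof (rule LIMSEQ_I)
    fix r :: real assume "r > 0"
    then obtain m where m: "1 / Suc m < r" using nat_approx_posE by auto
    from *[rule_format, of m] obtain n0 where "\<forall>n\<ge>n0. \<bar>X n - L\<bar> < 1 / Suc m" by blast
    then show "\<exists>n0. \<forall>n\<ge>n0. norm (X n - L) < r" using m by (intro exI[of _ n0]) (auto intro: less_trans)
  qed
qed

lemma sets_Collect_tendsto:
  fixes f :: "nat \<Rightarrow> 'a \<Rightarrow> real"
  assumes f: "\<And>n. f n \<in> borel_measurable S" and g: "g \<in> borel_measurable S"
  shows "{x \<in> space S. (\<lambda>n. f n x) \<longlonglongrightarrow> g x} \<in> sets S"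
proof -
  have "{x \<in> space S. \<bar>f n x - g x\<bar> < 1 / Suc m} \<in> sets S" for n m
    by (intro borel_measurable_less borel_measurable_abs borel_measurable_diff borel_measurable_const f g)
  then have "{x \<in> space S. \<forall>m::nat. \<exists>n0::nat. \<forall>n::nat. n0 \<le> n \<longrightarrow> \<bar>f n x - g x\<bar> < 1 / Suc m} \<in> sets S"
    by (intro sets.sets_Collect_countable_All sets.sets_Collect_countable_Ex sets.sets_Collect_imp sets.sets_Collect_const)
  then show ?thesis by (simp only: LIMSEQ_iff_inverse_Suc)
qed

section \<open>Consistency\<close>

locale consistent_setting = identifiable_mixture V \<X> F \<pi> D G N
  for V :: "'v::euclidean_space set" and \<X> :: "'x::polish_space set" and F \<pi> D G N +
  fixes Q :: "nat \<Rightarrow> (nat \<Rightarrow> 'x) \<Rightarrow> 'v param measure"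
  assumes Q: "\<And>n. 1 \<le> n \<Longrightarrow>
      regular_cond_distr M (Pi\<^sub>M {..<n} (\<lambda>_. N)) (\<lambda>\<omega>. obs n (snd \<omega>)) (borel_Theta V) fst (Q n)"
begin

lemma posterior_prob:
  assumes "1 \<le> n" "x \<in> space seqs"
  shows "prob_space (Q n (obs n x))" "sets (Q n (obs n x)) = sets (borel_Theta V)"
proof -
  have "Q n \<in> Pi\<^sub>M {..<n} (\<lambda>_. N) \<rightarrow>\<^sub>M prob_algebra (borel_Theta V)"
    using Q[OF assms(1)] by (simp add: regular_cond_distr_def)
  from measurable_space[OF measurable_compose[OF obs_measurable this] assms(2)]
  show "prob_space (Q n (obs n x))" "sets (Q n (obs n x)) = sets (borel_Theta V)"
    by (simp_all add: space_prob_algebra)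
qed

lemma posterior_measurable:
  assumes "B \<in> sets (borel_Theta V)"
  shows "(\<lambda>\<omega>. measure (Q (Suc n) (obs (Suc n) (snd \<omega>))) B) \<in> borel_measurable (borel_Theta V \<Otimes>\<^sub>M seqs)"
proof -
  have "Q (Suc n) \<in> Pi\<^sub>M {..<Suc n} (\<lambda>_. N) \<rightarrow>\<^sub>M prob_algebra (borel_Theta V)"
    using Q[of "Suc n"] by (simp add: regular_cond_distr_def)
  from measurable_compose[OF this measurable_measure_prob_algebra[OF assms]]
  show ?thesis
    by (rule measurable_compose[OF measurable_compose[OF measurable_snd obs_measurable]])
qed

text \<open>
  The index is shifted because \<open>Q 0\<close> is arbitrary, in particular possibly not measurable.
\<close>

definition good :: "(nat \<Rightarrow> 'v param set) \<Rightarrow> 'v param \<Rightarrow> (nat \<Rightarrow> 'x) \<Rightarrow> bool" where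
  "good B \<theta> x \<longleftrightarrow> (\<forall>j. (\<lambda>n. measure (Q (Suc n) (obs (Suc n) x)) (B j)) \<longlonglongrightarrow> indicator (B j) \<theta>)"

lemma good_sets:
  assumes B: "\<And>j. B j \<in> sets (borel_Theta V)"
  shows "{\<omega> \<in> space (borel_Theta V \<Otimes>\<^sub>M seqs). good B (fst \<omega>) (snd \<omega>)} \<in> sets (borel_Theta V \<Otimes>\<^sub>M seqs)"
  unfolding good_def
  by (intro sets.sets_Collect_countable_All sets_Collect_tendsto posterior_measurable B
      measurable_compose[OF measurable_fst borel_measurable_indicator[OF B]])

text \<open>
  Invariance holds because neither the law of the data nor membership in \<open>B j\<close> changes when \<open>\<theta>\<close> is
  permuted. That \<open>\<Theta>s\<close> has full prior probability is Doob's argument: almost sure convergence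
  under the joint law is, by Fubini, convergence for almost every \<open>\<theta>\<close>.
\<close>

lemma consistent_parameters:
  assumes B: "\<And>j. B j \<in> sets (borel_Theta V)" and inv: "\<And>j. perm_invariant (B j)"
  defines "\<Theta>s \<equiv> {\<theta> \<in> Theta V. AE x in data \<theta>. good B \<theta> x}"
  shows "\<Theta>s \<in> sets (borel_Theta V)" "perm_invariant \<Theta>s" "AE \<theta> in \<mu>. \<theta> \<in> \<Theta>s"
proof -
  let ?G = "\<lambda>\<theta>. {x \<in> space seqs. good B \<theta> x}"
  have "(SIGMA \<theta>:space (borel_Theta V). ?G \<theta>) = {\<omega> \<in> space (borel_Theta V \<Otimes>\<^sub>M seqs). good B (fst \<omega>) (snd \<omega>)}"
    by (auto simp: space_pair_measure)
  then have G: "(SIGMA \<theta>:space (borel_Theta V). ?G \<theta>) \<in> sets (borel_Theta V \<Otimes>\<^sub>M seqs)"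
    using good_sets[OF B] by simp
  have G_sec: "?G \<theta> \<in> sets seqs" if "\<theta> \<in> Theta V" for \<theta>
  proof -
    have "Pair \<theta> -` (SIGMA \<theta>:space (borel_Theta V). ?G \<theta>) = ?G \<theta>" using that by auto
    then show ?thesis using sets_Pair1[OF G, of \<theta>] by simp
  qed
  have iff: "measure (data \<theta>) (?G \<theta>) = 1 \<longleftrightarrow> (AE x in data \<theta>. good B \<theta> x)" if "\<theta> \<in> Theta V" for \<theta>
  proof -
    interpret prob_space "data \<theta>" by (rule data_prob[OF that])
    have "space (data \<theta>) = space seqs" by (rule sets_eq_imp_space_eq[OF data_prob(2)[OF that]])
    then show ?thesis
      using prob_Collect_eq_1[of "good B \<theta>"] G_sec[OF that] data_prob(2)[OF that] by simp
  qed
  have "(\<lambda>\<theta>. measure (data \<theta>) (?G \<theta>)) \<in> borel_measurable (borel_Theta V)"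
    by (rule measure_measurable_prob_algebra2[OF G data_kernel])
  then have "{\<theta> \<in> space (borel_Theta V). measure (data \<theta>) (?G \<theta>) = 1} \<in> sets (borel_Theta V)"
    by (intro measurable_equality_set borel_measurable_const)
  also have "{\<theta> \<in> space (borel_Theta V). measure (data \<theta>) (?G \<theta>) = 1} = \<Theta>s"
    unfolding \<Theta>s_def using iff by auto
  finally show \<Theta>s: "\<Theta>s \<in> sets (borel_Theta V)" .
  show "perm_invariant \<Theta>s"
    unfolding perm_invariant_def
  proof (intro ballI allI impI)
    fix \<theta> \<sigma> assume \<theta>: "\<theta> \<in> \<Theta>s" and \<sigma>: "\<sigma> permutes {..<num_components \<theta>}"
    have "permute_param \<sigma> \<theta> \<in> B j \<longleftrightarrow> \<theta> \<in> B j" for j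
    proof
      assume "permute_param \<sigma> \<theta> \<in> B j"
      then have "permute_param (inv \<sigma>) (permute_param \<sigma> \<theta>) \<in> B j"
        using inv[of j] permutes_inv[OF \<sigma>] by (simp add: perm_invariant_def)
      then show "\<theta> \<in> B j" by (simp add: permute_param_inv[OF \<sigma>])
    qed (use inv[of j] \<sigma> in \<open>simp add: perm_invariant_def\<close>)
    then have "good B (permute_param \<sigma> \<theta>) = good B \<theta>"
      by (simp add: good_def fun_eq_iff indicator_def)
    moreover have "data (permute_param \<sigma> \<theta>) = data \<theta>"
      by (simp only: mixture_param_permute[OF \<sigma>])
    moreover have "permute_param \<sigma> \<theta> \<in> Theta V"
      using \<theta> by (intro permute_param_Theta[OF _ \<sigma>]) (simp add: \<Theta>s_def)
    ultimately show "permute_param \<sigma> \<theta> \<in> \<Theta>s"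
      using \<theta> by (simp only: \<Theta>s_def mem_Collect_eq)
  qed
  have "AE \<omega> in M. \<forall>j. (\<lambda>n. measure (Q (Suc n) (obs (Suc n) (snd \<omega>))) (B j)) \<longlonglongrightarrow> indicator (B j) (fst \<omega>)"
    unfolding AE_all_countable
  proof
    fix j
    obtain C where C: "C \<in> sets seqs" "AE \<omega> in M. fst \<omega> \<in> B j \<longleftrightarrow> snd \<omega> \<in> C"
      by (rule invariant_event_determined_by_data[OF B inv, THEN bexE])
    have "AE \<omega> in M. (\<lambda>n. measure (Q n (obs n (snd \<omega>))) (B j)) \<longlonglongrightarrow> indicator (B j) (fst \<omega>)"
      by (rule posterior_tendsto[OF _ B C]) (rule Q)
    then show "AE \<omega> in M. (\<lambda>n. measure (Q (Suc n) (obs (Suc n) (snd \<omega>))) (B j)) \<longlonglongrightarrow> indicator (B j) (fst \<omega>)"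
      by eventually_elim (rule LIMSEQ_Suc)
  qed
  then have "AE \<omega> in M. good B (fst \<omega>) (snd \<omega>)" by (simp add: good_def)
  moreover have "{\<omega> \<in> space M. good B (fst \<omega>) (snd \<omega>)} \<in> sets M"
    unfolding sets_M sets_eq_imp_space_eq[OF sets_M] by (rule good_sets[OF B])
  ultimately have "AE \<theta> in \<mu>. AE x in data \<theta>. good B \<theta> x"
    using AE_model[of "\<lambda>\<omega>. good B (fst \<omega>) (snd \<omega>)"] by simp
  then show "AE \<theta> in \<mu>. \<theta> \<in> \<Theta>s"
    using AE_space by eventually_elim (simp add: \<Theta>s_def space_prior)
qed

lemma posterior_ball_tendsto:
  assumes basis: "topological_basis \<B>" "range Bs = \<B>" and B: "\<And>j. B j = saturation V (Bs j)"
    and \<theta>: "\<theta>\<^sub>0 \<in> Theta V" and good: "good B \<theta>\<^sub>0 x" and x: "x \<in> space seqs" and \<epsilon>: "\<epsilon> > 0"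
  shows "(\<lambda>n. measure (Q n (obs n x)) (perm_ball V \<theta>\<^sub>0 \<epsilon>)) \<longlonglongrightarrow> 1"
proof -
  obtain W where W: "W \<in> \<B>" "\<theta>\<^sub>0 \<in> saturation V W" "saturation V W \<subseteq> perm_ball V \<theta>\<^sub>0 \<epsilon>"
    using saturation_in_perm_ball[OF basis(1) \<theta> \<epsilon>] by (elim bexE conjE)
  then obtain j where j: "B j = saturation V W" using basis(2) B by auto
  have lim: "(\<lambda>n. measure (Q (Suc n) (obs (Suc n) x)) (B j)) \<longlonglongrightarrow> 1"
    using good W(2) j unfolding good_def by (auto dest!: spec[of _ j])
  have "(\<lambda>n. measure (Q (Suc n) (obs (Suc n) x)) (perm_ball V \<theta>\<^sub>0 \<epsilon>)) \<longlonglongrightarrow> 1"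
  proof (rule tendsto_sandwich[OF _ _ lim tendsto_const])
    have "measure (Q (Suc n) (obs (Suc n) x)) (B j) \<le> measure (Q (Suc n) (obs (Suc n) x)) (perm_ball V \<theta>\<^sub>0 \<epsilon>)
        \<and> measure (Q (Suc n) (obs (Suc n) x)) (perm_ball V \<theta>\<^sub>0 \<epsilon>) \<le> 1" for n
    proof -
      interpret prob_space "Q (Suc n) (obs (Suc n) x)" by (rule posterior_prob[OF _ x]) simp
      have "sets (Q (Suc n) (obs (Suc n) x)) = sets (borel_Theta V)" by (rule posterior_prob[OF _ x]) simp
      then show ?thesis
        using perm_ball_sets[OF \<theta>] W(3) j by (auto intro!: finite_measure_mono)
    qed
    then show "\<forall>\<^sub>F n in sequentially. measure (Q (Suc n) (obs (Suc n) x)) (B j) \<le> measure (Q (Suc n) (obs (Suc n) x)) (perm_ball V \<theta>\<^sub>0 \<epsilon>)"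
      "\<forall>\<^sub>F n in sequentially. measure (Q (Suc n) (obs (Suc n) x)) (perm_ball V \<theta>\<^sub>0 \<epsilon>) \<le> 1"
      by simp_all
  qed
  then show ?thesis by (rule LIMSEQ_imp_Suc)
qed

lemma posterior_num_components_tendsto:
  assumes \<theta>: "\<theta>\<^sub>0 \<in> Theta V" and x: "x \<in> space seqs"
    and lim: "(\<lambda>n. measure (Q n (obs n x)) (perm_ball V \<theta>\<^sub>0 1)) \<longlonglongrightarrow> 1"
  shows "(\<lambda>n. \<P>(\<theta> in Q n (obs n x). num_components \<theta> = num_components \<theta>\<^sub>0)) \<longlonglongrightarrow> 1"
proof (rule tendsto_sandwich[OF _ _ lim tendsto_const])
  have "measure (Q n (obs n x)) (perm_ball V \<theta>\<^sub>0 1) \<le> \<P>(\<theta> in Q n (obs n x). num_components \<theta> = num_components \<theta>\<^sub>0)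
      \<and> \<P>(\<theta> in Q n (obs n x). num_components \<theta> = num_components \<theta>\<^sub>0) \<le> 1" if "1 \<le> n" for n
  proof -
    interpret prob_space "Q n (obs n x)" by (rule posterior_prob[OF that x])
    have sets: "sets (Q n (obs n x)) = sets (borel_Theta V)" by (rule posterior_prob[OF that x])
    have space: "space (Q n (obs n x)) = Theta V" using sets_eq_imp_space_eq[OF sets] by simp
    have "fst -` {num_components \<theta>\<^sub>0} \<inter> space (borel_Theta V) \<in> sets (borel_Theta V)"
      by (rule measurable_sets[OF measurable_Theta_coords(1)]) simp
    also have "fst -` {num_components \<theta>\<^sub>0} \<inter> space (borel_Theta V) =
        {\<theta> \<in> space (Q n (obs n x)). num_components \<theta> = num_components \<theta>\<^sub>0}"
      unfolding space by (auto simp: num_components_def)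
    finally have meas: "{\<theta> \<in> space (Q n (obs n x)). num_components \<theta> = num_components \<theta>\<^sub>0} \<in> sets (Q n (obs n x))"
      unfolding sets .
    have "perm_ball V \<theta>\<^sub>0 1 \<subseteq> {\<theta> \<in> space (Q n (obs n x)). num_components \<theta> = num_components \<theta>\<^sub>0}"
    proof
      fix \<theta> assume \<theta>: "\<theta> \<in> perm_ball V \<theta>\<^sub>0 1"
      then have "\<theta> \<in> Theta V" by (auto simp: perm_ball_def)
      then show "\<theta> \<in> {\<theta> \<in> space (Q n (obs n x)). num_components \<theta> = num_components \<theta>\<^sub>0}"
        using perm_ball_num_components[OF \<theta>] by (simp add: space)
    qed
    from finite_measure_mono[OF this meas] show ?thesis by simp
  qed
  then show "\<forall>\<^sub>F n in sequentially. measure (Q n (obs n x)) (perm_ball V \<theta>\<^sub>0 1) \<le> \<P>(\<theta> in Q n (obs n x). num_components \<theta> = num_components \<theta>\<^sub>0)"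
    "\<forall>\<^sub>F n in sequentially. \<P>(\<theta> in Q n (obs n x). num_components \<theta> = num_components \<theta>\<^sub>0) \<le> 1"
    unfolding eventually_sequentially by (auto intro!: exI[of _ 1])
qed

end

theorem theorem3p2:
  fixes V :: "(real ^ 'd) set"
    and \<X> :: "'x::polish_space set"
    and F :: "real ^ 'd \<Rightarrow> 'x measure"
    and \<pi> :: "nat measure"
    and D :: "nat \<Rightarrow> (nat \<Rightarrow> real) measure"
    and G :: "nat \<Rightarrow> (nat \<Rightarrow> real ^ 'd) measure"
    and Q :: "nat \<Rightarrow> (nat \<Rightarrow> 'x) \<Rightarrow> (real ^ 'd) param measure"
  defines "N \<equiv> restrict_space borel \<X>"
    and "M \<equiv> model V (restrict_space borel \<X>) F \<pi> D G"
  assumes V: "V \<in> sets borel"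
    and \<X>: "\<X> \<in> sets borel"
    and F: "\<And>v. v \<in> V \<Longrightarrow> F v \<in> space (prob_algebra N)"
    and \<pi>: "\<pi> \<in> space (prob_algebra (count_space {1..}))"
    and D: "\<And>k. 1 \<le> k \<Longrightarrow> D k \<in> space (prob_algebra (borel_simplex k))"
    and G: "\<And>k. 1 \<le> k \<Longrightarrow> G k \<in> space (prob_algebra (borel_components V k))"
    and Q: "\<And>n. 1 \<le> n \<Longrightarrow>
      regular_cond_distr M (Pi\<^sub>M {..<n} (\<lambda>_. N)) (\<lambda>\<omega>. obs n (snd \<omega>)) (borel_Theta V) fst (Q n)"
    and cond1: "\<And>A. A \<in> sets N \<Longrightarrow>
      (\<lambda>v. measure (F v) A) \<in> borel_measurable (restrict_space borel V)"
    and cond2: "\<And>k k' w w' v v'.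
      \<lbrakk>1 \<le> k; 1 \<le> k'; w \<in> prob_simplex k; w' \<in> prob_simplex k'; v \<in> {..<k} \<rightarrow>\<^sub>E V; v' \<in> {..<k'} \<rightarrow>\<^sub>E V;
       mixture N F k w v = mixture N F k' w' v'\<rbrakk> \<Longrightarrow>
      mixture (restrict_space borel V) (return (restrict_space borel V)) k w v =
      mixture (restrict_space borel V) (return (restrict_space borel V)) k' w' v'"
    and cond3: "\<And>k. 1 \<le> k \<Longrightarrow> measure \<pi> {k} > 0"
    and cond4: "\<And>k A. \<lbrakk>1 \<le> k; A \<in> sets (borel_simplex k); measure (D k) A = 0\<rbrakk> \<Longrightarrow>
      emeasure (Pi\<^sub>M {..<k - 1} (\<lambda>_. lborel)) (drop_last_coord k ` A) = 0"
    and cond5: "\<And>k A. \<lbrakk>1 \<le> k; A \<in> sets (borel_components V k);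
       (\<Sum>\<sigma> | \<sigma> permutes {..<k}. \<P>(v in G k. (\<lambda>i. v (\<sigma> i)) \<in> A)) = 0\<rbrakk> \<Longrightarrow>
      emeasure (Pi\<^sub>M {..<k} (\<lambda>_. lborel)) A = 0"
    and cond6: "\<And>k i j. \<lbrakk>1 \<le> k; i < j; j < k\<rbrakk> \<Longrightarrow> \<P>(v in G k. v i = v j) = 0"
  shows "\<exists>\<Theta>s \<in> sets (borel_Theta V).
    \<P>(\<omega> in M. fst \<omega> \<in> \<Theta>s) = 1 \<and>
    lebesgue_Theta V (Theta V - \<Theta>s) = 0 \<and>
    (\<forall>\<theta>\<^sub>0 \<in> \<Theta>s.
      (\<forall>\<epsilon>>0. AE x in Pi\<^sub>M UNIV (\<lambda>_. mixture_param N F \<theta>\<^sub>0).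
         (\<lambda>n. measure (Q n (obs n x)) (perm_ball V \<theta>\<^sub>0 \<epsilon>)) \<longlonglongrightarrow> 1) \<and>
      (AE x in Pi\<^sub>M UNIV (\<lambda>_. mixture_param N F \<theta>\<^sub>0).
         (\<lambda>n. \<P>(\<theta> in Q n (obs n x). num_components \<theta> = num_components \<theta>\<^sub>0)) \<longlonglongrightarrow> 1))"
proof -
  interpret consistent_setting V \<X> F \<pi> D G N Q
  proof unfold_locales
    show "N = restrict_space borel \<X>" by (simp only: N_def)
    show "regular_cond_distr (model V N F \<pi> D G) (Pi\<^sub>M {..<n} (\<lambda>_. N)) (\<lambda>\<omega>. obs n (snd \<omega>)) (borel_Theta V) fst (Q n)"
      if "1 \<le> n" for n
      using Q[OF that] unfolding M_def N_def .
  qed (fact V F \<pi> D G cond1 cond2 cond6)+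
  have M: "M = model V N F \<pi> D G" unfolding M_def N_def ..
  obtain \<B> :: "(real ^ 'd) param set set" where \<B>: "countable \<B>" "topological_basis \<B>"
    using ex_countable_basis by auto
  have "\<B> \<noteq> {}" using topological_basisE[OF \<B>(2) open_UNIV UNIV_I] by blast
  then have range: "range (from_nat_into \<B>) = \<B>" using \<B>(1) by (rule range_from_nat_into)
  define B where "B j = saturation V (from_nat_into \<B> j)" for j
  have "from_nat_into \<B> j \<in> sets borel" for j
    using topological_basis_open[OF \<B>(2)] range by (intro borel_open) auto
  then have B_sets: "B j \<in> sets (borel_Theta V)" for j
    unfolding B_def by (rule saturation_sets[OF V])
  have B_inv: "perm_invariant (B j)" for j unfolding B_def by (rule saturation_invariant)
  define \<Theta>s where "\<Theta>s = {\<theta> \<in> Theta V. AE x in data \<theta>. good B \<theta> x}"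
  have \<Theta>s: "\<Theta>s \<in> sets (borel_Theta V)" "perm_invariant \<Theta>s" "AE \<theta> in \<mu>. \<theta> \<in> \<Theta>s"
    unfolding \<Theta>s_def by (rule consistent_parameters[OF B_sets B_inv])+
  show ?thesis
  proof (intro bexI[of _ \<Theta>s] conjI ballI allI impI)
    show "\<Theta>s \<in> sets (borel_Theta V)" by (rule \<Theta>s)
    show "\<P>(\<omega> in M. fst \<omega> \<in> \<Theta>s) = 1"
    proof -
      interpret M: prob_space M unfolding M by (rule prob_M)
      have meas: "{\<omega> \<in> space M. fst \<omega> \<in> \<Theta>s} \<in> sets M"
        using measurable_sets[OF fst_snd_measurable(1) \<Theta>s(1)] unfolding M
        by (simp add: vimage_def Int_def conj_commute)
      have "AE \<omega> in M. fst \<omega> \<in> \<Theta>s"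
        unfolding M AE_model[OF meas[unfolded M]] using \<Theta>s(3) by eventually_elim simp
      then show ?thesis by (simp add: M.prob_Collect_eq_1[OF meas])
    qed
    show "lebesgue_Theta V (Theta V - \<Theta>s) = 0"
    proof (rule lebesgue_Theta_null[OF V, where D = D and G = G])
      show E: "Theta V - \<Theta>s \<in> sets (borel_Theta V)"
        using sets.compl_sets[OF \<Theta>s(1)] by simp
      show "permute_param \<sigma> (k, w, v) \<in> Theta V - \<Theta>s"
        if "(k, w, v) \<in> Theta V - \<Theta>s" "\<sigma> permutes {..<k}" for k w v \<sigma>
      proof -
        have \<sigma>: "\<sigma> permutes {..<num_components (k, w, v)}" using that(2) by (simp add: num_components_def)
        have "permute_param \<sigma> (k, w, v) \<notin> \<Theta>s"
        proof
          assume a: "permute_param \<sigma> (k, w, v) \<in> \<Theta>s"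
          have "inv \<sigma> permutes {..<num_components (permute_param \<sigma> (k, w, v))}"
            using permutes_inv[OF \<sigma>] by simp
          with a \<Theta>s(2) have "permute_param (inv \<sigma>) (permute_param \<sigma> (k, w, v)) \<in> \<Theta>s"
            unfolding perm_invariant_def by blast
          then show False using that(1) by (simp add: permute_param_inv[OF \<sigma>])
        qed
        then show ?thesis using permute_param_Theta[OF _ \<sigma>, of V] that(1) by simp
      qed
      fix k :: nat assume k: "1 \<le> k"
      have "{\<theta> \<in> Theta V. \<theta> \<in> \<Theta>s} = \<Theta>s" using sets.sets_into_space[OF \<Theta>s(1)] by auto
      then have "AE k in \<pi>. AE (w, v) in D k \<Otimes>\<^sub>M G k. (k, w, v) \<in> \<Theta>s"
        using AE_prior[of "\<lambda>\<theta>. \<theta> \<in> \<Theta>s"] \<Theta>s(1,3) by simp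
      then obtain A where A: "{k \<in> space \<pi>. \<not> (AE (w, v) in D k \<Otimes>\<^sub>M G k. (k, w, v) \<in> \<Theta>s)} \<subseteq> A"
        "emeasure \<pi> A = 0" "A \<in> sets \<pi>" by (rule AE_E)
      have "AE (w, v) in D k \<Otimes>\<^sub>M G k. (k, w, v) \<in> \<Theta>s"
      \<comment> \<open>Every number of components has positive prior probability, so almost every one means every one.\<close>
      proof (rule ccontr)
        assume "\<not> ?thesis"
        then have "{k} \<subseteq> A" using A(1) k by (auto simp: space_\<pi>)
        then have "emeasure \<pi> {k} = 0" by (rule emeasure_eq_0[OF A(3,2)])
        then show False using cond3[OF k] by (simp add: measure_def)
      qed
      then show "AE (w, v) in D k \<Otimes>\<^sub>M G k. (k, w, v) \<notin> Theta V - \<Theta>s"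
        by eventually_elim auto
    qed (fact D G cond4 cond5)+
    fix \<theta>\<^sub>0 assume \<theta>\<^sub>0: "\<theta>\<^sub>0 \<in> \<Theta>s"
    then have \<theta>: "\<theta>\<^sub>0 \<in> Theta V" and good: "AE x in data \<theta>\<^sub>0. good B \<theta>\<^sub>0 x" by (auto simp: \<Theta>s_def)
    have "space (data \<theta>\<^sub>0) = space seqs" by (rule sets_eq_imp_space_eq[OF data_prob(2)[OF \<theta>]])
    then have space: "AE x in data \<theta>\<^sub>0. x \<in> space seqs" using AE_space[of "data \<theta>\<^sub>0"] by simp
    show ball: "AE x in Pi\<^sub>M UNIV (\<lambda>_. mixture_param N F \<theta>\<^sub>0).
         (\<lambda>n. measure (Q n (obs n x)) (perm_ball V \<theta>\<^sub>0 \<epsilon>)) \<longlonglongrightarrow> 1" if "\<epsilon> > 0" for \<epsilon>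
      using good space
      by eventually_elim (rule posterior_ball_tendsto[OF \<B>(2) range B_def \<theta> _ _ that])
    show "AE x in Pi\<^sub>M UNIV (\<lambda>_. mixture_param N F \<theta>\<^sub>0).
         (\<lambda>n. \<P>(\<theta> in Q n (obs n x). num_components \<theta> = num_components \<theta>\<^sub>0)) \<longlonglongrightarrow> 1"
      using ball[OF zero_less_one] space
      by eventually_elim (rule posterior_num_components_tendsto[OF \<theta>])
  qed
qed

end
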